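(* Let $k\geq 3$ be an integer. Every graph $G$ on $n$ vertices of odd girth at least $2k+1$ with $\mu_2(G)>\frac{4n}{6k-1}$ is bipartite.
   Context: All graphs are finite and simple, with at least two vertices. For a graph $G$ on $n$ vertices, with adjacency matrix $A(G)$ and diagonal degree matrix $D(G)$, the Laplacian matrix is $L(G)=D(G)-A(G)$; its eigenvalues (with multiplicity) are listed as $0=\mu_1(G)\le\mu_2(G)\le\cdots\le\mu_n(G)$, and $\mu_2(G)$ is the algebraic connectivity of $G$. The odd girth of $G$ is the length of a shortest odd cycle of $G$ (infinite if $G$ has no odd cycle); thus odd girth at least $2k+1$ means that $G$ contains no odd cycle of length less than $2k+1$. *)

theory Defs
  imports
    "Graph_Theory.Graph_Theory"
    "Jordan_Normal_Form.Char_Poly"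
    "HOL-Library.Extended_Nat"
begin

text \<open>
  A finite simple graph is a \<^locale>\<open>pair_graph\<close>: a finite vertex set with a symmetric, loop-free
  arc relation, so each undirected edge is represented by its two orientations. In particular the
  degree of a vertex is its \<^const>\<open>out_degree\<close>.

  Vertex sets are arbitrary, whereas matrices are indexed by initial segments of the naturals.
  The matrices below are therefore taken with respect to an enumeration \<open>vs\<close> of the vertices.
\<close>

definition vertex_enumeration :: "'a pair_pre_digraph \<Rightarrow> 'a list \<Rightarrow> bool" where
  "vertex_enumeration G vs \<longleftrightarrow> distinct vs \<and> set vs = pverts G"

definition adjacency_mat :: "'a pair_pre_digraph \<Rightarrow> 'a list \<Rightarrow> real mat" where
  "adjacency_mat G vs = mat (length vs) (length vs)
     (\<lambda>(i, j). if (vs ! i, vs ! j) \<in> parcs G then 1 else 0)"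

definition degree_mat :: "'a pair_pre_digraph \<Rightarrow> 'a list \<Rightarrow> real mat" where
  "degree_mat G vs = mat (length vs) (length vs)
     (\<lambda>(i, j). if i = j then real (out_degree (with_proj G) (vs ! i)) else 0)"

definition laplacian_mat :: "'a pair_pre_digraph \<Rightarrow> 'a list \<Rightarrow> real mat" where
  "laplacian_mat G vs = degree_mat G vs - adjacency_mat G vs"

definition laplacian_char_poly :: "'a pair_pre_digraph \<Rightarrow> real poly" where
  "laplacian_char_poly G = char_poly (laplacian_mat G (SOME vs. vertex_enumeration G vs))"

text \<open>The choice of the enumeration is immaterial.\<close>

lemma laplacian_mat_carrier: "laplacian_mat G vs \<in> carrier_mat (length vs) (length vs)"
  by (rule carrier_matI) (simp_all add: laplacian_mat_def degree_mat_def adjacency_mat_def)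

lemma char_poly_laplacian_mat_cong:
  assumes "vertex_enumeration G vs" "vertex_enumeration G ws"
  shows "char_poly (laplacian_mat G vs) = char_poly (laplacian_mat G ws)"
proof -
  define n where "n = length vs"
  have d: "distinct vs" "distinct ws" and s: "set vs = set ws"
    using assms by (auto simp: vertex_enumeration_def)
  have n': "length ws = n"
    using d s by (metis distinct_card n_def)
  let ?L = "laplacian_mat G vs" and ?M = "laplacian_mat G ws"
  define P :: "real mat" where "P = mat n n (\<lambda>(i, j). if vs ! i = ws ! j then 1 else 0)"
  define Q :: "real mat" where "Q = mat n n (\<lambda>(i, j). if ws ! i = vs ! j then 1 else 0)"
  have "\<exists>j<n. ws ! j = vs ! i" if "i < n" for i
    using that s n' n_def by (metis in_set_conv_nth nth_mem)
  then obtain f where f: "\<And>i. i < n \<Longrightarrow> f i < n" "\<And>i. i < n \<Longrightarrow> ws ! f i = vs ! i"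
    by metis
  have P_entry: "(vs ! i = ws ! j) = (j = f i)" if "i < n" "j < n" for i j
    using that f d n' by (metis nth_eq_iff_index_eq)
  have Q_entry: "(ws ! j = vs ! i) = (j = f i)" if "i < n" "j < n" for i j
    using P_entry[OF that] by metis
  have f_inj: "(f i = f j) = (i = j)" if "i < n" "j < n" for i j
    using that f d n_def by (metis nth_eq_iff_index_eq)
  have "\<exists>i<n. vs ! i = ws ! j" if "j < n" for j
    using that s n' n_def by (metis in_set_conv_nth nth_mem)
  then obtain g where g: "\<And>j. j < n \<Longrightarrow> g j < n" "\<And>j. j < n \<Longrightarrow> vs ! g j = ws ! j"
    by metis
  have fg: "(j = f i) = (i = g j)" if "i < n" "j < n" for i j
    using that f g d n' n_def by (metis nth_eq_iff_index_eq)
  have c[simp]: "?L \<in> carrier_mat n n" "?M \<in> carrier_mat n n"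
    "P \<in> carrier_mat n n" "Q \<in> carrier_mat n n"
    using laplacian_mat_carrier[of G vs] laplacian_mat_carrier[of G ws]
    by (simp_all add: n' n_def P_def Q_def)
  note dims[simp] = carrier_matD[OF c(1)] carrier_matD[OF c(2)]
    carrier_matD[OF c(3)] carrier_matD[OF c(4)]
  have Pi: "P $$ (i, j) = (if j = f i then 1 else 0)" if "i < n" "j < n" for i j
    using that P_entry by (simp add: P_def)
  have Qi: "Q $$ (i, j) = (if i = f j then 1 else 0)" if "i < n" "j < n" for i j
    using that Q_entry by (simp add: Q_def)
  have PA: "(P * A) $$ (i, j) = A $$ (f i, j)"
    if "A \<in> carrier_mat n n" "i < n" "j < n" for A i j
  proof -
    have "(P * A) $$ (i, j) = (\<Sum>k\<in>{0..<n}. P $$ (i, k) * A $$ (k, j))"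
      using that by (simp add: scalar_prod_def)
    also have "\<dots> = (\<Sum>k\<in>{0..<n}. if k = f i then A $$ (k, j) else 0)"
      using that by (intro sum.cong) (auto simp: Pi)
    also have "\<dots> = A $$ (f i, j)" using that f(1) by simp
    finally show ?thesis .
  qed
  have AQ: "(A * Q) $$ (i, j) = A $$ (i, f j)"
    if "A \<in> carrier_mat n n" "i < n" "j < n" for A i j
  proof -
    have "(A * Q) $$ (i, j) = (\<Sum>k\<in>{0..<n}. A $$ (i, k) * Q $$ (k, j))"
      using that by (simp add: scalar_prod_def)
    also have "\<dots> = (\<Sum>k\<in>{0..<n}. if k = f j then A $$ (i, k) else 0)"
      using that by (intro sum.cong) (auto simp: Qi)
    also have "\<dots> = A $$ (i, f j)" using that f(1) by simp
    finally show ?thesis .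
  qed
  have PQ: "P * Q = 1\<^sub>m n"
    by (rule eq_matI) (auto simp: PA[OF c(4)] Qi f(1) f_inj simp del: index_mult_mat(1))
  have QP: "Q * P = 1\<^sub>m n"
    by (rule mat_mult_left_right_inverse[OF c(3,4) PQ])
  have L: "?L = P * ?M * Q"
  proof (rule eq_matI)
    fix i j assume "i < dim_row (P * ?M * Q)" "j < dim_col (P * ?M * Q)"
    then have ij: "i < n" "j < n" by auto
    have "(P * ?M * Q) $$ (i, j) = (P * ?M) $$ (i, f j)"
      by (rule AQ[OF _ ij]) (rule mult_carrier_mat[OF c(3,2)])
    also have "\<dots> = ?M $$ (f i, f j)"
      by (rule PA[OF c(2) ij(1) f(1)[OF ij(2)]])
    also have "\<dots> = ?L $$ (i, j)"
      using ij f n' n_def f_inj by (simp add: laplacian_mat_def degree_mat_def adjacency_mat_def)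
    finally show "?L $$ (i, j) = (P * ?M * Q) $$ (i, j)" by simp
  qed auto
  have "similar_mat ?L ?M"
    unfolding similar_mat_def
    by (intro exI, rule similar_mat_witI[OF PQ QP L c])
  then show ?thesis by (rule char_poly_similar)
qed

lemma laplacian_char_poly_eq:
  assumes "vertex_enumeration G vs"
  shows "laplacian_char_poly G = char_poly (laplacian_mat G vs)"
  unfolding laplacian_char_poly_def
  by (rule char_poly_laplacian_mat_cong[OF someI[of "vertex_enumeration G", OF assms] assms])

text \<open>
  The eigenvalues in nondecreasing order, each repeated according to its multiplicity as a root
  of the characteristic polynomial; \<open>laplacian_eigenvalue G i\<close> uses 1-based indices.
\<close>

definition laplacian_spectrum :: "'a pair_pre_digraph \<Rightarrow> real list" where
  "laplacian_spectrum G = sorted_list_of_multiset (proots (laplacian_char_poly G))"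

definition laplacian_eigenvalue :: "'a pair_pre_digraph \<Rightarrow> nat \<Rightarrow> real" where
  "laplacian_eigenvalue G i = laplacian_spectrum G ! (i - 1)"

definition algebraic_connectivity :: "'a pair_pre_digraph \<Rightarrow> real" where
  "algebraic_connectivity G = laplacian_eigenvalue G 2"

text \<open>
  \<^const>\<open>pre_digraph.cycle\<close> also admits the closed walks \<open>u, v, u\<close> along a single edge. They have
  length 2, so the cycles of odd length are exactly the (oriented) odd cycles of the graph.
  The infimum of the empty set is \<open>\<infinity>\<close>.
\<close>

definition odd_girth :: "'a pair_pre_digraph \<Rightarrow> enat" where
  "odd_girth G = Inf {enat (length p) | p. pre_digraph.cycle (with_proj G) p \<and> odd (length p)}"

definition bipartite :: "'a pair_pre_digraph \<Rightarrow> bool" where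
  "bipartite G \<longleftrightarrow> (\<exists>X Y. X \<union> Y = pverts G \<and> X \<inter> Y = {} \<and>
     (\<forall>(u, v) \<in> parcs G. u \<in> X \<and> v \<in> Y \<or> u \<in> Y \<and> v \<in> X))"

end

(*
  Let g = 2k + 1 be the length of a shortest odd closed walk c_0, ..., c_2k; enlarging k only weakens
  the hypothesis on the algebraic connectivity. Put q = 6k - 1. A vertex is adjacent to at most two
  of the c_j and joined to at most three of them by walks of length 2, in one of nine patterns.

  For k >= 7 the distance to c_0, cut off at k, contradicts the spectral gap: its energy is at most
  the number of edges, which is small because adjacent vertices have a small degree sum, and its
  variance is large because the balls contain disjoint neighbourhoods of circuit vertices.

  For k = 3, 4, 5, 6 choose the circuit with the largest degree sum. For each j use the test vector
  with value -1 on the neighbours of c_j, 0 on the vertices joined to c_j by a walk of length 2,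
  and 2 elsewhere. Exchanging three consecutive circuit vertices bounds the degree of a vertex by
  circuit degrees, depending on its pattern. Adding the gap inequalities over all j, these degree
  bounds, and nonnegative multiples of q deg c_j - 4n >= 0 and of products of two such terms, yields
  an inequality "sum of K(w, w') over all pairs <= 0", where K depends only on the two patterns and
  their relative position. Multipliers found by linear programming make K(w, w') + K(w', w) positive
  in all the finitely many cases.
*)

theory Submission
  imports Defs "HOL-Analysis.Function_Topology"
begin

section \<open>Minimising the Rayleigh quotient\<close>

text \<open>Why everything becomes a sum over pairs: \<open>n\<close> times the sum of the
  \<open>(f v)^2\<close> minus the square of the sum of the \<open>f v\<close> is half the double
  sum of the \<open>(f v - f w)^2\<close>; \<open>n\<close> is the sum of 1 over all
  \<open>w'\<close>; and \<open>deg (c j)\<close> is the sum over \<open>w'\<close> of the indicator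
  that \<open>w'\<close> is adjacent to \<open>c j\<close>. So once an energy is linear in the
  degrees, and each degree is bounded by circuit degrees and \<open>n\<close>, the gap inequality is
  a statement about ordered pairs of vertices. The linearity is where the odd girth enters the small
  cases: no edge joins two neighbours of \<open>c j\<close>, nor two vertices that both have a walk
  of length 2 to \<open>c j\<close>. The unit of all counting, \<open>4 n \<le> q deg v\<close>, is
  Fiedler's bound of the algebraic connectivity by a vertex cut, here the set of neighbours of
  \<open>v\<close>. The circuit has at least 7 points. Together with parity this turns congruences
  between short offsets into equalities, which is why there are so few patterns.\<close>

lemma compact_pm_one_box:
  "compact {x :: 'a \<Rightarrow> real. (\<forall>i\<in>V. \<bar>x i\<bar> \<le> 1) \<and> (\<forall>i. i \<notin> V \<longrightarrow> x i = 0)}"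
proof -
  let ?S = "\<lambda>i. if i \<in> V then {-1..1::real} else {0}"
  have "compactin (product_topology (\<lambda>_. euclidean) UNIV) (PiE UNIV ?S)"
    unfolding compactin_PiE by (auto simp: compactin_euclidean_iff)
  then have "compact (PiE UNIV ?S)"
    by (simp add: euclidean_product_topology compactin_euclidean_iff)
  moreover have "PiE UNIV ?S = {x. (\<forall>i\<in>V. \<bar>x i\<bar> \<le> 1) \<and> (\<forall>i. i \<notin> V \<longrightarrow> x i = 0)}"
    by (auto simp: PiE_iff abs_le_iff split: if_splits; smt (verit))
  ultimately show ?thesis by simp
qed

text \<open>The first-order condition at a minimum, without derivatives: for small \<open>t\<close>
  of the sign opposite to \<open>b\<close> the linear term would outweigh the quadratic one.\<close>

lemma quadratic_nonneg_linear_coeff_zero: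
  fixes a b :: real
  assumes "\<And>t. 0 \<le> 2 * t * b + t\<^sup>2 * a"
  shows "b = 0"
proof (rule ccontr)
  assume b: "b \<noteq> 0"
  define s where "s = 1 / (\<bar>a\<bar> + 1)"
  have s: "s > 0" "s * a < 1"
    by (auto simp: s_def field_simps)
  have "2 * (- s * b) * b + (- s * b)\<^sup>2 * a = s * b\<^sup>2 * (s * a - 2)"
    by (simp add: power2_eq_square algebra_simps)
  also have "\<dots> < 0"
    using s b by (intro mult_pos_neg) auto
  finally show False using assms[of "- s * b"] by simp
qed

text \<open>The minimum of a quadratic form on the unit sphere of the hyperplane orthogonal to the
  constant vector is attained, and a minimizer is an eigenvector because the constant vector
  spans an invariant subspace.\<close>

lemma minimal_eigenvector_orthogonal_to_one:
  fixes L :: "'a \<Rightarrow> 'a \<Rightarrow> real"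
  assumes V: "finite V" "card V \<ge> 2"
    and sym: "\<And>u v. u \<in> V \<Longrightarrow> v \<in> V \<Longrightarrow> L u v = L v u"
    and zero: "\<And>u. u \<in> V \<Longrightarrow> (\<Sum>v\<in>V. L u v) = 0"
  obtains g \<rho> where "(\<Sum>v\<in>V. g v) = 0" "(\<Sum>v\<in>V. (g v)\<^sup>2) = 1"
    "\<And>u. u \<in> V \<Longrightarrow> (\<Sum>v\<in>V. L u v * g v) = \<rho> * g u"
    "\<And>f. (\<Sum>v\<in>V. f v) = 0 \<Longrightarrow> \<rho> * (\<Sum>v\<in>V. (f v)\<^sup>2) \<le> (\<Sum>u\<in>V. \<Sum>v\<in>V. L u v * f u * f v)"
proof -
  define Q where "Q f = (\<Sum>u\<in>V. \<Sum>v\<in>V. L u v * f u * f v)" for f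
  define B where "B = {x :: 'a \<Rightarrow> real. (\<forall>i\<in>V. \<bar>x i\<bar> \<le> 1) \<and> (\<forall>i. i \<notin> V \<longrightarrow> x i = 0)}"
  define S where "S = {x. (\<Sum>v\<in>V. x v) = 0} \<inter> ({x. (\<Sum>v\<in>V. (x v)\<^sup>2) = 1} \<inter> B)"
  have "closed {x :: 'a \<Rightarrow> real. (\<Sum>v\<in>V. x v) = 0}"
    "closed {x :: 'a \<Rightarrow> real. (\<Sum>v\<in>V. (x v)\<^sup>2) = 1}"
    by (intro closed_Collect_eq continuous_on_sum continuous_on_power continuous_on_const
        continuous_on_product_coordinates)+
  then have cS: "compact S"
    unfolding S_def B_def by (intro closed_Int_compact compact_pm_one_box)
  have "continuous_on UNIV Q"
    unfolding Q_def
    by (intro continuous_on_sum continuous_on_mult continuous_on_const continuous_on_product_coordinates)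
  then have contQ: "continuous_on S Q"
    by (rule continuous_on_subset) simp
  have in_S: "\<exists>h\<in>S. Q f = (\<Sum>v\<in>V. (f v)\<^sup>2) * Q h \<and> (\<forall>v\<in>V. f v = sqrt (\<Sum>v\<in>V. (f v)\<^sup>2) * h v)"
    if f: "(\<Sum>v\<in>V. f v) = 0" and pos: "(\<Sum>v\<in>V. (f v)\<^sup>2) > 0" for f
  proof -
    define r where "r = sqrt (\<Sum>v\<in>V. (f v)\<^sup>2)"
    have r: "r > 0" "r\<^sup>2 = (\<Sum>v\<in>V. (f v)\<^sup>2)" using pos by (auto simp: r_def)
    define h where "h v = (if v \<in> V then f v / r else 0)" for v
    have hsq: "(\<Sum>v\<in>V. (h v)\<^sup>2) = 1"
      using r pos by (simp add: h_def power_divide flip: sum_divide_distrib)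
    have "\<bar>h v\<bar> \<le> 1" if "v \<in> V" for v
    proof -
      have "(h v)\<^sup>2 \<le> (\<Sum>v\<in>V. (h v)\<^sup>2)"
        using that V by (intro member_le_sum) auto
      then show ?thesis using hsq by (simp add: abs_square_le_1)
    qed
    then have "h \<in> S"
      using f hsq by (auto simp: S_def B_def h_def simp flip: sum_divide_distrib)
    moreover have "Q f = r\<^sup>2 * Q h"
      unfolding Q_def sum_distrib_left using r(1)
      by (intro sum.cong refl) (simp add: h_def power2_eq_square)
    ultimately show ?thesis using r by (auto simp: h_def r_def[symmetric])
  qed
  obtain a b where ab: "a \<in> V" "b \<in> V" "a \<noteq> b"
    using card_le_Suc0_iff_eq[OF V(1)] V(2) by auto
  have "\<exists>f. (\<Sum>v\<in>V. f v) = 0 \<and> (\<Sum>v\<in>V. (f v)\<^sup>2) > (0::real)"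
  proof (intro exI conjI)
    let ?f = "\<lambda>v. (if v = a then 1 else 0) - (if v = b then 1 else (0::real))"
    show "(\<Sum>v\<in>V. ?f v) = 0" using ab V by (simp add: sum_subtractf)
    have "0 < (?f a)\<^sup>2" using ab by simp
    also have "\<dots> \<le> (\<Sum>v\<in>V. (?f v)\<^sup>2)" using ab V by (intro member_le_sum) auto
    finally show "0 < (\<Sum>v\<in>V. (?f v)\<^sup>2)" .
  qed
  then have "S \<noteq> {}" using in_S by blast
  then obtain g where g: "g \<in> S" "\<And>h. h \<in> S \<Longrightarrow> Q g \<le> Q h"
    using continuous_attains_inf[OF cS _ contQ] by blast
  define \<rho> where "\<rho> = Q g"
  have g0: "(\<Sum>v\<in>V. g v) = 0" and g1: "(\<Sum>v\<in>V. (g v)\<^sup>2) = 1" using g by (auto simp: S_def)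
  have min: "\<rho> * (\<Sum>v\<in>V. (f v)\<^sup>2) \<le> Q f" if f: "(\<Sum>v\<in>V. f v) = 0" for f
  proof (cases "(\<Sum>v\<in>V. (f v)\<^sup>2) = 0")
    case True
    then have "\<And>v. v \<in> V \<Longrightarrow> f v = 0" using V by (simp add: sum_nonneg_eq_0_iff)
    then have "Q f = 0" by (simp add: Q_def)
    with True show ?thesis by simp
  next
    case False
    then have pos: "(\<Sum>v\<in>V. (f v)\<^sup>2) > 0" by (simp add: less_le sum_nonneg)
    obtain h where h: "h \<in> S" "Q f = (\<Sum>v\<in>V. (f v)\<^sup>2) * Q h"
      using in_S[OF f pos] by blast
    have "\<rho> \<le> Q h" using g(2)[OF h(1)] by (simp add: \<rho>_def)
    then show ?thesis using h(2) pos by (simp add: mult.commute)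
  qed
  \<comment> \<open>\<open>w\<close> is the residual of the eigenvector equation. Symmetry and zero
    row sums make its entries sum to 0, so \<open>g + t w\<close> is an admissible competitor. The
    first variation of \<open>Q\<close> minus \<rho> times the squared norm along \<open>w\<close>
    is twice the squared norm of \<open>w\<close>, and minimality makes it vanish.\<close>
  define w where "w u = (\<Sum>v\<in>V. L u v * g v) - \<rho> * g u" for u
  have w0: "(\<Sum>u\<in>V. w u) = 0"
  proof -
    have "(\<Sum>u\<in>V. \<Sum>v\<in>V. L u v * g v) = (\<Sum>v\<in>V. \<Sum>u\<in>V. L u v * g v)"
      by (rule sum.swap)
    also have "\<dots> = (\<Sum>v\<in>V. (\<Sum>u\<in>V. L v u) * g v)"
      unfolding sum_distrib_right by (intro sum.cong refl) (simp add: sym)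
    also have "\<dots> = 0" using zero by simp
    finally show ?thesis using g0 by (simp add: w_def sum_subtractf flip: sum_distrib_left)
  qed
  have "(\<Sum>u\<in>V. (w u)\<^sup>2) = 0"
  proof (rule quadratic_nonneg_linear_coeff_zero)
    fix t :: real
    have cross: "(\<Sum>u\<in>V. \<Sum>v\<in>V. L u v * (g u * w v)) = (\<Sum>u\<in>V. \<Sum>v\<in>V. L u v * (w u * g v))"
      by (subst sum.swap) (intro sum.cong refl, simp add: sym mult_ac)
    have sp: "(\<Sum>v\<in>V. L u v * g v) = w u + \<rho> * g u" for u by (simp add: w_def)
    have bil: "(\<Sum>u\<in>V. \<Sum>v\<in>V. L u v * (w u * g v)) = (\<Sum>u\<in>V. (w u)\<^sup>2) + \<rho> * (\<Sum>u\<in>V. w u * g u)"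
    proof -
      have "(\<Sum>u\<in>V. \<Sum>v\<in>V. L u v * (w u * g v)) = (\<Sum>u\<in>V. w u * (\<Sum>v\<in>V. L u v * g v))"
        by (simp add: sum_distrib_left mult_ac)
      also have "\<dots> = (\<Sum>u\<in>V. (w u)\<^sup>2 + \<rho> * (w u * g u))"
        unfolding sp by (intro sum.cong refl) (simp add: power2_eq_square algebra_simps)
      finally show ?thesis by (simp add: sum.distrib sum_distrib_left)
    qed
    have "Q (\<lambda>v. g v + t * w v) = Q g + t * (\<Sum>u\<in>V. \<Sum>v\<in>V. L u v * (g u * w v))
        + t * (\<Sum>u\<in>V. \<Sum>v\<in>V. L u v * (w u * g v)) + t\<^sup>2 * Q w"
      unfolding Q_def sum_distrib_left sum.distrib[symmetric]
      by (intro sum.cong refl) (simp add: power2_eq_square algebra_simps)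
    then have Q: "Q (\<lambda>v. g v + t * w v)
        = \<rho> + 2 * t * ((\<Sum>u\<in>V. (w u)\<^sup>2) + \<rho> * (\<Sum>u\<in>V. w u * g u)) + t\<^sup>2 * Q w"
      unfolding cross bil by (simp add: \<rho>_def algebra_simps)
    have "(\<Sum>v\<in>V. (g v + t * w v)\<^sup>2)
        = (\<Sum>v\<in>V. (g v)\<^sup>2) + 2 * t * (\<Sum>v\<in>V. w v * g v) + t\<^sup>2 * (\<Sum>v\<in>V. (w v)\<^sup>2)"
      unfolding sum_distrib_left sum.distrib[symmetric]
      by (intro sum.cong refl) (simp add: power2_eq_square algebra_simps)
    moreover have "\<rho> * (\<Sum>v\<in>V. (g v + t * w v)\<^sup>2) \<le> Q (\<lambda>v. g v + t * w v)"
      using g0 w0 by (intro min) (simp add: sum.distrib flip: sum_distrib_left)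
    ultimately show "0 \<le> 2 * t * (\<Sum>u\<in>V. (w u)\<^sup>2) + t\<^sup>2 * (Q w - \<rho> * (\<Sum>v\<in>V. (w v)\<^sup>2))"
      using Q g1 by (simp add: algebra_simps)
  qed
  then have "w u = 0" if "u \<in> V" for u
    using V that by (simp add: sum_nonneg_eq_0_iff)
  then have "(\<Sum>v\<in>V. L u v * g v) = \<rho> * g u" if "u \<in> V" for u
    using that by (simp add: w_def)
  then show ?thesis using that[OF g0 g1] min unfolding Q_def by blast
qed

section \<open>The Rayleigh principle for the algebraic connectivity\<close>

text \<open>Index 1 holds the second smallest entry. Inclusion of multisets rather than membership
  matters when \<open>a = b\<close>: the value must then occur twice.\<close>

lemma sorted_nth_one_le:
  fixes a b :: "'a::linorder"
  assumes "sorted xs" "{#a, b#} \<subseteq># mset xs" "a \<le> b"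
  shows "xs ! 1 \<le> b"
proof (rule ccontr)
  assume *: "\<not> xs ! 1 \<le> b"
  have "2 \<le> size (mset xs)" using size_mset_mono[OF assms(2)] by simp
  then obtain y z ys where xs: "xs = y # z # ys"
    by (metis One_nat_def Suc_1 Suc_le_length_iff size_mset)
  have "filter (\<lambda>x. x \<le> b) ys = []" "\<not> z \<le> b"
    using * assms(1) by (auto simp: xs filter_empty_conv)
  then have "size (filter_mset (\<lambda>x. x \<le> b) (mset xs)) \<le> 1"
    by (simp add: xs flip: mset_filter)
  moreover have "size (filter_mset (\<lambda>x. x \<le> b) {#a, b#}) \<le> size (filter_mset (\<lambda>x. x \<le> b) (mset xs))"
    by (intro size_mset_mono multiset_filter_mono assms)
  ultimately show False using assms(3) by simp
qed

text \<open>In the basis \<open>(1, \<dots>, 1), e\<^sub>2, \<dots>, e\<^sub>n\<close> the matrix is block triangular.\<close>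

lemma char_poly_zero_row_sums:
  fixes A :: "real mat"
  assumes A: "A \<in> carrier_mat (Suc m) (Suc m)"
    and zero: "\<And>i. i < Suc m \<Longrightarrow> (\<Sum>j<Suc m. A $$ (i, j)) = 0"
  shows "char_poly A = [:0, 1:] * char_poly (mat m m (\<lambda>(i, j). A $$ (Suc i, Suc j) - A $$ (0, Suc j)))"
proof -
  define n where "n = Suc m"
  define B where "B = mat m m (\<lambda>(i, j). A $$ (Suc i, Suc j) - A $$ (0, Suc j))"
  define R where "R = mat 1 m (\<lambda>(i, j). A $$ (0, Suc j))"
  define M where "M = four_block_mat (0\<^sub>m 1 1) R (0\<^sub>m m 1) B"
  \<comment> \<open>The columns of \<open>P\<close> are the new basis and \<open>Q\<close> is its
    inverse. The first column of \<open>M\<close> vanishes because \<open>A\<close> kills the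
    constant vector.\<close>
  define P :: "real mat" where "P = mat n n (\<lambda>(i, j). if i = j \<or> j = 0 then 1 else 0)"
  define Q :: "real mat" where "Q = mat n n (\<lambda>(i, j). if i = j then 1 else if j = 0 then - 1 else 0)"
  have c[simp]: "A \<in> carrier_mat n n" "B \<in> carrier_mat m m" "R \<in> carrier_mat 1 m"
    "M \<in> carrier_mat n n" "P \<in> carrier_mat n n" "Q \<in> carrier_mat n n"
    using A by (auto simp: n_def B_def R_def M_def P_def Q_def)
  note d[simp] = carrier_matD[OF c(1)] carrier_matD[OF c(4)] carrier_matD[OF c(5)] carrier_matD[OF c(6)]
  have prod: "(X * Y) $$ (i, j) = (\<Sum>k<n. X $$ (i, k) * Y $$ (k, j))"
    if "X \<in> carrier_mat n n" "Y \<in> carrier_mat n n" "i < n" "j < n" for X Y :: "real mat" and i j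
    using that by (auto simp: scalar_prod_def lessThan_atLeast0)
  have split: "(\<Sum>k<n. h k) = h 0 + (\<Sum>k<m. h (Suc k))" for h :: "nat \<Rightarrow> real"
    unfolding n_def by (rule sum.lessThan_Suc_shift)
  have M_entry: "M $$ (i, j) = (if j = 0 then 0 else if i = 0 then A $$ (0, j) else A $$ (i, j) - A $$ (0, j))"
    if "i < n" "j < n" for i j
    using that by (auto simp: M_def B_def R_def n_def)
  have PQ: "P * Q = 1\<^sub>m n"
  proof (rule eq_matI)
    fix i j assume "i < dim_row (1\<^sub>m n)" "j < dim_col (1\<^sub>m n)"
    then have ij: "i < n" "j < n" by auto
    then have "(P * Q) $$ (i, j) = (\<Sum>k<n. (if k = 0 then Q $$ (0, j) else if k = i then Q $$ (i, j) else 0))"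
      unfolding prod[OF c(5,6) ij] by (intro sum.cong) (auto simp: P_def)
    also have "\<dots> = Q $$ (0, j) + (\<Sum>k<m. if Suc k = i then Q $$ (i, j) else 0)"
      unfolding split by simp
    also have "(\<Sum>k<m. if Suc k = i then Q $$ (i, j) else 0) = (if i = 0 then 0 else Q $$ (i, j))"
      using ij by (cases i) (auto simp: n_def)
    also have "Q $$ (0, j) + (if i = 0 then 0 else Q $$ (i, j)) = (1\<^sub>m n) $$ (i, j)"
      using ij by (auto simp: Q_def)
    finally show "(P * Q) $$ (i, j) = (1\<^sub>m n) $$ (i, j)" .
  qed auto
  have QP: "Q * P = 1\<^sub>m n"
    by (rule mat_mult_left_right_inverse[OF c(5,6) PQ])
  have AP: "A * P = P * M"
  proof (rule eq_matI)
    fix i j assume "i < dim_row (P * M)" "j < dim_col (P * M)"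
    then have ij: "i < n" "j < n" by auto
    have "(A * P) $$ (i, j) = (if j = 0 then 0 else A $$ (i, j))"
    proof (cases "j = 0")
      case True
      have "(A * P) $$ (i, j) = (\<Sum>k<n. A $$ (i, k))"
        unfolding prod[OF c(1,5) ij] using True ij by (intro sum.cong) (auto simp: P_def)
      then show ?thesis using True zero ij by (simp add: n_def)
    next
      case False
      have "(A * P) $$ (i, j) = (\<Sum>k<n. if k = j then A $$ (i, j) else 0)"
        unfolding prod[OF c(1,5) ij] using False ij by (intro sum.cong) (auto simp: P_def)
      then show ?thesis using False ij by simp
    qed
    moreover have "(P * M) $$ (i, j) = (\<Sum>k<n. (if k = 0 then M $$ (0, j) else if k = i then M $$ (i, j) else 0))"
      unfolding prod[OF c(5,4) ij] using ij by (intro sum.cong) (auto simp: P_def)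
    moreover have "\<dots> = M $$ (0, j) + (\<Sum>k<m. if Suc k = i then M $$ (i, j) else 0)"
      unfolding split by simp
    moreover have "(\<Sum>k<m. if Suc k = i then M $$ (i, j) else 0) = (if i = 0 then 0 else M $$ (i, j))"
      using ij by (cases i) (auto simp: n_def)
    ultimately show "(A * P) $$ (i, j) = (P * M) $$ (i, j)"
      using ij M_entry[of 0 j] M_entry[of i j] by (auto simp: n_def)
  qed auto
  have "A = A * (P * Q)" unfolding PQ by (rule right_mult_one_mat[OF c(1), symmetric])
  also have "\<dots> = A * P * Q" by (rule assoc_mult_mat[symmetric]) auto
  finally have "A = P * M * Q" unfolding AP .
  then have "similar_mat_wit A M P Q"
    by (rule similar_mat_witI[OF PQ QP]) auto
  then have "similar_mat A M"
    unfolding similar_mat_def by blast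
  then have "char_poly A = char_poly M" by (rule char_poly_similar)
  also have "\<dots> = char_poly (0\<^sub>m 1 1 :: real mat) * char_poly B"
    unfolding M_def by (rule char_poly_four_block_zeros_col[OF _ c(3,2)]) simp
  also have "char_poly (0\<^sub>m 1 1 :: real mat) = [:0, 1:]"
    by (simp add: char_poly_defs det_single)
  finally show ?thesis by (simp add: B_def)
qed

lemma (in pair_graph) parcs_symD: "(u, v) \<in> parcs G \<Longrightarrow> (v, u) \<in> parcs G"
  using pair_sym_arcs by (auto simp: symmetric_def dest: symD)

lemma (in pair_graph) out_degree_card: "out_degree (with_proj G) u = card {v. (u, v) \<in> parcs G}"
proof -
  have "out_arcs (with_proj G) u = Pair u ` {v. (u, v) \<in> parcs G}"
    by (auto simp: out_arcs_def)
  then show ?thesis by (simp add: out_degree_def card_image inj_on_def)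
qed

lemma (in pair_graph) laplacian_quadratic_form:
  defines "L \<equiv> \<lambda>u v. (if u = v then real (out_degree (with_proj G) u) else 0) - (if (u, v) \<in> parcs G then 1 else 0)"
  shows "(\<Sum>u\<in>pverts G. \<Sum>v\<in>pverts G. L u v * f u * f v) = (\<Sum>(u, v)\<in>parcs G. (f u - f v)\<^sup>2) / 2"
    and "u \<in> pverts G \<Longrightarrow> (\<Sum>v\<in>pverts G. L u v) = 0"
proof -
  have fin: "finite (pverts G)" by (rule pair_finite_verts)
  have sub: "parcs G \<subseteq> pverts G \<times> pverts G"
    using arc_fst_in_verts arc_snd_in_verts by fastforce
  have arcs: "(\<Sum>(u, v)\<in>parcs G. h u v) = (\<Sum>u\<in>pverts G. \<Sum>v\<in>pverts G. if (u, v) \<in> parcs G then h u v else 0)"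
    for h :: "'a \<Rightarrow> 'a \<Rightarrow> real"
  proof -
    have "(\<Sum>(u, v)\<in>parcs G. h u v) = (\<Sum>(u, v)\<in>pverts G \<times> pverts G. if (u, v) \<in> parcs G then h u v else 0)"
      using sub fin by (intro sum.mono_neutral_cong_left) auto
    then show ?thesis by (simp add: sum.cartesian_product)
  qed
  have deg: "real (out_degree (with_proj G) u) = (\<Sum>v\<in>pverts G. if (u, v) \<in> parcs G then 1 else 0)" for u
  proof -
    have "pverts G \<inter> {v. (u, v) \<in> parcs G} = {v. (u, v) \<in> parcs G}" using sub by auto
    then show ?thesis using fin by (simp add: out_degree_card sum.If_cases)
  qed
  show "(\<Sum>v\<in>pverts G. L u v) = 0" if "u \<in> pverts G"
    using that fin deg[of u] by (simp add: L_def sum_subtractf)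
  have d1: "(\<Sum>u\<in>pverts G. \<Sum>v\<in>pverts G. if (u, v) \<in> parcs G then (f u)\<^sup>2 else 0)
    = (\<Sum>u\<in>pverts G. real (out_degree (with_proj G) u) * (f u)\<^sup>2)"
    unfolding deg sum_distrib_right by (intro sum.cong refl) auto
  have d2: "(\<Sum>u\<in>pverts G. \<Sum>v\<in>pverts G. if (u, v) \<in> parcs G then (f v)\<^sup>2 else 0)
    = (\<Sum>u\<in>pverts G. real (out_degree (with_proj G) u) * (f u)\<^sup>2)"
    unfolding d1[symmetric] by (subst sum.swap) (intro sum.cong refl, auto dest: parcs_symD)
  have "(\<Sum>u\<in>pverts G. \<Sum>v\<in>pverts G. L u v * f u * f v)
      = (\<Sum>u\<in>pverts G. \<Sum>v\<in>pverts G. (if u = v then real (out_degree (with_proj G) u) * (f u)\<^sup>2 else 0)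
         - (if (u, v) \<in> parcs G then f u * f v else 0))"
    by (intro sum.cong refl) (auto simp: L_def power2_eq_square algebra_simps)
  also have "\<dots> = (\<Sum>u\<in>pverts G. real (out_degree (with_proj G) u) * (f u)\<^sup>2)
      - (\<Sum>u\<in>pverts G. \<Sum>v\<in>pverts G. if (u, v) \<in> parcs G then f u * f v else 0)"
    using fin by (simp add: sum_subtractf)
  also have "\<dots> = (\<Sum>u\<in>pverts G. \<Sum>v\<in>pverts G. if (u, v) \<in> parcs G then (f u - f v)\<^sup>2 else 0) / 2"
  proof -
    have "(\<Sum>u\<in>pverts G. \<Sum>v\<in>pverts G. if (u, v) \<in> parcs G then (f u - f v)\<^sup>2 else 0)
      = (\<Sum>u\<in>pverts G. \<Sum>v\<in>pverts G. (if (u, v) \<in> parcs G then (f u)\<^sup>2 else 0)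
         + (if (u, v) \<in> parcs G then (f v)\<^sup>2 else 0) - 2 * (if (u, v) \<in> parcs G then f u * f v else 0))"
      by (intro sum.cong refl) (auto simp: power2_eq_square algebra_simps)
    also have "\<dots> = 2 * (\<Sum>u\<in>pverts G. real (out_degree (with_proj G) u) * (f u)\<^sup>2)
      - 2 * (\<Sum>u\<in>pverts G. \<Sum>v\<in>pverts G. if (u, v) \<in> parcs G then f u * f v else 0)"
      by (simp add: sum.distrib sum_subtractf d1 d2 flip: sum_distrib_left)
    finally show ?thesis by simp
  qed
  finally show "(\<Sum>u\<in>pverts G. \<Sum>v\<in>pverts G. L u v * f u * f v) = (\<Sum>(u, v)\<in>parcs G. (f u - f v)\<^sup>2) / 2"
    by (simp only: arcs)
qed

text \<open>With \<rho> the minimum of the form on the unit sphere orthogonal to the constants, it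
  is enough that the second smallest root is at most \<rho>. Since \<rho> may be 0, knowing that 0
  and \<rho> are eigenvalues would not give two roots. Hence the factor belonging to the constant
  vector is split off first, and \<rho> is shown to be a root of the remaining factor.\<close>

theorem (in pair_graph) algebraic_connectivity_rayleigh:
  assumes card: "card (pverts G) \<ge> 2" and f: "(\<Sum>v\<in>pverts G. f v) = 0"
  shows "algebraic_connectivity G * (\<Sum>v\<in>pverts G. (f v)\<^sup>2) \<le> (\<Sum>(u, v)\<in>parcs G. (f u - f v)\<^sup>2) / 2"
proof -
  define L where "L u v = (if u = v then real (out_degree (with_proj G) u) else 0) - (if (u, v) \<in> parcs G then 1 else 0)" for u v
  have fin: "finite (pverts G)" by (rule pair_finite_verts)
  have sym: "L u v = L v u" for u v by (auto simp: L_def dest: parcs_symD)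
  have quad: "(\<Sum>u\<in>pverts G. \<Sum>v\<in>pverts G. L u v * h u * h v) = (\<Sum>(u, v)\<in>parcs G. (h u - h v)\<^sup>2) / 2" for h
    using laplacian_quadratic_form(1)[of h] by (simp add: L_def)
  have row: "(\<Sum>v\<in>pverts G. L u v) = 0" if "u \<in> pverts G" for u
    using laplacian_quadratic_form(2)[OF that] by (simp add: L_def)
  obtain g \<rho> where g: "(\<Sum>v\<in>pverts G. g v) = 0" "(\<Sum>v\<in>pverts G. (g v)\<^sup>2) = 1"
    "\<And>u. u \<in> pverts G \<Longrightarrow> (\<Sum>v\<in>pverts G. L u v * g v) = \<rho> * g u"
    "\<And>f. (\<Sum>v\<in>pverts G. f v) = 0 \<Longrightarrow> \<rho> * (\<Sum>v\<in>pverts G. (f v)\<^sup>2) \<le> (\<Sum>u\<in>pverts G. \<Sum>v\<in>pverts G. L u v * f u * f v)"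
    using minimal_eigenvector_orthogonal_to_one[OF fin card sym row] by blast
  have "0 \<le> (\<Sum>u\<in>pverts G. \<Sum>v\<in>pverts G. L u v * g u * g v)"
    unfolding quad by (intro divide_nonneg_nonneg sum_nonneg) auto
  also have "\<dots> = (\<Sum>u\<in>pverts G. g u * (\<Sum>v\<in>pverts G. L u v * g v))"
    by (simp add: sum_distrib_left mult_ac)
  also have "\<dots> = \<rho> * (\<Sum>u\<in>pverts G. (g u)\<^sup>2)"
    unfolding sum_distrib_left[of \<rho>] by (intro sum.cong refl) (simp add: g(3) power2_eq_square)
  finally have rho: "\<rho> \<ge> 0" using g(2) by simp
  obtain vs where vs: "distinct vs" "set vs = pverts G"
    using finite_distinct_list[OF fin] by blast
  have len: "length vs \<ge> 2" using vs card by (metis distinct_card)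
  then obtain m where m: "length vs = Suc m" by (cases "length vs") auto
  define A where "A = laplacian_mat G vs"
  have A: "A \<in> carrier_mat (Suc m) (Suc m)"
    unfolding A_def m[symmetric] by (rule laplacian_mat_carrier)
  have A_entry: "A $$ (i, j) = L (vs ! i) (vs ! j)" if "i < Suc m" "j < Suc m" for i j
    using that m vs(1) by (auto simp: A_def L_def laplacian_mat_def degree_mat_def adjacency_mat_def
        nth_eq_iff_index_eq)
  have reindex: "(\<Sum>v\<in>pverts G. h v) = (\<Sum>j<Suc m. h (vs ! j))" for h :: "'a \<Rightarrow> real"
    using sum.distinct_set_conv_list[OF vs(1), of h] vs(2) m
    by (simp add: sum_list_sum_nth lessThan_atLeast0 del: sum.op_ivl_Suc sum.lessThan_Suc)
  have vin: "vs ! i \<in> pverts G" if "i < Suc m" for i using that m vs(2) nth_mem by metis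
  have zero: "(\<Sum>j<Suc m. A $$ (i, j)) = 0" if "i < Suc m" for i
    using row[OF vin[OF that]] that by (simp only: reindex) (simp add: A_entry del: sum.lessThan_Suc)
  define B where "B = mat m m (\<lambda>(i, j). A $$ (Suc i, Suc j) - A $$ (0, Suc j))"
  have cp: "char_poly A = [:0, 1:] * char_poly B"
    unfolding B_def using A zero by (rule char_poly_zero_row_sums)
  have Bc: "B \<in> carrier_mat m m" by (simp add: B_def)
  \<comment> \<open>These are the coordinates of \<open>g\<close> in the basis of
    \<open>char_poly_zero_row_sums\<close>, without the coordinate of the constant vector; so
    \<open>w\<close> represents \<open>g\<close> modulo constants.\<close>
  define w where "w = vec m (\<lambda>j. g (vs ! Suc j) - g (vs ! 0))"
  have Ag: "(\<Sum>j<Suc m. A $$ (i, j) * g (vs ! j)) = \<rho> * g (vs ! i)" if "i < Suc m" for i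
    using g(3)[OF vin[OF that]] that by (simp only: reindex) (simp add: A_entry del: sum.lessThan_Suc)
  have Aw: "(\<Sum>j<m. A $$ (i, Suc j) * (g (vs ! Suc j) - g (vs ! 0))) = \<rho> * g (vs ! i)" if "i < Suc m" for i
  proof -
    have "(\<Sum>j<Suc m. A $$ (i, j) * (g (vs ! j) - g (vs ! 0))) = \<rho> * g (vs ! i)"
      using Ag[OF that] zero[OF that]
      by (simp add: right_diff_distrib sum_subtractf del: sum.lessThan_Suc flip: sum_distrib_right)
    then show ?thesis unfolding sum.lessThan_Suc_shift by simp
  qed
  have "B *\<^sub>v w = \<rho> \<cdot>\<^sub>v w"
  proof (rule eq_vecI)
    fix i assume "i < dim_vec (\<rho> \<cdot>\<^sub>v w)"
    then have i: "i < m" by (simp add: w_def)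
    have "(B *\<^sub>v w) $ i = (\<Sum>j<m. (A $$ (Suc i, Suc j) - A $$ (0, Suc j)) * (g (vs ! Suc j) - g (vs ! 0)))"
      using i by (simp add: B_def w_def scalar_prod_def lessThan_atLeast0)
    also have "\<dots> = \<rho> * g (vs ! Suc i) - \<rho> * g (vs ! 0)"
      unfolding left_diff_distrib sum_subtractf using i Aw[of "Suc i"] Aw[of 0] by simp
    finally show "(B *\<^sub>v w) $ i = (\<rho> \<cdot>\<^sub>v w) $ i" using i by (simp add: w_def algebra_simps)
  qed (simp add: B_def w_def)
  moreover have "w \<noteq> 0\<^sub>v m"
  proof
    assume "w = 0\<^sub>v m"
    then have "w $ j = 0" if "j < m" for j using that by simp
    then have "g (vs ! Suc j) = g (vs ! 0)" if "j < m" for j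
      using that by (simp add: w_def)
    then have const: "g (vs ! j) = g (vs ! 0)" if "j < Suc m" for j using that by (cases j) auto
    have "(\<Sum>j<Suc m. g (vs ! j)) = (\<Sum>j<Suc m. g (vs ! 0))"
      by (intro sum.cong refl const) simp
    then have g0: "g (vs ! 0) = 0" using g(1) reindex[of g] by (simp del: sum.lessThan_Suc of_nat_Suc)
    have "(\<Sum>j<Suc m. (g (vs ! j))\<^sup>2) = (\<Sum>j<Suc m. 0)"
      using const g0 by (intro sum.cong refl) (metis lessThan_iff zero_power2)
    then show False using g(2) reindex[of "\<lambda>v. (g v)\<^sup>2"] by (simp del: sum.lessThan_Suc)
  qed
  ultimately have "eigenvalue B \<rho>"
    unfolding eigenvalue_def eigenvector_def by (intro exI[of _ w]) (simp add: B_def w_def)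
  then have "[:- \<rho>, 1:] dvd char_poly B"
    using eigenvalue_root_char_poly[OF Bc] by (simp add: poly_eq_0_iff_dvd)
  then obtain r where "char_poly B = [:- \<rho>, 1:] * r" by (auto simp: dvd_def)
  then have p: "char_poly A = [:0, 1:] * ([:- \<rho>, 1:] * r)" using cp by simp
  have "char_poly A \<noteq> 0" using degree_monic_char_poly[OF A] by auto
  then have "[:0, 1:] * ([:- \<rho>, 1:] * r) \<noteq> 0" unfolding p .
  then have "proots (char_poly A) = proots [:- 0, 1:] + (proots [:- \<rho>, 1:] + proots r)"
    unfolding p by (metis minus_zero mult_eq_0_iff proots_mult)
  then have "proots (char_poly A) = {#0#} + ({#\<rho>#} + proots r)" by simp
  moreover have "laplacian_char_poly G = char_poly A"
    unfolding A_def using vs by (intro laplacian_char_poly_eq) (simp add: vertex_enumeration_def)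
  ultimately have "{#0, \<rho>#} \<subseteq># mset (laplacian_spectrum G)"
    by (simp add: laplacian_spectrum_def)
  then have "laplacian_spectrum G ! 1 \<le> \<rho>"
    using rho by (intro sorted_nth_one_le) (simp add: laplacian_spectrum_def)
  then have "algebraic_connectivity G \<le> \<rho>"
    unfolding algebraic_connectivity_def laplacian_eigenvalue_def by simp
  then have "algebraic_connectivity G * (\<Sum>v\<in>pverts G. (f v)\<^sup>2) \<le> \<rho> * (\<Sum>v\<in>pverts G. (f v)\<^sup>2)"
    by (intro mult_right_mono sum_nonneg) auto
  also have "\<dots> \<le> (\<Sum>(u, v)\<in>parcs G. (f u - f v)\<^sup>2) / 2"
    using g(4)[OF f] quad[of f] by simp
  finally show ?thesis .
qed

section \<open>Odd closed walks\<close>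

text \<open>Cutting a closed walk at a repeated vertex gives two shorter closed walks, one of them
  of odd length. This links closed walks, with which the rest of the proof works, to the cycles in
  \<open>odd_girth\<close>.\<close>

lemma (in wf_digraph) odd_closed_awalk_imp_odd_cycle:
  assumes "awalk u p u" "odd (length p)"
  shows "\<exists>q. cycle q \<and> odd (length q) \<and> length q \<le> length p"
  using assms
proof (induction "length p" arbitrary: p u rule: less_induct)
  case less
  show ?case
  proof (cases "distinct (tl (awalk_verts u p))")
    case True
    then show ?thesis using less.prems by (auto simp: cycle_def intro!: exI[of _ p])
  next
    case False
    obtain e es where p: "p = e # es" using less.prems(2) by (cases p) auto
    with False less.prems have es: "awalk (head G e) es u" "\<not> distinct (awalk_verts (head G e) es)"
      by (auto simp: awalk_Cons_iff)
    obtain q r s where qrs: "es = q @ r @ s" "0 < length r"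
      "\<exists>w. awalk (head G e) q w \<and> awalk w r w \<and> awalk w s u"
      using awalk_not_distinct_decomp[OF es] by blast
    then obtain w where w: "awalk (head G e) q w" "awalk w r w" "awalk w s u" by blast
    have rest: "awalk u (e # q @ s) u"
      using less.prems(1) w p by (auto simp: awalk_Cons_iff)
    have len: "length p = length r + length (e # q @ s)" using p qrs by simp
    show ?thesis
    proof (cases "odd (length r)")
      case True
      have "length r < length p" using len by simp
      from less.hyps[OF this w(2) True] show ?thesis using \<open>length r < length p\<close> by auto
    next
      case False
      then have "odd (length (e # q @ s))" using less.prems(2) len by simp
      moreover have lt: "length (e # q @ s) < length p" using len qrs(2) by simp
      ultimately show ?thesis using less.hyps[OF lt rest] lt by auto
    qed
  qed
qed

lemma (in pair_graph) relpow_imp_awalk: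
  assumes "(u, v) \<in> parcs G ^^ t" "v \<in> pverts G"
  shows "\<exists>p. awalk u p v \<and> length p = t"
  using assms(1)
proof (induction t arbitrary: u)
  case 0
  then show ?case using assms(2) by (auto simp: awalk_Nil_iff)
next
  case (Suc t)
  obtain w where w: "(u, w) \<in> parcs G" "(w, v) \<in> parcs G ^^ t"
    using relpow_Suc_D2[OF Suc.prems] by blast
  with Suc.IH obtain p where "awalk w p v" "length p = t" by blast
  with w have "awalk u ((u, w) # p) v" "length ((u, w) # p) = Suc t"
    by (auto simp: awalk_Cons_iff in_arcsD1)
  then show ?case by blast
qed

lemma (in pair_graph) odd_girth_le_odd_closed_walk:
  assumes "(u, u) \<in> parcs G ^^ t" "odd t"
  shows "odd_girth G \<le> enat t"
proof -
  have "u \<in> pverts G" using assms by (cases t) (auto dest: in_arcsD2)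
  then obtain p where p: "awalk u p u" "length p = t"
    using relpow_imp_awalk[OF assms(1)] by blast
  then obtain q where "cycle q" "odd (length q)" "length q \<le> t"
    using odd_closed_awalk_imp_odd_cycle[of u p] assms(2) by auto
  then have "odd_girth G \<le> enat (length q)" "enat (length q) \<le> enat t"
    unfolding odd_girth_def by (auto intro!: Inf_lower)
  then show ?thesis by (rule order_trans)
qed

lemma relpow_sym:
  assumes "sym R" "(x, y) \<in> R ^^ t"
  shows "(y, x) \<in> R ^^ t"
  using assms(2)
proof (induction t arbitrary: x)
  case (Suc t)
  obtain z where z: "(x, z) \<in> R" "(z, y) \<in> R ^^ t"
    using relpow_Suc_D2[OF Suc.prems] by blast
  show ?case by (rule relpow_Suc_I[OF Suc.IH[OF z(2)] symD[OF assms(1) z(1)]])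
qed simp

lemma relpow_trans: "(x, y) \<in> R ^^ s \<Longrightarrow> (y, z) \<in> R ^^ t \<Longrightarrow> (x, z) \<in> R ^^ (s + t)"
  by (auto simp: relpow_add)

lemma (in pair_graph) parcs_sym: "sym (parcs G)"
  by (auto intro!: symI dest: parcs_symD)

text \<open>Colour each component by the parity of the length of walks from a chosen root.\<close>

lemma (in pair_graph) bipartite_if_no_odd_closed_walk:
  assumes "\<And>u t. (u, u) \<in> parcs G ^^ t \<Longrightarrow> even t"
  shows "bipartite G"
proof -
  define root where "root v = (SOME r. \<exists>t. (r, v) \<in> parcs G ^^ t)" for v
  have root: "\<exists>t. (root v, v) \<in> parcs G ^^ t" for v
    unfolding root_def by (rule someI[of _ v], rule exI[of _ 0]) simp
  have edge_root: "root u = root v" if "(u, v) \<in> parcs G" for u v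
  proof -
    have "(\<exists>t. (r, u) \<in> parcs G ^^ t) = (\<exists>t. (r, v) \<in> parcs G ^^ t)" for r
      using relpow_Suc_I[OF _ that] relpow_Suc_I[OF _ parcs_symD[OF that]] by blast
    then show ?thesis by (simp add: root_def)
  qed
  have parity: "even (s + t)" if "(r, v) \<in> parcs G ^^ s" "(r, v) \<in> parcs G ^^ t" for r v s t
    using assms[OF relpow_trans[OF that(1) relpow_sym[OF parcs_sym that(2)]]] .
  define X where "X = {v \<in> pverts G. \<exists>t. even t \<and> (root v, v) \<in> parcs G ^^ t}"
  have X_iff: "v \<in> X \<longleftrightarrow> even s" if "v \<in> pverts G" "(root v, v) \<in> parcs G ^^ s" for v s
  proof
    assume "v \<in> X"
    then obtain t where "even t" "(root v, v) \<in> parcs G ^^ t" unfolding X_def by blast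
    with parity[OF that(2)] show "even s" by fastforce
  qed (use that in \<open>unfold X_def, blast\<close>)
  have "u \<in> X \<and> v \<in> pverts G - X \<or> u \<in> pverts G - X \<and> v \<in> X" if uv: "(u, v) \<in> parcs G" for u v
  proof -
    have V: "u \<in> pverts G" "v \<in> pverts G" using uv by (auto dest: in_arcsD1 in_arcsD2)
    obtain t where t: "(root u, u) \<in> parcs G ^^ t" using root by blast
    then have t': "(root v, v) \<in> parcs G ^^ Suc t"
      unfolding edge_root[OF uv] by (rule relpow_Suc_I[OF _ uv])
    show ?thesis using V X_iff[OF V(1) t] X_iff[OF V(2) t'] by simp
  qed
  then have "\<forall>(u, v) \<in> parcs G. u \<in> X \<and> v \<in> pverts G - X \<or> u \<in> pverts G - X \<and> v \<in> X"
    by blast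
  moreover have "X \<union> (pverts G - X) = pverts G" "X \<inter> (pverts G - X) = {}"
    unfolding X_def by blast+
  ultimately show ?thesis
    unfolding bipartite_def by blast
qed

section \<open>A shortest odd closed walk\<close>

lemma sum_periodic_shift:
  fixes h :: "int \<Rightarrow> 'b::comm_monoid_add"
  assumes "g > 0" "\<And>j. h (j mod g) = h j"
  shows "(\<Sum>j\<in>{0..<g}. h (j + l)) = (\<Sum>j\<in>{0..<g}. h j)"
proof (rule sum.reindex_bij_witness[where i = "\<lambda>j. (j - l) mod g" and j = "\<lambda>j. (j + l) mod g"])
  fix j assume "j \<in> {0..<g}"
  then show "((j + l) mod g - l) mod g = j" "((j - l) mod g + l) mod g = j"
    by (auto simp: mod_simps)
  show "h ((j + l) mod g) = h (j + l)" by (rule assms)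
qed (use assms(1) in auto)

lemma even_multiple_of_odd_eq_0:
  fixes x g :: int
  assumes "g dvd x" "odd g" "even x" "\<bar>x\<bar> < 2 * g"
  shows "x = 0"
proof -
  have "2 * g dvd x"
    using assms by (intro divides_mult) (auto simp: coprime_commute)
  then show ?thesis using assms(4) dvd_imp_le_int[of x "2 * g"] by fastforce
qed

text \<open>Indexing the circuit by all integers with a period removes wrap-around cases. It is
  required only to be a closed walk, so that exchanging some of its vertices calls for no check of
  distinctness. \<open>gap\<close> is the Rayleigh inequality for arbitrary \<open>f\<close>, freed
  from the condition of mean 0.\<close>

locale odd_circuit =
  fixes V :: "'a set" and R :: "'a rel" and k :: nat and c :: "int \<Rightarrow> 'a"
  assumes fin: "finite V" and R_sub: "R \<subseteq> V \<times> V" and sym_R: "sym R" and k3: "3 \<le> k"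
    and no_short: "(u, u) \<in> R ^^ t \<Longrightarrow> odd t \<Longrightarrow> 2 * k + 1 \<le> t"
    and step: "(c i, c (i + 1)) \<in> R"
    and periodic: "c (i mod (2 * int k + 1)) = c i"
    and gap: "4 * (real (card V) * (\<Sum>v\<in>V. (f v)\<^sup>2) - (\<Sum>v\<in>V. f v)\<^sup>2)
      \<le> (6 * real k - 1) * ((\<Sum>(u, v)\<in>R. (f u - f v)\<^sup>2) / 2)"
begin

abbreviation "g \<equiv> 2 * int k + 1"

definition deg :: "'a \<Rightarrow> real" where "deg u = real (card {v. (u, v) \<in> R})"

lemma R_sym: "(u, v) \<in> R \<Longrightarrow> (v, u) \<in> R"
  using sym_R by (rule symD)

lemma irrefl: "(u, u) \<notin> R"
  using no_short[of u 1] k3 by auto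

lemma R_V: "(u, v) \<in> R \<Longrightarrow> u \<in> V" "(u, v) \<in> R \<Longrightarrow> v \<in> V"
  using R_sub by auto

lemma c_V: "c i \<in> V"
  using step R_V by blast

lemma nbrs_Int: "V \<inter> {v. (u, v) \<in> R} = {v. (u, v) \<in> R}"
  using R_sub by auto

lemma deg_sum: "deg u = (\<Sum>v\<in>V. of_bool ((u, v) \<in> R))"
  using fin by (simp add: deg_def sum.If_cases of_bool_def nbrs_Int)

lemma sum_R: "(\<Sum>(u, v)\<in>R. h u v) = (\<Sum>u\<in>V. \<Sum>v\<in>V. of_bool ((u, v) \<in> R) * (h u v :: real))"
proof -
  have "(\<Sum>(u, v)\<in>R. h u v) = (\<Sum>(u, v)\<in>V \<times> V. of_bool ((u, v) \<in> R) * h u v)"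
    using R_sub fin by (intro sum.mono_neutral_cong_left) auto
  then show ?thesis by (simp add: sum.cartesian_product)
qed

lemma sum_R_fst: "(\<Sum>(u, v)\<in>R. h u) = (\<Sum>u\<in>V. h u * deg u)"
  unfolding sum_R deg_sum sum_distrib_left by (intro sum.cong refl) simp

lemma sum_R_snd: "(\<Sum>(u, v)\<in>R. h v) = (\<Sum>u\<in>V. h u * deg u)"
  unfolding sum_R_fst[symmetric]
  by (rule sum.reindex_bij_witness[where i = prod.swap and j = prod.swap]) (auto dest: R_sym)

lemma circuit_walk_nat: "(c i, c (i + int d)) \<in> R ^^ d"
proof (induction d)
  case (Suc d)
  then show ?case using step[of "i + int d"] by (auto intro!: relpow_Suc_I simp: algebra_simps)
qed simp

lemma circuit_walk: "(c i, c j) \<in> R ^^ nat \<bar>j - i\<bar>"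
proof (cases "i \<le> j")
  case True
  then show ?thesis using circuit_walk_nat[of i "nat (j - i)"] by simp
next
  case False
  then show ?thesis
    using relpow_sym[OF sym_R circuit_walk_nat[of j "nat (i - j)"]] by simp
qed

lemma odd_detour:
  assumes "(w, c i) \<in> R ^^ s" "(w, c j) \<in> R ^^ t" "odd (int s + int t + (j - i))"
  shows "g \<le> int s + int t + \<bar>j - i\<bar>"
proof -
  have "(w, w) \<in> R ^^ (s + nat \<bar>j - i\<bar> + t)"
    using relpow_trans[OF relpow_trans[OF assms(1) circuit_walk] relpow_sym[OF sym_R assms(2)]] .
  moreover have "odd (s + nat \<bar>j - i\<bar> + t)"
  proof -
    have "odd (int s + \<bar>j - i\<bar> + int t)" using assms(3) by presburger
    also have "int s + \<bar>j - i\<bar> + int t = int (s + nat \<bar>j - i\<bar> + t)" by simp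
    finally show ?thesis by (simp only: even_of_nat not_False_eq_True)
  qed
  ultimately have "2 * k + 1 \<le> s + nat \<bar>j - i\<bar> + t" by (rule no_short)
  then show ?thesis by linarith
qed

lemma c_cong: "g dvd i - j \<Longrightarrow> c i = c j"
  by (metis mod_eq_dvd_iff periodic)

text \<open>Both arcs of the circuit close up the two walks; the closed walk of odd length cannot be short.\<close>

lemma near:
  assumes "(w, c i) \<in> R ^^ s" "(w, c j) \<in> R ^^ t"
  obtains e where "even (e - int s - int t)" "\<bar>e\<bar> \<le> int s + int t" "g dvd j - i - e"
proof -
  define r where "r = (j - i) mod g"
  have r: "0 \<le> r" "r < g" using pos_mod_bound[of g "j - i"] by (simp_all add: r_def)
  define m where "m = (j - i) div g"
  have m: "j = i + r + g * m"
    using mult_div_mod_eq[of g "j - i"] by (simp add: r_def m_def)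
  have dvd: "g dvd j - i - r" by (rule dvdI[of _ _ m]) (simp add: m)
  have c1: "c j = c (i + r)" by (rule c_cong, rule dvdI[of _ _ m]) (simp add: m)
  have c2: "c j = c (i + r - g)"
    by (rule c_cong, rule dvdI[of _ _ "m + 1"]) (simp add: m algebra_simps)
  have t1: "(w, c (i + r)) \<in> R ^^ t" "(w, c (i + r - g)) \<in> R ^^ t"
    using assms(2) c1 c2 by simp_all
  show thesis
  proof (cases "even (r - int s - int t)")
    case True
    have "g \<le> int s + int t + \<bar>(i + r - g) - i\<bar>"
      by (rule odd_detour[OF assms(1) t1(2)]) (use True in presburger)
    then show thesis using that[OF True _ dvd] r by simp
  next
    case False
    have "g \<le> int s + int t + \<bar>(i + r) - i\<bar>"
      by (rule odd_detour[OF assms(1) t1(1)]) (use False in presburger)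
    moreover have "even (r - g - int s - int t)" using False by presburger
    moreover have "g dvd j - i - (r - g)"
      by (rule dvdI[of _ _ "m + 1"]) (simp add: m algebra_simps)
    ultimately show thesis using that[of "r - g"] r by simp
  qed
qed

section \<open>Patterns of walks of length 1 and 2 from a vertex to the circuit\<close>

definition N1 :: "'a \<Rightarrow> int \<Rightarrow> bool" where "N1 w j \<longleftrightarrow> (w, c j) \<in> R"
text \<open>Walks, not distances: \<open>c j\<close> itself satisfies this, by going to a neighbour
  and back.\<close>

definition N2 :: "'a \<Rightarrow> int \<Rightarrow> bool" where "N2 w j \<longleftrightarrow> (w, c j) \<in> R ^^ 2"

lemma N1_relpow: "N1 w j \<longleftrightarrow> (w, c j) \<in> R ^^ 1"
  by (simp add: N1_def)

lemma N1_step: "(w, v) \<in> R \<Longrightarrow> N1 v j \<Longrightarrow> N2 w j"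
  by (auto simp: N1_def N2_def numeral_2_eq_2)

lemma N1_imp_N2: "N1 w j \<Longrightarrow> N2 w (j + 1)" "N1 w j \<Longrightarrow> N2 w (j - 1)"
  using step[of j] step[of "j - 1"] R_sym
  by (auto simp: N1_def N2_def numeral_2_eq_2)

lemma N2E:
  assumes "N2 w j" obtains v where "(w, v) \<in> R" "N1 v j"
  using assms by (auto simp: N1_def N2_def numeral_2_eq_2)

lemma N1_cong: "g dvd i - j \<Longrightarrow> N1 w i \<longleftrightarrow> N1 w j"
  unfolding N1_def using c_cong by metis

lemma N2_cong: "g dvd i - j \<Longrightarrow> N2 w i \<longleftrightarrow> N2 w j"
  unfolding N2_def using c_cong by metis

text \<open>14 is twice the least possible period 7. Parity is essential: offsets 6 and -1, say, are
  congruent when \<open>g = 7\<close>.\<close>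

lemma dvd_even_0: "g dvd x \<Longrightarrow> even x \<Longrightarrow> \<bar>x\<bar> < 14 \<Longrightarrow> x = 0"
  by (rule even_multiple_of_odd_eq_0[of g]) (use k3 in auto)

lemma near11:
  assumes "N1 w i" "N1 w j"
  obtains e where "e \<in> {-2, 0, 2}" "g dvd j - i - e"
proof -
  obtain e where e: "even (e - 2)" "\<bar>e\<bar> \<le> 2" "g dvd j - i - e"
    using near[of w i 1 j 1] assms unfolding N1_relpow by auto
  from e(1,2) have "e \<in> {-2, 0, 2}" by (auto simp: abs_le_iff; presburger)
  then show thesis using that e(3) by blast
qed

lemma near12:
  assumes "N1 w i" "N2 w j"
  obtains e where "e \<in> {-3, -1, 1, 3}" "g dvd j - i - e"
proof -
  obtain e where e: "even (e - 3)" "\<bar>e\<bar> \<le> 3" "g dvd j - i - e"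
    using near[of w i 1 j 2] assms unfolding N1_relpow N2_def by auto
  from e(1,2) have "e \<in> {-3, -1, 1, 3}" by (auto simp: abs_le_iff; presburger)
  then show thesis using that e(3) by blast
qed

lemma near22:
  assumes "N2 w i" "N2 w j"
  obtains e where "e \<in> {-4, -2, 0, 2, 4}" "g dvd j - i - e"
proof -
  obtain e where e: "even (e - 4)" "\<bar>e\<bar> \<le> 4" "g dvd j - i - e"
    using near[of w i 2 j 2] assms unfolding N2_def by auto
  from e(1,2) have "e \<in> {-4, -2, 0, 2, 4}" by (auto simp: abs_le_iff; presburger)
  then show thesis using that e(3) by blast
qed

definition at_offsets :: "(int \<Rightarrow> bool) \<Rightarrow> int \<Rightarrow> int set \<Rightarrow> bool" where
  "at_offsets N l S \<longleftrightarrow> (\<forall>j. N j \<longleftrightarrow> (\<exists>e\<in>S. g dvd j - l - e))"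

lemma N1_at:
  assumes "\<And>e. e \<in> S \<Longrightarrow> N1 w (l + e)" "\<And>j. N1 w j \<Longrightarrow> \<exists>e\<in>S. g dvd j - l - e"
  shows "at_offsets (N1 w) l S"
  unfolding at_offsets_def
proof (intro allI iffI)
  fix j assume "\<exists>e\<in>S. g dvd j - l - e"
  then obtain e where "e \<in> S" "g dvd j - (l + e)" by (auto simp: diff_diff_eq)
  then show "N1 w j" using assms(1) N1_cong by blast
qed (rule assms(2))

lemma N2_at:
  assumes "\<And>j. N2 w j \<Longrightarrow> \<exists>e\<in>T. g dvd j - l - e" "{e \<in> T. N2 w (l + e)} = S"
  shows "at_offsets (N2 w) l S"
  unfolding at_offsets_def
proof (intro allI iffI)
  fix j assume "\<exists>e\<in>S. g dvd j - l - e"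
  then obtain e where "e \<in> S" "g dvd j - (l + e)" by (auto simp: diff_diff_eq)
  then show "N2 w j" using assms(2) N2_cong by blast
next
  fix j assume j: "N2 w j"
  then obtain e where e: "e \<in> T" "g dvd j - (l + e)" using assms(1) by (auto simp: diff_diff_eq)
  then have "e \<in> S" using j assms(2) N2_cong by blast
  then show "\<exists>e\<in>S. g dvd j - l - e" using e by (auto simp: diff_diff_eq)
qed

lemma offsets_eq:
  assumes "g dvd j - i - e" "g dvd j - i' - e'" "even (i' - i + e' - e)" "\<bar>i' - i + e' - e\<bar> < 14"
  shows "e = i' - i + e'"
proof -
  have "g dvd (j - i - e) - (j - i' - e')" using assms(1,2) by (rule dvd_diff)
  then have "g dvd i' - i + e' - e" by (simp add: algebra_simps)
  from dvd_even_0[OF this assms(3,4)] show ?thesis by simp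
qed

text \<open>The position of any further point can be measured from \<open>l - 1\<close> and from
  \<open>l + 1\<close>. The two offsets must differ by exactly 2, which leaves only the values
  allowed by both.\<close>

lemma two_neighbours_offsets:
  assumes "N1 w (l - 1)" "N1 w (l + 1)"
  shows "at_offsets (N1 w) l {-1, 1}" "at_offsets (N2 w) l {-2, 0, 2}"
proof -
  show "at_offsets (N1 w) l {-1, 1}"
  proof (rule N1_at)
    fix j assume j: "N1 w j"
    obtain e where e: "e \<in> {-2, 0, 2}" "g dvd j - (l - 1) - e" using near11[OF assms(1) j] .
    obtain e' where e': "e' \<in> {-2, 0, 2}" "g dvd j - (l + 1) - e'" using near11[OF assms(2) j] .
    have "e = (l + 1) - (l - 1) + e'"
      by (rule offsets_eq[OF e(2) e'(2)]) (use e e' in auto)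
    then have "e - 1 \<in> {-1, 1}" using e(1) e'(1) by auto
    moreover have "g dvd j - l - (e - 1)" using e(2) by (simp add: algebra_simps)
    ultimately show "\<exists>e\<in>{-1, 1}. g dvd j - l - e" by blast
  qed (use assms in auto)
  have sub: "\<exists>e\<in>{-2, 0, 2}. g dvd j - l - e" if j: "N2 w j" for j
  proof -
    obtain e where e: "e \<in> {-3, -1, 1, 3}" "g dvd j - (l - 1) - e" using near12[OF assms(1) j] .
    obtain e' where e': "e' \<in> {-3, -1, 1, 3}" "g dvd j - (l + 1) - e'" using near12[OF assms(2) j] .
    have "e = (l + 1) - (l - 1) + e'"
      by (rule offsets_eq[OF e(2) e'(2)]) (use e e' in auto)
    then have "e - 1 \<in> {-2, 0, 2}" using e(1) e'(1) by auto
    moreover have "g dvd j - l - (e - 1)" using e(2) by (simp add: algebra_simps)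
    ultimately show ?thesis by blast
  qed
  show "at_offsets (N2 w) l {-2, 0, 2}"
    using N1_imp_N2[OF assms(1)] N1_imp_N2[OF assms(2)]
    by (intro N2_at[OF sub]) (auto simp: add.commute)
qed

lemma one_neighbour_offsets:
  assumes l: "N1 w l" and only: "\<And>j. N1 w j \<Longrightarrow> g dvd j - l"
  shows "at_offsets (N1 w) l {0} \<and>
    (at_offsets (N2 w) l {-1, 1, 3} \<or> at_offsets (N2 w) l {-1, 1, -3} \<or> at_offsets (N2 w) l {-1, 1})"
proof
  show "at_offsets (N1 w) l {0}" using l only by (intro N1_at) auto
  have sub: "\<exists>e\<in>{-3, -1, 1, 3}. g dvd j - l - e" if "N2 w j" for j
    using near12[OF l that] by blast
  \<comment> \<open>Points at \<open>l + 3\<close> and \<open>l - 3\<close> would be 6 apart, but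
    two points reached by walks of length 2 are at most 4 apart at an even offset.\<close>
  have not_both: "\<not> (N2 w (l + 3) \<and> N2 w (l - 3))"
  proof
    assume "N2 w (l + 3) \<and> N2 w (l - 3)"
    then obtain e where e: "e \<in> {-4, -2, 0, 2, 4}" "g dvd (l + 3) - (l - 3) - e"
      using near22[of w "l - 3" "l + 3"] by blast
    have "6 - e = 0" by (rule dvd_even_0) (use e in auto)
    then show False using e(1) by auto
  qed
  have has: "N2 w (l + 1)" "N2 w (l - 1)" using N1_imp_N2[OF l] by auto
  consider "N2 w (l + 3)" "\<not> N2 w (l - 3)" | "\<not> N2 w (l + 3)" "N2 w (l - 3)"
    | "\<not> N2 w (l + 3)" "\<not> N2 w (l - 3)" using not_both by blast
  then show "at_offsets (N2 w) l {-1, 1, 3} \<or> at_offsets (N2 w) l {-1, 1, -3} \<or> at_offsets (N2 w) l {-1, 1}"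
  proof cases
    case 1
    have "at_offsets (N2 w) l {-1, 1, 3}"
      using 1 has by (intro N2_at[OF sub]) auto
    then show ?thesis by blast
  next
    case 2
    have "at_offsets (N2 w) l {-1, 1, -3}"
      using 2 has by (intro N2_at[OF sub]) auto
    then show ?thesis by blast
  next
    case 3
    have "at_offsets (N2 w) l {-1, 1}"
      using 3 has by (intro N2_at[OF sub]) auto
    then show ?thesis by blast
  qed
qed

lemma no_neighbour_offsets:
  "\<exists>l. at_offsets (N2 w) l {-2, 0, 2} \<or> at_offsets (N2 w) l {0, 2} \<or> at_offsets (N2 w) l {-2, 2}
    \<or> at_offsets (N2 w) l {0} \<or> at_offsets (N2 w) l {}"
proof (cases "\<exists>i. N2 w i")
  case False
  then have "at_offsets (N2 w) 0 {}" by (simp add: at_offsets_def)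
  then show ?thesis by blast
next
  case True
  then obtain i where i: "N2 w i" by blast
  have sub: "\<exists>e\<in>{-4, -2, 0, 2, 4}. g dvd j - i - e" if "N2 w j" for j
    using near22[OF i that] by blast
  have cong: "N2 w j \<longleftrightarrow> N2 w (m + e)" if "g dvd j - m - e" for j e m
    using N2_cong[of j "m + e" w] that by (simp add: algebra_simps)
  \<comment> \<open>Two points 4 apart are the extremes of the pattern, so it is recentred at their
    midpoint.\<close>
  have far: "at_offsets (N2 w) (m + 2) {-2, 0, 2} \<or> at_offsets (N2 w) (m + 2) {-2, 2}"
    if m: "N2 w m" "N2 w (m + 4)" for m
  proof -
    have sub4: "\<exists>e\<in>{-2, 0, 2}. g dvd j - (m + 2) - e" if j: "N2 w j" for j
    proof -
      obtain e where e: "e \<in> {-4, -2, 0, 2, 4}" "g dvd j - m - e" using near22[OF m(1) j] .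
      obtain e' where e': "e' \<in> {-4, -2, 0, 2, 4}" "g dvd j - (m + 4) - e'" using near22[OF m(2) j] .
      have "e = (m + 4) - m + e'"
        by (rule offsets_eq[OF e(2) e'(2)]) (use e e' in auto)
      then have "e - 2 \<in> {-2, 0, 2}" using e(1) e'(1) by auto
      moreover have "g dvd j - (m + 2) - (e - 2)" using e(2) by (simp add: algebra_simps)
      ultimately show ?thesis by blast
    qed
    have ends: "N2 w ((m + 2) + 2)" "N2 w ((m + 2) + (-2))" using m by (auto simp: algebra_simps)
    show ?thesis
    proof (cases "N2 w (m + 2)")
      case True
      have "at_offsets (N2 w) (m + 2) {-2, 0, 2}"
        using True ends by (intro N2_at[OF sub4]) auto
      then show ?thesis by blast
    next
      case False
      have "at_offsets (N2 w) (m + 2) {-2, 2}"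
        using False ends by (intro N2_at[OF sub4]) auto
      then show ?thesis by blast
    qed
  qed
  consider "N2 w (i + 4)" | "N2 w (i - 4)" | "\<not> N2 w (i + 4)" "\<not> N2 w (i - 4)" by blast
  then show ?thesis
  proof cases
    case 1
    then show ?thesis using far[OF i] by blast
  next
    case 2
    then have "N2 w (i - 4)" "N2 w (i - 4 + 4)" using i by simp_all
    then show ?thesis using far by blast
  next
    case 3
    have sub2: "\<exists>e\<in>{-2, 0, 2}. g dvd j - i - e" if j: "N2 w j" for j
    proof -
      obtain e where e: "e \<in> {-4, -2, 0, 2, 4}" "g dvd j - i - e" using sub[OF j] by blast
      have "N2 w (i + e)" using cong[OF e(2)] j by simp
      then have "e \<noteq> 4" "e \<noteq> -4" using 3 by auto
      then show ?thesis using e by blast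
    qed
    consider "N2 w (i + 2)" "N2 w (i - 2)" | "N2 w (i + 2)" "\<not> N2 w (i - 2)"
      | "\<not> N2 w (i + 2)" "N2 w (i - 2)" | "\<not> N2 w (i + 2)" "\<not> N2 w (i - 2)" by blast
    then show ?thesis
    proof cases
      case 1
      have "at_offsets (N2 w) i {-2, 0, 2}" using 1 i by (intro N2_at[OF sub2]) auto
      then show ?thesis by blast
    next
      case 2
      have "at_offsets (N2 w) i {0, 2}"
        using 2 i by (intro N2_at[OF sub2]) auto
      then show ?thesis by blast
    next
      case 3
      have sub3: "\<exists>e\<in>{0, 2, 4}. g dvd j - (i - 2) - e" if "N2 w j" for j
        using sub2[OF that] by (auto simp: algebra_simps)
      have "at_offsets (N2 w) (i - 2) {0, 2}"
        using 3 i by (intro N2_at[OF sub3]) (auto simp: add.commute)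
      then show ?thesis by blast
    next
      case 4
      have "at_offsets (N2 w) i {0}"
        using 4 i by (intro N2_at[OF sub2]) auto
      then show ?thesis by blast
    qed
  qed
qed

lemma offsets_cases:
  "(\<exists>l. at_offsets (N1 w) l {-1, 1} \<and> at_offsets (N2 w) l {-2, 0, 2}) \<or>
   (\<exists>l. at_offsets (N1 w) l {0} \<and> (at_offsets (N2 w) l {-1, 1, 3} \<or> at_offsets (N2 w) l {-1, 1, -3} \<or> at_offsets (N2 w) l {-1, 1})) \<or>
   (\<exists>l. at_offsets (N1 w) l {} \<and> (at_offsets (N2 w) l {-2, 0, 2} \<or> at_offsets (N2 w) l {0, 2} \<or> at_offsets (N2 w) l {-2, 2}
    \<or> at_offsets (N2 w) l {0} \<or> at_offsets (N2 w) l {}))"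
proof (cases "\<exists>i. N1 w i")
  case False
  then have "at_offsets (N1 w) l {}" for l by (simp add: at_offsets_def)
  then show ?thesis using no_neighbour_offsets by blast
next
  case True
  then obtain i where i: "N1 w i" by blast
  show ?thesis
  proof (cases "\<forall>j. N1 w j \<longrightarrow> g dvd j - i")
    case True
    then have "\<And>j. N1 w j \<Longrightarrow> g dvd j - i" by blast
    from one_neighbour_offsets[OF i this] show ?thesis by blast
  next
    case False
    then obtain j where j: "N1 w j" "\<not> g dvd j - i" by blast
    obtain e where e: "e \<in> {-2, 0, 2}" "g dvd j - i - e" using near11[OF i j(1)] .
    with j have "e = 2 \<or> e = -2" by auto
    moreover have "N1 w (i + e)" using j(1) N1_cong[of j "i + e" w] e(2) by (simp add: algebra_simps)
    ultimately have "N1 w (i + 1 - 1) \<and> N1 w (i + 1 + 1) \<or> N1 w (i - 1 - 1) \<and> N1 w (i - 1 + 1)"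
      using i by (auto simp: algebra_simps)
    then show ?thesis using two_neighbours_offsets by blast
  qed
qed

section \<open>Degree bounds from packings\<close>

abbreviation "n \<equiv> real (card V)"
abbreviation "q \<equiv> 6 * real k - 1"

lemma q_pos: "q > 0" using k3 by simp

text \<open>Otherwise the absence of triangles would make \<open>v\<close> an end of every circuit
  edge, hence equal to two circuit points two steps apart; the remaining \<open>g - 2\<close> steps
  would form an odd closed walk that is too short. The non-neighbour found here keeps the test
  vector of \<open>min_degree\<close> from vanishing.\<close>

lemma not_adjacent_to_all:
  assumes "v \<in> V"
  shows "\<exists>w\<in>V. w \<noteq> v \<and> (v, w) \<notin> R"
proof (rule ccontr)
  assume "\<not> ?thesis"
  then have adj: "(v, c i) \<in> R" if "c i \<noteq> v" for i using that c_V by blast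
  have one: "c i = v \<or> c (i + 1) = v" for i
  proof (rule ccontr)
    assume "\<not> (c i = v \<or> c (i + 1) = v)"
    then have "(v, c i) \<in> R ^^ 1" "(v, c (i + 1)) \<in> R ^^ 1" using adj by auto
    from odd_detour[OF this] show False using k3 by arith
  qed
  have two: "c i \<noteq> c (i + 2)" for i
  proof
    assume "c i = c (i + 2)"
    then have "(c i, c (i + 2)) \<in> R ^^ 0" "(c i, c (i + g)) \<in> R ^^ 0"
      using c_cong[of "i + g" i] by auto
    from odd_detour[OF this] show False using k3 by (simp add: abs_if split: if_splits)
  qed
  have irr: "c (i + 1) \<noteq> c i" for i using step[of i] irrefl by auto
  have "c 0 = v \<or> c 1 = v" using one[of 0] by simp
  then show False
  proof
    assume "c 0 = v"
    then have "c 1 \<noteq> v" using irr[of 0] by auto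
    then have "c 2 = v" using one[of 1] by simp
    then show False using \<open>c 0 = v\<close> two[of 0] by simp
  next
    assume "c 1 = v"
    then have "c 2 \<noteq> v" using irr[of 1] by auto
    then have "c 3 = v" using one[of 2] by simp
    then show False using \<open>c 1 = v\<close> two[of 1] by simp
  qed
qed

text \<open>Testing with the vector separating \<open>v\<close> from its non-neighbours, which vanishes on the
  neighbours of \<open>v\<close>, bounds the algebraic connectivity by the degree of \<open>v\<close>.\<close>

lemma min_degree:
  assumes v: "v \<in> V"
  shows "4 * n \<le> q * deg v"
proof -
  define W where "W = {w \<in> V. w \<noteq> v \<and> (v, w) \<notin> R}"
  define r where "r = real (card W)"
  have W: "finite W" "W \<noteq> {}" "W \<subseteq> V"
    using not_adjacent_to_all[OF v] fin by (auto simp: W_def)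
  then have r: "r > 0" by (simp add: r_def card_gt_0_iff)
  define f where "f x = (if x = v then r else if x \<in> W then - 1 else 0)" for x
  have vW: "v \<notin> W" by (simp add: W_def)
  have sum_f: "(\<Sum>x\<in>V. h (f x)) = h r + (\<Sum>x\<in>W. h (- 1))" if "h 0 = 0" for h :: "real \<Rightarrow> real"
  proof -
    have "(\<Sum>x\<in>V. h (f x)) = (\<Sum>x\<in>insert v W. h (f x))"
      using that v W fin by (intro sum.mono_neutral_right) (auto simp: f_def)
    also have "\<dots> = h (f v) + (\<Sum>x\<in>W. h (f x))" using W(1) vW by simp
    also have "(\<Sum>x\<in>W. h (f x)) = (\<Sum>x\<in>W. h (- 1))"
      using vW by (intro sum.cong) (auto simp: f_def)
    finally show ?thesis by (simp add: f_def)
  qed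
  have f0: "(\<Sum>x\<in>V. f x) = 0" using sum_f[of "\<lambda>x. x"] by (simp add: r_def)
  have f2: "(\<Sum>x\<in>V. (f x)\<^sup>2) = r\<^sup>2 + r" using sum_f[of "\<lambda>x. x\<^sup>2"] by (simp add: r_def)
  \<comment> \<open>An edge on which \<open>f\<close> changes has an end \<open>x\<close> among the
    neighbours of \<open>v\<close>; its other end is \<open>v\<close>, at cost \<open>r^2\<close>,
    or lies in \<open>W\<close>, at cost 1. Charging each \<open>x\<close> for all of
    \<open>W\<close>, adjacent or not, gives the product \<open>deg v (r^2 + r)\<close>.\<close>
  define h where "h x y = of_bool ((v, x) \<in> R) * (of_bool (y = v) * r\<^sup>2 + of_bool (y \<in> W))" for x y
  have h0: "0 \<le> h x y" for x y by (simp add: h_def)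
  have sum_h: "(\<Sum>x\<in>V. \<Sum>y\<in>V. h x y) = deg v * (r\<^sup>2 + r)"
  proof -
    have "(\<Sum>y\<in>V. of_bool (y = v) * r\<^sup>2 + of_bool (y \<in> W)) = r\<^sup>2 + r"
      using v W fin by (simp add: sum.distrib r_def Int_absorb1 sum.If_cases of_bool_def if_distrib[of "\<lambda>x. x * _"] cong: if_cong)
    then have "(\<Sum>x\<in>V. \<Sum>y\<in>V. h x y) = (\<Sum>x\<in>V. of_bool ((v, x) \<in> R) * (r\<^sup>2 + r))"
      by (simp add: h_def flip: sum_distrib_left)
    then show ?thesis by (simp add: deg_sum sum_distrib_right)
  qed
  have edge: "of_bool ((x, y) \<in> R) * (f x - f y)\<^sup>2 \<le> h x y + h y x" if "x \<in> V" "y \<in> V" for x y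
  proof (cases "(x, y) \<in> R")
    case True
    consider "x = v" | "y = v" | "x \<in> W" "y \<noteq> v" | "y \<in> W" "x \<noteq> v" | "x \<noteq> v" "y \<noteq> v" "x \<notin> W" "y \<notin> W" by blast
    then show ?thesis
    proof cases
      case 1
      then have "(v, y) \<in> R" "y \<noteq> v" "y \<notin> W" using True irrefl by (auto simp: W_def)
      then show ?thesis using 1 irrefl by (simp add: f_def h_def)
    next
      case 2
      then have "(v, x) \<in> R" "x \<noteq> v" "x \<notin> W" using R_sym[OF True] irrefl by (auto simp: W_def)
      then show ?thesis using 2 irrefl by (simp add: f_def h_def)
    next
      case 3
      then show ?thesis using h0 True that vW by (cases "y \<in> W") (auto simp: f_def h_def W_def)
    next
      case 4
      then show ?thesis using h0 True that vW by (cases "x \<in> W") (auto simp: f_def h_def W_def)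
    next
      case 5
      then show ?thesis using h0[of x y] h0[of y x] by (simp add: f_def)
    qed
  qed (use h0[of x y] h0[of y x] in simp)
  have "(\<Sum>(x, y)\<in>R. (f x - f y)\<^sup>2) \<le> (\<Sum>x\<in>V. \<Sum>y\<in>V. h x y + h y x)"
    unfolding sum_R by (intro sum_mono edge)
  also have "\<dots> = 2 * (deg v * (r\<^sup>2 + r))"
  proof -
    have "(\<Sum>x\<in>V. \<Sum>y\<in>V. h y x) = (\<Sum>x\<in>V. \<Sum>y\<in>V. h x y)" by (rule sum.swap)
    then show ?thesis by (simp add: sum.distrib sum_h)
  qed
  finally have E: "(\<Sum>(x, y)\<in>R. (f x - f y)\<^sup>2) / 2 \<le> deg v * (r\<^sup>2 + r)" by simp
  have "4 * (n * (r\<^sup>2 + r)) \<le> q * ((\<Sum>(x, y)\<in>R. (f x - f y)\<^sup>2) / 2)"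
    using gap[of f] by (simp add: f0 f2)
  also have "\<dots> \<le> q * (deg v * (r\<^sup>2 + r))"
    using E q_pos by (intro mult_left_mono) auto
  finally have "4 * (n * (r\<^sup>2 + r)) \<le> q * (deg v * (r\<^sup>2 + r))" .
  then have "(4 * n) * (r\<^sup>2 + r) \<le> (q * deg v) * (r\<^sup>2 + r)" by (simp add: mult.assoc)
  moreover have "r\<^sup>2 + r > 0" using r by (simp add: add_pos_pos)
  ultimately show ?thesis by (rule mult_right_le_imp_le)
qed

lemma finite_residues: "finite {j \<in> {0..<g}. P j}"
  by (rule finite_subset[of _ "{0..<g}"]) auto

lemma card_at_offsets_le:
  assumes "at_offsets N l T" "finite T"
  shows "card {j \<in> {0..<g}. N j} \<le> card T"
proof -
  have "{j \<in> {0..<g}. N j} \<subseteq> (\<lambda>e. (l + e) mod g) ` T"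
  proof
    fix j assume "j \<in> {j \<in> {0..<g}. N j}"
    then have j: "0 \<le> j" "j < g" "N j" by auto
    then obtain e where e: "e \<in> T" "g dvd j - (l + e)"
      using assms(1) by (auto simp: at_offsets_def diff_diff_eq)
    have "j = j mod g" using j by (intro mod_pos_pos_trivial[symmetric])
    also have "\<dots> = (l + e) mod g" using e(2) by (simp add: mod_eq_dvd_iff)
    finally show "j \<in> (\<lambda>e. (l + e) mod g) ` T" using e(1) by blast
  qed
  then show ?thesis using assms(2) by (meson card_image_le card_mono finite_imageI order_trans)
qed

lemma card_N1_le: "card {j \<in> {0..<g}. N1 w j} \<le> 2"
  using offsets_cases[of w] card_at_offsets_le[of "N1 w"] by fastforce

lemma card_N2_le: "card {j \<in> {0..<g}. N2 w j} \<le> 3"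
  using offsets_cases[of w] card_at_offsets_le[of "N2 w"] by fastforce

text \<open>Double counting over all \<open>v\<close>. A vertex adjacent to some \<open>u\<close> in
  \<open>U\<close> is adjacent to no \<open>c j\<close> with \<open>j\<close> in \<open>S\<close>,
  since it would be the middle of a walk of length 2. Any other vertex is adjacent to at most two of
  the \<open>c j\<close>, hence the weight 2 on \<open>U\<close>.\<close>

lemma sum_circuit_degrees_le:
  assumes "finite U" "\<And>v. (\<Sum>u\<in>U. of_bool ((u, v) \<in> R)) \<le> (1::real)"
    and S: "S \<subseteq> {0..<g}" "\<And>j u. j \<in> S \<Longrightarrow> u \<in> U \<Longrightarrow> \<not> N2 u j"
  shows "2 * (\<Sum>u\<in>U. deg u) + (\<Sum>j\<in>S. deg (c j)) \<le> 2 * n"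
proof -
  have finS: "finite S" using S(1) finite_subset by blast
  have "2 * (\<Sum>u\<in>U. of_bool ((u, v) \<in> R)) + (\<Sum>j\<in>S. of_bool ((c j, v) \<in> R)) \<le> (2::real)" for v
  proof (cases "\<exists>u\<in>U. (u, v) \<in> R")
    case True
    then obtain u where "u \<in> U" "(u, v) \<in> R" by blast
    then have "(c j, v) \<notin> R" if "j \<in> S" for j
      using S(2)[OF that] N1_step[of u v j] R_sym by (auto simp: N1_def)
    then have "(\<Sum>j\<in>S. of_bool ((c j, v) \<in> R)) = (0::real)" by (intro sum.neutral) auto
    then show ?thesis using assms(2)[of v] by simp
  next
    case False
    have "(\<Sum>j\<in>S. of_bool ((c j, v) \<in> R)) = real (card (S \<inter> {j. N1 v j}))"
      using finS by (auto simp: sum.If_cases of_bool_def N1_def intro!: arg_cong[of _ _ card] dest: R_sym)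
    also have "card (S \<inter> {j. N1 v j}) \<le> card {j \<in> {0..<g}. N1 v j}"
      using S(1) by (intro card_mono[OF finite_residues]) auto
    finally have "(\<Sum>j\<in>S. of_bool ((c j, v) \<in> R)) \<le> (2::real)" using card_N1_le[of v] by linarith
    then show ?thesis using False by simp
  qed
  then have "(\<Sum>v\<in>V. 2 * (\<Sum>u\<in>U. of_bool ((u, v) \<in> R)) + (\<Sum>j\<in>S. of_bool ((c j, v) \<in> R))) \<le> (\<Sum>v\<in>V. 2::real)"
    by (intro sum_mono)
  moreover have "(\<Sum>v\<in>V. \<Sum>u\<in>U. of_bool ((u, v) \<in> R)) = (\<Sum>u\<in>U. deg u)"
    unfolding deg_sum by (rule sum.swap)
  moreover have "(\<Sum>v\<in>V. \<Sum>j\<in>S. of_bool ((c j, v) \<in> R)) = (\<Sum>j\<in>S. deg (c j))"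
    unfolding deg_sum by (rule sum.swap)
  ultimately show ?thesis by (simp add: sum.distrib flip: sum_distrib_left)
qed

text \<open>\<open>U = {w}\<close> is packed together with all circuit points that \<open>w\<close>
  does not reach in two steps, each of degree at least \<open>4 n / q\<close>.\<close>

lemma degree_le:
  assumes "card {j \<in> {0..<g}. N2 w j} \<le> m" "m \<le> 3"
  shows "q * deg w \<le> n * (q - 2 * (2 * real k + 1 - real m))"
proof -
  define S where "S = {0..<g} - {j \<in> {0..<g}. N2 w j}"
  have card: "real (card S) \<ge> 2 * real k + 1 - real m"
    using assms k3 unfolding S_def by (subst card_Diff_subset[OF finite_residues]) auto
  have "2 * (\<Sum>u\<in>{w}. deg u) + (\<Sum>j\<in>S. deg (c j)) \<le> 2 * n"
    by (rule sum_circuit_degrees_le) (auto simp: S_def simp del: sum_of_bool_eq)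
  then have "q * (2 * (\<Sum>u\<in>{w}. deg u) + (\<Sum>j\<in>S. deg (c j))) \<le> q * (2 * n)"
    using q_pos by (intro mult_left_mono) auto
  then have "2 * (q * deg w) + (\<Sum>j\<in>S. q * deg (c j)) \<le> 2 * (q * n)"
    by (simp add: distrib_left sum_distrib_left mult.left_commute)
  moreover have "real (card S) * (4 * n) \<le> (\<Sum>j\<in>S. q * deg (c j))"
    using min_degree[OF c_V] by (rule sum_bounded_below)
  moreover have "(2 * real k + 1 - real m) * (4 * n) \<le> real (card S) * (4 * n)"
    using card by (intro mult_right_mono) auto
  ultimately show ?thesis by (simp add: algebra_simps)
qed

end

section \<open>Long odd girth\<close>

lemma sum_odd_weights: "(\<Sum>i<N. 2 * real i + 1) = (real N)\<^sup>2"
  by (induction N) (auto simp: power2_eq_square algebra_simps)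

lemma sum_odd_weights_rev: "(\<Sum>t\<in>{d..<m}. 2 * (real m - real t) - 1) = (real m - real d)\<^sup>2" if "d \<le> m"
proof -
  have "(\<Sum>t\<in>{d..<m}. 2 * (real m - real t) - 1) = (\<Sum>i<m - d. 2 * real i + 1)"
    using that by (intro sum.reindex_bij_witness[where i = "\<lambda>i. m - Suc i" and j = "\<lambda>t. m - Suc t"])
      (auto simp: of_nat_diff)
  then show ?thesis using that by (simp add: sum_odd_weights of_nat_diff)
qed

lemma sum_odd_weights_shift: "(\<Sum>u\<in>{m..<d}. 2 * (real u - real m) + 1) = (real d - real m)\<^sup>2" if "m \<le> d"
proof -
  have "(\<Sum>u\<in>{m..<d}. 2 * (real u - real m) + 1) = (\<Sum>i<d - m. 2 * real i + 1)"
    using that by (intro sum.reindex_bij_witness[where i = "\<lambda>i. m + i" and j = "\<lambda>u. u - m"])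
      (auto simp: of_nat_diff)
  then show ?thesis using that by (simp add: sum_odd_weights of_nat_diff)
qed

lemma sum_odd_weights_linear:
  "(\<Sum>t<m. (2 * (real m - real t) - 1) * real t) = (real m - 1) * real m * (2 * real m - 1) / 6"
proof (induction m)
  case (Suc m)
  have "(\<Sum>t<Suc m. (2 * (real (Suc m) - real t) - 1) * real t)
      = (\<Sum>t<m. (2 * (real m - real t) - 1) * real t) + 2 * (\<Sum>t<m. real t) + real m"
    by (simp add: sum_distrib_left algebra_simps flip: sum.distrib)
  also have "(\<Sum>t<m. real t) = real m * (real m - 1) / 2"
    by (induction m) (auto simp: field_simps)
  finally show ?case unfolding Suc.IH by (simp add: field_simps)
qed simp

lemma sum_odd_weights_linear_rev:
  assumes "m \<le> k"
  shows "(\<Sum>u\<in>{m..<k}. (2 * (real u - real m) + 1) * (real k - 1 - real u))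
    = (real (k - m) - 1) * real (k - m) * (2 * real (k - m) - 1) / 6"
  unfolding sum_odd_weights_linear[symmetric]
  using assms by (intro sum.reindex_bij_witness[where i = "\<lambda>t. k - Suc t" and j = "\<lambda>u. k - Suc u"])
    (auto simp: of_nat_diff algebra_simps)

text \<open>For a fixed sum the right side is smallest at \<open>x = y\<close>. It removes the
  dependence on the centre \<open>m\<close> that splits \<open>k\<close> into \<open>m\<close> and
  \<open>k - m\<close>.\<close>

lemma cubic_split_bound:
  fixes x y :: real
  assumes "0 \<le> x" "0 \<le> y" "x + y \<ge> 1"
  shows "(x + y - 2) * (x + y - 1) * (x + y) / 12
    \<le> (x - 1) * x * (2 * x - 1) / 6 + (y - 1) * y * (2 * y - 1) / 6"
proof -
  have "(x - 1) * x * (2 * x - 1) / 6 + (y - 1) * y * (2 * y - 1) / 6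
      - (x + y - 2) * (x + y - 1) * (x + y) / 12 = (x + y - 1) * (x - y)\<^sup>2 / 4"
    by (simp add: field_simps power2_eq_square power3_eq_cube)
  also have "\<dots> \<ge> 0" using assms by simp
  finally show ?thesis by simp
qed

text \<open>Numbers congruent to 0 or 1 modulo 4 never differ by exactly 2. This is what separates
  the neighbourhoods in \<open>card_dist0_le\<close>.\<close>

lemma block_index_unique:
  fixes a a' x x' e :: int
  assumes "4 * a' + x' = 4 * a + x + e" "e \<in> {-2, 0, 2}" "x \<in> {0, 1}" "x' \<in> {0, 1}"
  shows "a' = a \<and> x' = x"
  using assms by (elim insertE emptyE; hypsubst; presburger)

context odd_circuit
begin

text \<open>The alternative \<open>t = k\<close> gives vertices without a short walk to
  \<open>c 0\<close> the value \<open>k\<close>; the truncated distance still changes by at most 1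
  along an edge.\<close>

definition dist0 :: "'a \<Rightarrow> nat" where "dist0 w = (LEAST t. t = k \<or> (w, c 0) \<in> R ^^ t)"

lemma dist0_le: "dist0 w \<le> k"
  unfolding dist0_def by (rule Least_le) simp

lemma dist0_le_walk: "(w, c 0) \<in> R ^^ t \<Longrightarrow> dist0 w \<le> t"
  unfolding dist0_def by (rule Least_le) simp

lemma dist0_walk: "dist0 w < k \<Longrightarrow> (w, c 0) \<in> R ^^ dist0 w"
  using LeastI[of "\<lambda>t. t = k \<or> (w, c 0) \<in> R ^^ t" k] unfolding dist0_def by auto

lemma dist0_edge: "(u, w) \<in> R \<Longrightarrow> dist0 u \<le> Suc (dist0 w)"
proof (cases "dist0 w < k")
  case True
  assume "(u, w) \<in> R"
  then have "(u, c 0) \<in> R ^^ Suc (dist0 w)" using dist0_walk[OF True] by (rule relpow_Suc_I2)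
  then show ?thesis by (rule dist0_le_walk)
qed (use dist0_le[of u] in simp)

text \<open>The neighbourhoods of \<open>c\<^sub>l\<close> for \<open>l = 1 - t, 2 - t, 5 - t, 6 - t, 9 - t, \<dots>\<close> are disjoint.\<close>

lemma card_dist0_le:
  assumes t: "t < k"
  shows "4 * n * real t \<le> q * real (card {w \<in> V. dist0 w \<le> t})"
proof -
  define l where "l s = 2 * int s - int (s mod 2) - (int t - 1)" for s :: nat
  have l_bd: "\<bar>l s\<bar> \<le> int t - 1" if "s < t" for s
  proof -
    have "s mod 2 \<le> 1" "s mod 2 \<le> s" by auto
    then show ?thesis using that unfolding l_def abs_le_iff by linarith
  qed
  have inj: "s = s'" if ss: "s < t" "s' < t" and N: "N1 v (l s)" "N1 v (l s')" for s s' v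
  proof -
    obtain e where e: "e \<in> {-2, 0, 2}" "g dvd l s' - l s - e" using near11[OF N] .
    have "\<bar>e\<bar> \<le> 2" using e(1) by auto
    then have "\<bar>l s' - l s - e\<bar> < g" using l_bd[OF ss(1)] l_bd[OF ss(2)] t by linarith
    moreover have "\<bar>g\<bar> \<le> \<bar>l s' - l s - e\<bar>" if "l s' - l s - e \<noteq> 0"
      using that e(2) by (rule dvd_imp_le_int)
    ultimately have "l s' - l s - e = 0" by linarith
    then have "2 * int s' - int (s' mod 2) - (2 * int s - int (s mod 2)) = e"
      by (simp add: l_def)
    moreover obtain a x where "s = 2 * a + x" "s mod 2 = x" "x \<le> 1"
      by (rule that[of "s div 2" "s mod 2"]) auto
    moreover obtain a' x' where "s' = 2 * a' + x'" "s' mod 2 = x'" "x' \<le> 1"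
      by (rule that[of "s' div 2" "s' mod 2"]) auto
    moreover have "e = - 2 \<or> e = 0 \<or> e = 2" using e(1) by simp
    ultimately have "4 * int a' + int x' = 4 * int a + int x + e" by simp
    then have "int a' = int a \<and> int x' = int x"
      using e(1) \<open>x \<le> 1\<close> \<open>x' \<le> 1\<close> by (intro block_index_unique) auto
    then show ?thesis using \<open>s = 2 * a + x\<close> \<open>s' = 2 * a' + x'\<close> by simp
  qed
  have "(\<Sum>s<t. of_bool ((c (l s), v) \<in> R)) \<le> (of_bool (dist0 v \<le> t) :: real)" for v
  proof (cases "\<exists>s<t. (c (l s), v) \<in> R")
    case True
    then obtain s where s: "s < t" "N1 v (l s)" using R_sym by (auto simp: N1_def)
    have "(v, c 0) \<in> R ^^ (1 + nat \<bar>0 - l s\<bar>)"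
      by (rule relpow_trans[OF _ circuit_walk]) (use s(2) in \<open>simp add: N1_def\<close>)
    from dist0_le_walk[OF this] have "dist0 v \<le> t" using l_bd[OF s(1)] by linarith
    moreover have "(\<Sum>s'<t. of_bool ((c (l s'), v) \<in> R)) \<le> (\<Sum>s'<t. of_bool (s' = s) :: real)"
    proof (rule sum_mono)
      fix s' assume "s' \<in> {..<t}"
      moreover have "N1 v (l s')" if "(c (l s'), v) \<in> R" using R_sym[OF that] by (simp add: N1_def)
      ultimately show "of_bool ((c (l s'), v) \<in> R) \<le> (of_bool (s' = s) :: real)"
        using inj[OF _ s(1) _ s(2), of s'] by auto
    qed
    moreover have "(\<Sum>s'<t. of_bool (s' = s) :: real) = 1"
      using s(1) by (simp add: of_bool_def)
    ultimately show ?thesis by simp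
  next
    case False
    then have "(\<Sum>s<t. of_bool ((c (l s), v) \<in> R)) = (0::real)" by (intro sum.neutral) auto
    then show ?thesis by simp
  qed
  then have "(\<Sum>v\<in>V. \<Sum>s<t. of_bool ((c (l s), v) \<in> R)) \<le> (\<Sum>v\<in>V. of_bool (dist0 v \<le> t) :: real)"
    by (intro sum_mono)
  also have "(\<Sum>v\<in>V. \<Sum>s<t. of_bool ((c (l s), v) \<in> R)) = (\<Sum>s<t. deg (c (l s)))"
    unfolding deg_sum by (rule sum.swap)
  also have "(\<Sum>v\<in>V. of_bool (dist0 v \<le> t) :: real) = real (card {w \<in> V. dist0 w \<le> t})"
    using fin by (simp add: sum.If_cases of_bool_def Int_def)
  finally have "q * (\<Sum>s<t. deg (c (l s))) \<le> q * real (card {w \<in> V. dist0 w \<le> t})"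
    using q_pos by (intro mult_left_mono) auto
  moreover have "real (card {..<t}) * (4 * n) \<le> (\<Sum>s<t. q * deg (c (l s)))"
    using min_degree[OF c_V] by (rule sum_bounded_below)
  ultimately show ?thesis by (simp add: sum_distrib_left mult.commute)
qed

text \<open>\<open>S\<close> collects the circuit points at least \<open>u + 2\<close> steps from
  \<open>c 0\<close> along either arc. A neighbour of such a point within distance \<open>u\<close>
  of \<open>c 0\<close> would close one of the two arcs to an odd walk shorter than
  \<open>g\<close>. Each vertex is counted at most twice.\<close>

lemma card_dist0_gt:
  assumes u: "u < k"
  shows "4 * n * (real k - 1 - real u) \<le> q * real (card {w \<in> V. u < dist0 w})"
proof -
  define S where "S = {int u + 2..<2 * int k - int u}"
  have S: "S \<subseteq> {0..<g}" "finite S" "real (card S) = 2 * (real k - 1 - real u)"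
    using u by (auto simp: S_def)
  have far: "u < dist0 v" if l: "l \<in> S" "N1 v l" for l v
  proof (rule ccontr)
    assume "\<not> u < dist0 v"
    then have d: "dist0 v \<le> u" by simp
    then have w0: "(v, c 0) \<in> R ^^ dist0 v" using u by (intro dist0_walk) simp
    then have wg: "(v, c g) \<in> R ^^ dist0 v" using c_cong[of g 0] by simp
    have wl: "(v, c l) \<in> R ^^ 1" using l(2) by (simp add: N1_def)
    show False
    proof (cases "odd (int (dist0 v) + 1 + l)")
      case True
      have "g \<le> int (dist0 v) + int 1 + \<bar>l - 0\<bar>" by (rule odd_detour[OF w0 wl]) (use True in simp)
      then show False using d l(1) by (simp add: S_def)
    next
      case False
      have "g \<le> int 1 + int (dist0 v) + \<bar>g - l\<bar>" by (rule odd_detour[OF wl wg]) (use False in simp)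
      then show False using d l(1) by (simp add: S_def)
    qed
  qed
  have "(\<Sum>l\<in>S. of_bool ((c l, v) \<in> R)) \<le> (2 * of_bool (u < dist0 v) :: real)" for v
  proof (cases "\<exists>l\<in>S. (c l, v) \<in> R")
    case True
    then obtain l where "l \<in> S" "N1 v l" using R_sym by (auto simp: N1_def)
    then have "u < dist0 v" by (rule far)
    moreover have "(\<Sum>l\<in>S. of_bool ((c l, v) \<in> R)) = real (card (S \<inter> {j. N1 v j}))"
      using S(2) by (auto simp: sum.If_cases of_bool_def N1_def intro!: arg_cong[of _ _ card] dest: R_sym)
    moreover have "card (S \<inter> {j. N1 v j}) \<le> card {j \<in> {0..<g}. N1 v j}"
      using S(1) by (intro card_mono[OF finite_residues]) auto
    ultimately show ?thesis using card_N1_le[of v] by simp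
  next
    case False
    then have "(\<Sum>l\<in>S. of_bool ((c l, v) \<in> R)) = (0::real)" by (intro sum.neutral) auto
    then show ?thesis by simp
  qed
  then have "(\<Sum>v\<in>V. \<Sum>l\<in>S. of_bool ((c l, v) \<in> R)) \<le> (\<Sum>v\<in>V. 2 * of_bool (u < dist0 v) :: real)"
    by (intro sum_mono)
  also have "(\<Sum>v\<in>V. \<Sum>l\<in>S. of_bool ((c l, v) \<in> R)) = (\<Sum>l\<in>S. deg (c l))"
    unfolding deg_sum by (rule sum.swap)
  also have "(\<Sum>v\<in>V. 2 * of_bool (u < dist0 v) :: real) = 2 * real (card {w \<in> V. u < dist0 w})"
    using fin by (simp add: sum.If_cases of_bool_def Int_def flip: sum_distrib_left)
  finally have "q * (\<Sum>l\<in>S. deg (c l)) \<le> q * (2 * real (card {w \<in> V. u < dist0 w}))"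
    using q_pos by (intro mult_left_mono) auto
  moreover have "real (card S) * (4 * n) \<le> q * (\<Sum>l\<in>S. deg (c l))"
    unfolding sum_distrib_left using min_degree[OF c_V] by (rule sum_bounded_below)
  ultimately have "2 * (4 * n * (real k - 1 - real u)) \<le> 2 * (q * real (card {w \<in> V. u < dist0 w}))"
    unfolding S(3) by (simp only: mult_ac)
  then show ?thesis by simp
qed

text \<open>Adjacent vertices have disjoint neighbourhoods, and together reach at most six circuit
  points in two steps. The packing bound leaves \<open>q - 2 (2 k - 5) = 2 k + 9\<close>.\<close>

lemma edge_degrees_le:
  assumes uw: "(u, w) \<in> R"
  shows "q * (deg u + deg w) \<le> n * (2 * real k + 9)"
proof -
  define S where "S = {0..<g} - ({j \<in> {0..<g}. N2 u j} \<union> {j \<in> {0..<g}. N2 w j})"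
  have ne: "u \<noteq> w" using uw irrefl by auto
  have "card ({j \<in> {0..<g}. N2 u j} \<union> {j \<in> {0..<g}. N2 w j}) \<le> 6"
    using card_N2_le[of u] card_N2_le[of w] card_Un_le[of "{j \<in> {0..<g}. N2 u j}" "{j \<in> {0..<g}. N2 w j}"] by linarith
  moreover have "card {0..<g} - card ({j \<in> {0..<g}. N2 u j} \<union> {j \<in> {0..<g}. N2 w j}) \<le> card S"
    unfolding S_def by (rule diff_card_le_card_Diff) (intro finite_UnI finite_residues)
  ultimately have card: "2 * real k - 5 \<le> real (card S)" by simp
  have "\<not> ((u, v) \<in> R \<and> (w, v) \<in> R)" for v
  proof
    assume "(u, v) \<in> R \<and> (w, v) \<in> R"
    then have "(u, u) \<in> R ^^ 3"
      using uw R_sym by (auto simp: numeral_3_eq_3)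
    from no_short[OF this] k3 show False by simp
  qed
  then have "2 * (\<Sum>u\<in>{u, w}. deg u) + (\<Sum>j\<in>S. deg (c j)) \<le> 2 * n"
    using ne by (intro sum_circuit_degrees_le) (auto simp: S_def simp del: sum_of_bool_eq)
  then have "q * (2 * (deg u + deg w) + (\<Sum>j\<in>S. deg (c j))) \<le> q * (2 * n)"
    using q_pos ne by (intro mult_left_mono) auto
  then have "2 * (q * (deg u + deg w)) + (\<Sum>j\<in>S. q * deg (c j)) \<le> 2 * (q * n)"
    by (simp only: distrib_left[of q "2 * _"] sum_distrib_left mult.left_commute)
  moreover have "real (card S) * (4 * n) \<le> (\<Sum>j\<in>S. q * deg (c j))"
    using min_degree[OF c_V] by (rule sum_bounded_below)
  moreover have "(2 * real k - 5) * (4 * n) \<le> real (card S) * (4 * n)"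
    using card by (intro mult_right_mono) auto
  ultimately have "2 * (q * (deg u + deg w)) \<le> 2 * (q * n) - (2 * real k - 5) * (4 * n)" by linarith
  then show ?thesis by (simp add: algebra_simps)
qed

text \<open>Summing \<open>edge_degrees_le\<close> over all arcs bounds the sum of squared degrees
  by a multiple of the degree sum \<open>m\<close>. Cauchy-Schwarz, in the form of a nonnegative sum
  of \<open>(n deg v - m)^2\<close>, then bounds \<open>m\<close> itself.\<close>

lemma sum_degrees_le: "2 * q * (\<Sum>v\<in>V. deg v) \<le> n\<^sup>2 * (2 * real k + 9)"
proof -
  define m where "m = (\<Sum>v\<in>V. deg v)"
  have m0: "m \<ge> 0" unfolding m_def by (intro sum_nonneg) (simp add: deg_def)
  have cardR: "real (card R) = m"
    using sum_R_fst[of "\<lambda>_. 1"] by (simp add: m_def)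
  have n0: "n > 0" using c_V[of 0] fin by (auto simp: card_gt_0_iff)
  have "(\<Sum>(u, v)\<in>R. q * (deg u + deg v)) \<le> (\<Sum>(u, v)\<in>R. n * (2 * real k + 9))"
    by (intro sum_mono) (use edge_degrees_le in auto)
  moreover have "(\<Sum>(u, v)\<in>R. q * (deg u + deg v)) = q * (2 * (\<Sum>v\<in>V. (deg v)\<^sup>2))"
    using sum_R_fst[of "\<lambda>v. q * deg v"] sum_R_snd[of "\<lambda>v. q * deg v"]
    by (simp add: case_prod_unfold distrib_left sum.distrib power2_eq_square sum_distrib_left mult_ac)
  ultimately have sq: "q * (2 * (\<Sum>v\<in>V. (deg v)\<^sup>2)) \<le> m * (n * (2 * real k + 9))"
    by (simp add: case_prod_unfold cardR)
  have "0 \<le> (\<Sum>v\<in>V. (n * deg v - m)\<^sup>2)" by (intro sum_nonneg) simp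
  also have "\<dots> = n\<^sup>2 * (\<Sum>v\<in>V. (deg v)\<^sup>2) - 2 * n * m * (\<Sum>v\<in>V. deg v) + n * m\<^sup>2"
    by (simp add: power2_diff sum.distrib sum_subtractf power_mult_distrib sum_distrib_left mult_ac)
  also have "\<dots> = n * (n * (\<Sum>v\<in>V. (deg v)\<^sup>2) - m\<^sup>2)"
    by (simp add: m_def[symmetric] power2_eq_square algebra_simps)
  finally have "m\<^sup>2 \<le> n * (\<Sum>v\<in>V. (deg v)\<^sup>2)"
    using n0 by (simp add: zero_le_mult_iff)
  then have "2 * q * m\<^sup>2 \<le> 2 * q * (n * (\<Sum>v\<in>V. (deg v)\<^sup>2))"
    using q_pos by (intro mult_left_mono) auto
  also have "\<dots> \<le> n * (m * (n * (2 * real k + 9)))"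
    using mult_left_mono[OF sq, of n] n0 by (simp only: mult_ac of_nat_0_le_iff)
  finally have "m * (2 * q * m) \<le> m * (n\<^sup>2 * (2 * real k + 9))"
    by (simp add: power2_eq_square mult_ac)
  then show ?thesis
    using m0 n0 by (cases "m = 0") (auto simp: m_def[symmetric] mult_le_cancel_left)
qed

text \<open>Layer-cake argument: \<open>(d - m)^2\<close> is a sum of consecutive odd weights over
  the thresholds between \<open>d\<close> and \<open>m\<close>. Thresholds below \<open>m\<close>
  are paid for by the sizes of balls, those from \<open>m\<close> on by the sizes of their
  complements.\<close>

lemma sum_dist0_deviation:
  assumes m: "m \<le> k"
  shows "n * (real k - 2) * (real k - 1) * real k / 3 \<le> q * (\<Sum>w\<in>V. (real (dist0 w) - real m)\<^sup>2)"
proof -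
  have pt: "(real (dist0 w) - real m)\<^sup>2 = (\<Sum>t<m. (2 * (real m - real t) - 1) * of_bool (dist0 w \<le> t))
      + (\<Sum>u\<in>{m..<k}. (2 * (real u - real m) + 1) * of_bool (u < dist0 w))" (is "_ = ?A + ?B") for w
  proof (cases "dist0 w \<le> m")
    case True
    have "?A = (\<Sum>t\<in>{dist0 w..<m}. 2 * (real m - real t) - 1)"
      by (intro sum.mono_neutral_cong_right) auto
    moreover have "?B = 0" using True by (intro sum.neutral) auto
    ultimately show ?thesis
      using sum_odd_weights_rev[OF True] by (simp add: power2_commute)
  next
    case False
    have "?A = 0" using False by (intro sum.neutral) auto
    moreover have "?B = (\<Sum>u\<in>{m..<dist0 w}. 2 * (real u - real m) + 1)"
      using dist0_le[of w] by (intro sum.mono_neutral_cong_right) auto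
    ultimately show ?thesis using sum_odd_weights_shift[of m "dist0 w"] False by simp
  qed
  have cnt: "(\<Sum>w\<in>V. of_bool (P w)) = real (card {w \<in> V. P w})" for P
    using fin by (simp add: sum.If_cases of_bool_def Int_def)
  have "(\<Sum>w\<in>V. (real (dist0 w) - real m)\<^sup>2)
      = (\<Sum>t<m. (2 * (real m - real t) - 1) * real (card {w \<in> V. dist0 w \<le> t}))
      + (\<Sum>u\<in>{m..<k}. (2 * (real u - real m) + 1) * real (card {w \<in> V. u < dist0 w}))"
    unfolding pt sum.distrib
    by (subst (1 2) sum.swap) (simp only: cnt flip: sum_distrib_left)
  then have "q * (\<Sum>w\<in>V. (real (dist0 w) - real m)\<^sup>2)
      = (\<Sum>t<m. (2 * (real m - real t) - 1) * (q * real (card {w \<in> V. dist0 w \<le> t})))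
      + (\<Sum>u\<in>{m..<k}. (2 * (real u - real m) + 1) * (q * real (card {w \<in> V. u < dist0 w})))"
    by (simp only: distrib_left sum_distrib_left mult.left_commute)
  also have "\<dots> \<ge> (\<Sum>t<m. (2 * (real m - real t) - 1) * (4 * n * real t))
      + (\<Sum>u\<in>{m..<k}. (2 * (real u - real m) + 1) * (4 * n * (real k - 1 - real u)))"
    using m by (intro add_mono sum_mono mult_left_mono card_dist0_le card_dist0_gt) auto
  also have "(\<Sum>t<m. (2 * (real m - real t) - 1) * (4 * n * real t))
      + (\<Sum>u\<in>{m..<k}. (2 * (real u - real m) + 1) * (4 * n * (real k - 1 - real u)))
    = 4 * n * ((\<Sum>t<m. (2 * (real m - real t) - 1) * real t)
      + (\<Sum>u\<in>{m..<k}. (2 * (real u - real m) + 1) * (real k - 1 - real u)))"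
    by (simp only: distrib_left sum_distrib_left mult.left_commute)
  finally have low: "4 * n * ((real m - 1) * real m * (2 * real m - 1) / 6
      + (real (k - m) - 1) * real (k - m) * (2 * real (k - m) - 1) / 6)
      \<le> q * (\<Sum>w\<in>V. (real (dist0 w) - real m)\<^sup>2)"
    unfolding sum_odd_weights_linear sum_odd_weights_linear_rev[OF m] .
  have sum: "real m + real (k - m) = real k" using m by simp
  have "(real k - 2) * (real k - 1) * real k / 12 \<le> (real m - 1) * real m * (2 * real m - 1) / 6
      + (real (k - m) - 1) * real (k - m) * (2 * real (k - m) - 1) / 6"
    using cubic_split_bound[of "real m" "real (k - m)"] k3 unfolding sum by simp
  then have "4 * n * ((real k - 2) * (real k - 1) * real k / 12) \<le> 4 * n * ((real m - 1) * real m * (2 * real m - 1) / 6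
      + (real (k - m) - 1) * real (k - m) * (2 * real (k - m) - 1) / 6)"
    by (intro mult_left_mono) auto
  moreover have "n * (real k - 2) * (real k - 1) * real k / 3
      = 4 * n * ((real k - 2) * (real k - 1) * real k / 12)"
    by simp
  ultimately show ?thesis using low by (simp only: order_trans)
qed

lemma k_less_7: "k < 7"
proof (rule ccontr)
  assume "\<not> k < 7"
  then have k7: "real k \<ge> 7" by simp
  define f where "f w = real (dist0 w)" for w
  define s where "s = (\<Sum>w\<in>V. f w)"
  have n0: "n > 0" using c_V[of 0] fin by (auto simp: card_gt_0_iff)
  have s: "0 \<le> s" "s \<le> n * real k"
    using sum_bounded_above[of V f "real k"] dist0_le by (auto simp: s_def f_def intro: sum_nonneg)
  \<comment> \<open>The mean rounded to the nearest integer, since the layer-cake bound needs an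
    integral centre. Moving the centre away from the mean costs at most
    \<open>n^2 / 4\<close>.\<close>
  define m where "m = nat \<lfloor>s / n + 1 / 2\<rfloor>"
  have "s / n \<le> real k" using s n0 by (simp add: field_simps)
  then have fl: "0 \<le> \<lfloor>s / n + 1 / 2\<rfloor>" "\<lfloor>s / n + 1 / 2\<rfloor> \<le> int k"
    using s n0 by (auto simp: floor_le_iff)
  then have m: "m \<le> k" and rm: "real m = of_int \<lfloor>s / n + 1 / 2\<rfloor>" by (auto simp: m_def)
  have "\<bar>s / n - real m\<bar> \<le> 1 / 2" unfolding rm by linarith
  then have "\<bar>s - n * real m\<bar> \<le> n / 2"
    using n0 by (simp add: abs_le_iff field_simps)
  then have dev: "(s - n * real m)\<^sup>2 \<le> n\<^sup>2 / 4"
    using power_mono[of "\<bar>s - n * real m\<bar>" "n / 2" 2] by (simp add: power_divide)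
  have "(f u - f w)\<^sup>2 \<le> 1" if "(u, w) \<in> R" for u w
    using dist0_edge[OF that] dist0_edge[OF R_sym[OF that]] by (simp add: f_def abs_square_le_1)
  then have "(\<Sum>(u, w)\<in>R. (f u - f w)\<^sup>2) \<le> (\<Sum>(u, w)\<in>R. 1)"
    by (intro sum_mono) auto
  also have "\<dots> = (\<Sum>v\<in>V. deg v)" using sum_R_fst[of "\<lambda>_. 1"] by simp
  finally have "q * ((\<Sum>(u, w)\<in>R. (f u - f w)\<^sup>2) / 2) \<le> q * ((\<Sum>v\<in>V. deg v) / 2)"
    using q_pos by (intro mult_left_mono) auto
  then have var: "n * (\<Sum>w\<in>V. (f w)\<^sup>2) - s\<^sup>2 \<le> n\<^sup>2 * (2 * real k + 9) / 16"
  proof -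
    have "4 * (n * (\<Sum>w\<in>V. (f w)\<^sup>2) - s\<^sup>2) \<le> q * ((\<Sum>(u, w)\<in>R. (f u - f w)\<^sup>2) / 2)"
      using gap[of f] unfolding s_def .
    also have "\<dots> \<le> q * ((\<Sum>v\<in>V. deg v) / 2)" by fact
    also have "\<dots> = 2 * q * (\<Sum>v\<in>V. deg v) / 4" by simp
    also have "\<dots> \<le> n\<^sup>2 * (2 * real k + 9) / 4"
      by (rule divide_right_mono[OF sum_degrees_le]) simp
    finally show ?thesis by simp
  qed
  have "n * (\<Sum>w\<in>V. (f w - real m)\<^sup>2) = n * (\<Sum>w\<in>V. (f w)\<^sup>2) - s\<^sup>2 + (s - n * real m)\<^sup>2"
  proof -
    have "(\<Sum>w\<in>V. (f w - real m)\<^sup>2) = (\<Sum>w\<in>V. (f w)\<^sup>2 - 2 * real m * f w + (real m)\<^sup>2)"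
      by (intro sum.cong refl) (simp add: power2_diff)
    also have "\<dots> = (\<Sum>w\<in>V. (f w)\<^sup>2) - 2 * real m * s + n * (real m)\<^sup>2"
      unfolding s_def by (simp add: sum.distrib sum_subtractf flip: sum_distrib_left)
    finally have "(\<Sum>w\<in>V. (f w - real m)\<^sup>2) = (\<Sum>w\<in>V. (f w)\<^sup>2) - 2 * real m * s + n * (real m)\<^sup>2" .
    then show ?thesis by (simp only: power2_eq_square) (simp add: algebra_simps)
  qed
  then have "n * (\<Sum>w\<in>V. (f w - real m)\<^sup>2) \<le> n\<^sup>2 * (2 * real k + 13) / 16"
    using var dev by (simp add: field_simps)
  then have "q * (n * (\<Sum>w\<in>V. (f w - real m)\<^sup>2)) \<le> q * (n\<^sup>2 * (2 * real k + 13) / 16)"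
    using q_pos by (intro mult_left_mono) auto
  also have "\<dots> = n\<^sup>2 * (q * (2 * real k + 13) / 16)" by simp
  finally have "n * (q * (\<Sum>w\<in>V. (f w - real m)\<^sup>2)) \<le> n\<^sup>2 * (q * (2 * real k + 13) / 16)"
    by (simp only: mult_ac)
  note upper = this
  have "n\<^sup>2 * ((real k - 2) * (real k - 1) * real k / 3) = n * (n * (real k - 2) * (real k - 1) * real k / 3)"
    by (simp add: power2_eq_square)
  also have "\<dots> \<le> n * (q * (\<Sum>w\<in>V. (f w - real m)\<^sup>2))"
    unfolding f_def by (intro mult_left_mono sum_dist0_deviation m) auto
  also note upper
  finally have "n\<^sup>2 * ((real k - 2) * (real k - 1) * real k / 3) \<le> n\<^sup>2 * (q * (2 * real k + 13) / 16)" .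
  then have "(real k - 2) * (real k - 1) * real k / 3 \<le> q * (2 * real k + 13) / 16"
    using n0 by (simp only: mult_le_cancel_left_pos zero_less_power)
  \<comment> \<open>At \<open>k = 7\<close> the two sides are 3360 and 3321; at \<open>k = 6\<close>
    they are 1920 and 2625, so the smaller cases need the certificates.\<close>
  moreover have "16 * ((real k - 2) * (real k - 1) * real k) > 3 * (q * (2 * real k + 13))"
  proof -
    define x where "x = real k - 7"
    have x: "x \<ge> 0" "real k = x + 7" using k7 by (auto simp: x_def)
    have "16 * ((real k - 2) * (real k - 1) * real k) - 3 * (q * (2 * real k + 13))
      = 16 * x ^ 3 + 252 * x\<^sup>2 + 980 * x + 39"
      unfolding x(2) by (simp add: power2_eq_square power3_eq_cube algebra_simps)
    also have "\<dots> > 0" using x(1) by (simp add: add_nonneg_pos)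
    finally show ?thesis by simp
  qed
  ultimately show False by simp
qed

section \<open>The energy of the distance levels\<close>

definition level :: "int \<Rightarrow> 'a \<Rightarrow> real" where
  "level j w = 2 - 3 * of_bool (N1 w j) - 2 * of_bool (N2 w j)"

definition load :: "'a \<Rightarrow> real" where
  "load w = (\<Sum>j\<in>{0..<g}. 4 * of_bool (N2 w j) - 3 * of_bool (N1 w j))"

lemma no_odd_closed: "(u, u) \<in> R ^^ t \<Longrightarrow> odd t \<Longrightarrow> t \<le> 5 \<Longrightarrow> False"
  using no_short[of u t] k3 by linarith

lemma N1_N2_exclusive: "\<not> (N1 w j \<and> N2 w j)"
proof
  assume "N1 w j \<and> N2 w j"
  then have "(w, w) \<in> R ^^ (1 + 2)"
    by (intro relpow_trans[OF _ relpow_sym[OF sym_R]]) (auto simp: N1_def N2_def)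
  then show False by (rule no_odd_closed) auto
qed

lemma N2_independent: "(u, v) \<in> R \<Longrightarrow> \<not> (N2 u j \<and> N2 v j)"
proof
  assume uv: "(u, v) \<in> R" and "N2 u j \<and> N2 v j"
  then have "(u, v) \<in> R ^^ (2 + 2)"
    by (intro relpow_trans[OF _ relpow_sym[OF sym_R]]) (auto simp: N2_def)
  then have "(u, u) \<in> R ^^ (Suc (2 + 2))"
    using R_sym[OF uv] by (rule relpow_Suc_I)
  then show False by (rule no_odd_closed) auto
qed

text \<open>All neighbours of an \<open>N1\<close> vertex are in \<open>N2\<close>, and
  \<open>N2\<close> is independent, both because odd closed walks of length 3 and 5 are excluded. So
  \<open>level\<close> changes along an edge only between \<open>N1\<close> and \<open>N2\<close>,
  by 1, or between \<open>N2\<close> and the rest, by 2. The weight 4 of \<open>N2\<close> is the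
  square of the second step, and -3 on \<open>N1\<close> corrects it to the square of the
  first.\<close>

lemma level_edge:
  assumes uv: "(u, v) \<in> R"
  shows "(level j u - level j v)\<^sup>2
    = (4 * of_bool (N2 u j) - 3 * of_bool (N1 u j)) + (4 * of_bool (N2 v j) - 3 * of_bool (N1 v j))"
  using N1_N2_exclusive[of u j] N1_N2_exclusive[of v j] N2_independent[OF uv, of j]
    N1_step[OF uv, of j] N1_step[OF R_sym[OF uv], of j]
  by (cases "N1 u j"; cases "N2 u j"; cases "N1 v j"; cases "N2 v j") (auto simp: level_def)

text \<open>Summed over \<open>j\<close>, each edge contributes the loads of its two ends.\<close>

lemma level_energy:
  "2 * (\<Sum>w\<in>V. \<Sum>w'\<in>V. \<Sum>j\<in>{0..<g}. (level j w - level j w')\<^sup>2) \<le> q * (\<Sum>w\<in>V. load w * deg w)"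
proof -
  have one: "2 * (\<Sum>w\<in>V. \<Sum>w'\<in>V. (level j w - level j w')\<^sup>2)
    \<le> q * (\<Sum>w\<in>V. (4 * of_bool (N2 w j) - 3 * of_bool (N1 w j)) * deg w)" for j
  proof -
    have "(\<Sum>w\<in>V. \<Sum>w'\<in>V. (level j w - level j w')\<^sup>2)
      = (\<Sum>w\<in>V. \<Sum>w'\<in>V. (level j w)\<^sup>2 + (level j w')\<^sup>2 - 2 * (level j w * level j w'))"
      by (intro sum.cong refl) (simp add: power2_diff)
    also have "\<dots> = 2 * (n * (\<Sum>w\<in>V. (level j w)\<^sup>2) - (\<Sum>w\<in>V. level j w)\<^sup>2)"
      by (simp add: sum.distrib sum_subtractf power2_eq_square[of "sum _ _"] sum_product flip: sum_distrib_left)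
    finally have "2 * (\<Sum>w\<in>V. \<Sum>w'\<in>V. (level j w - level j w')\<^sup>2)
      \<le> q * ((\<Sum>(u, v)\<in>R. (level j u - level j v)\<^sup>2) / 2)"
      using gap[of "level j"] by simp
    also have "(\<Sum>(u, v)\<in>R. (level j u - level j v)\<^sup>2)
      = (\<Sum>(u, v)\<in>R. 4 * of_bool (N2 u j) - 3 * of_bool (N1 u j))
      + (\<Sum>(u, v)\<in>R. 4 * of_bool (N2 v j) - 3 * of_bool (N1 v j))"
      unfolding sum.distrib[symmetric] by (intro sum.cong refl) (auto simp: level_edge)
    finally show ?thesis by (simp add: sum_R_fst sum_R_snd)
  qed
  have "2 * (\<Sum>w\<in>V. \<Sum>w'\<in>V. \<Sum>j\<in>{0..<g}. (level j w - level j w')\<^sup>2)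
      = (\<Sum>j\<in>{0..<g}. 2 * (\<Sum>w\<in>V. \<Sum>w'\<in>V. (level j w - level j w')\<^sup>2))"
    unfolding sum_distrib_left[symmetric]
    by (subst sum.swap[of _ "{0..<g}"]) (intro arg_cong[of _ _ "(*) 2"] sum.cong refl sum.swap)
  also have "\<dots> \<le> (\<Sum>j\<in>{0..<g}. q * (\<Sum>w\<in>V. (4 * of_bool (N2 w j) - 3 * of_bool (N1 w j)) * deg w))"
    by (intro sum_mono one)
  also have "\<dots> = q * (\<Sum>w\<in>V. load w * deg w)"
    unfolding load_def sum_distrib_right sum_distrib_left[symmetric]
    by (intro arg_cong[of _ _ "(*) q"] sum.swap)
  finally show ?thesis .
qed

end

section \<open>Certificates\<close>

text \<open>A profile \<open>(xs, ys, b, bs, U)\<close> of a vertex \<open>w\<close> is relative to a position \<open>l\<close> on the circuit: \<open>w\<close>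
  has walks of length 1 and 2 to exactly the points \<open>c (l + e)\<close> with \<open>e \<in> xs\<close> and \<open>e \<in> ys\<close>, and
  \<open>16 q deg w \<le> n b + q (\<Sum>i. bs\<^sub>i deg (c (l + i)))\<close>. The multiplier of
  \<open>\<Sum>j. q deg (c j) - 4 n \<ge> 0\<close> attached to \<open>w\<close> is \<open>U\<close>.\<close>

type_synonym profile = "int list \<times> int list \<times> int \<times> int list \<times> int"

text \<open>The test vector equals 2 minus these weights.\<close>

fun weights :: "profile \<Rightarrow> (int \<times> int) list" where
  "weights (xs, ys, b, bs, U) = map (\<lambda>e. (e, 3)) xs @ map (\<lambda>e. (e, 2)) ys"

definition at_residue :: "int list \<Rightarrow> int \<Rightarrow> int" where
  "at_residue zs i = zs ! nat (i mod int (length zs))"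

definition overlap :: "int \<Rightarrow> profile \<Rightarrow> profile \<Rightarrow> int \<Rightarrow> int" where
  "overlap g a b d = (\<Sum>(e, x)\<leftarrow>weights a. \<Sum>(e', x')\<leftarrow>weights b. if g dvd e' + d - e then x * x' else 0)"

text \<open>For vertices with positions \<open>l\<close> and \<open>l' = l + d\<close>. The list \<open>lam\<close> holds the multipliers
  of \<open>\<Sum>j. (q deg (c j) - 4 n) (q deg (c (j + m)) - 4 n) \<ge> 0\<close>.\<close>

fun kernel :: "nat \<Rightarrow> int list \<Rightarrow> profile \<Rightarrow> profile \<Rightarrow> int \<Rightarrow> int" where
  "kernel k lam (xs, ys, b, bs, U) (xs', ys', b', bs', U') d =
    (let g = 2 * int k + 1; q = 6 * int k - 1 in
     32 * q * (9 * (int (length xs) + int (length xs')) + 4 * (int (length ys) + int (length ys'))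
       - 2 * overlap g (xs, ys, b, bs, U) (xs', ys', b', bs', U') d)
     - q * ((4 * int (length ys) - 3 * int (length xs)) * (b + q * (\<Sum>e\<leftarrow>xs'. at_residue bs (e + d)))
       + U * (q * int (length xs') - 4 * g))
     - (q * q * (\<Sum>e\<leftarrow>xs. \<Sum>e'\<leftarrow>xs'. at_residue lam (e' + d - e))
       - 4 * q * sum_list lam * (int (length xs) + int (length xs')) + 16 * g * sum_list lam))"

text \<open>The list \<open>nu\<close> holds multipliers of \<open>q deg (c (l \<plusminus> i)) - 4 n \<ge> 0\<close>, added to the degree bounds of
  the second and the third profile, which are mirror images.\<close>

definition profiles :: "nat \<Rightarrow> int list \<Rightarrow> int list \<Rightarrow> profile list" where
  "profiles k nu us = (let g = 2 * int k + 1; q = 6 * int k - 1;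
      bs = map2 (+) nu (0 # 16 # 16 # replicate (2 * k - 2) 0); b = - 64 - 4 * sum_list nu in
    [([-1, 1], [-2, 0, 2], 0, 16 # replicate (2 * k) 0, 0),
     ([0], [-1, 1, 3], b, bs, 0),
     ([0], [-1, 1, -3], b, hd bs # rev (tl bs), 0),
     ([0], [-1, 1], 16 * q - 32 * (g - 2), replicate (2 * k + 1) 0, us ! 0),
     ([], [-2, 0, 2], - 64 * (g - 1), replicate (2 * k + 1) 16, 0),
     ([], [0, 2], 16 * q - 32 * (g - 2), replicate (2 * k + 1) 0, us ! 1),
     ([], [-2, 2], 16 * q - 32 * (g - 2), replicate (2 * k + 1) 0, us ! 1),
     ([], [0], 16 * q - 32 * (g - 1), replicate (2 * k + 1) 0, us ! 2),
     ([], [], 16 * q - 32 * g, replicate (2 * k + 1) 0, us ! 3)])"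

text \<open>Only the symmetrized kernel has to be positive, because both orders of a pair occur in
  the double sum. The residues \<open>d\<close> cover all relative positions of two
  profiles.\<close>

definition certificate :: "nat \<Rightarrow> int list \<Rightarrow> int list \<Rightarrow> int list \<Rightarrow> bool" where
  "certificate k nu lam us \<longleftrightarrow> length nu = 2 * k + 1 \<and> length lam = 2 * k + 1 \<and> length us = 4
    \<and> list_all (\<lambda>i. 0 \<le> i) (nu @ lam @ us)
    \<and> list_all (\<lambda>a. list_all (\<lambda>b. list_all (\<lambda>d. 0 < kernel k lam a b d + kernel k lam b a (- d))
        [0..2 * int k]) (profiles k nu us)) (profiles k nu us)"

text \<open>In each certificate \<open>lam\<close> vanishes beyond index \<open>k\<close>: the
  shifts \<open>m\<close> and \<open>g - m\<close> give the same cyclic sum of products.\<close>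

lemma certificate_3:
  "certificate 3 [4,1,0,3,5,16,13] [48,0,72,184,0,0,0] [104,128,288,392]"
  by code_simp

lemma certificate_4:
  "certificate 4 [8,1,0,8,11,14,13,15,16] [32,16,144,192,112,0,0,0,0] [80,128,240,304]"
  by code_simp

lemma certificate_5:
  "certificate 5 [7,1,0,7,7,15,14,10,10,15,14] [56,40,120,192,176,120,0,0,0,0,0] [88,144,232,280]"
  by code_simp

lemma certificate_6:
  "certificate 6 [8,1,0,11,9,12,16,15,11,11,15,16,14] [42,36,134,162,124,118,152,0,0,0,0,0,0] [74,128,200,242]"
  by code_simp

section \<open>Cyclic sums evaluated from profiles\<close>

lemma at_residue_cong:
  "int (length zs) dvd i - j \<Longrightarrow> at_residue zs i = at_residue zs j"
  unfolding at_residue_def by (metis mod_eq_dvd_iff)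

lemma sum_at_residue:
  fixes h :: "int \<Rightarrow> 'b::comm_ring_1"
  shows "(\<Sum>i\<in>{0..<int (length zs)}. of_int (at_residue zs i) * h i) = (\<Sum>i<length zs. of_int (zs ! i) * h (int i))"
  by (rule sum.reindex_bij_witness[where i = int and j = nat]) (auto simp: at_residue_def)

lemma sum_at_residue_int: "(\<Sum>i\<in>{0..<int (length zs)}. at_residue zs i) = sum_list zs"
  using sum_at_residue[of zs "\<lambda>_. 1 :: int"] by (simp add: sum_list_sum_nth atLeast0LessThan)

text \<open>Reflecting the circuit about the position of a vertex fixes index 0 and reverses the
  others; this turns the bound of the second profile into that of the third.\<close>

lemma at_residue_reverse:
  assumes "zs \<noteq> []"
  shows "at_residue (hd zs # rev (tl zs)) i = at_residue zs (- i)"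
proof -
  define m where "m = length zs"
  have m: "m > 0" using assms by (simp add: m_def)
  have len: "length (hd zs # rev (tl zs)) = m" using assms by (simp add: m_def)
  define r where "r = nat (i mod int m)"
  have r: "r < m" "int r = i mod int m" using m by (simp_all add: r_def nat_less_iff)
  have r0: "r = 0 \<longleftrightarrow> i mod int m = 0" using r(2) by linarith
  have neg: "(- i) mod int m = (if r = 0 then 0 else int m - int r)"
    unfolding r0 r(2) by (simp add: zmod_zminus1_eq_if)
  show ?thesis
  proof (cases "r = 0")
    case True
    then show ?thesis using r neg assms len by (simp add: at_residue_def m_def[symmetric] hd_conv_nth)
  next
    case False
    then obtain r' where r': "r = Suc r'" by (cases r) auto
    then have "(hd zs # rev (tl zs)) ! r = zs ! (m - r)"
      using r(1) by (simp add: rev_nth m_def nth_tl flip: Suc_diff_le)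
    moreover have "nat (int m - int r) = m - r" by simp
    ultimately show ?thesis using neg False len unfolding at_residue_def
      by (simp add: m_def[symmetric] r_def[symmetric])
  qed
qed

context odd_circuit
begin

text \<open>Offsets of absolute value at most 3 stay distinct modulo \<open>g\<close>, so a sum over
  the circuit collapses to a sum over the short list of a pattern.\<close>

lemma sum_at_offsets:
  fixes h :: "int \<Rightarrow> 'b::comm_semiring_1"
  assumes at: "at_offsets N l (set xs)" and xs: "distinct xs" "\<And>e. e \<in> set xs \<Longrightarrow> \<bar>e\<bar> \<le> 3"
    and h: "\<And>j. h (j mod g) = h j"
  shows "(\<Sum>j\<in>{0..<g}. of_bool (N j) * h j) = (\<Sum>e\<leftarrow>xs. h (l + e))"
proof -
  have inj: "inj_on (\<lambda>e. (l + e) mod g) (set xs)"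
  proof (rule inj_onI)
    fix e e' assume e: "e \<in> set xs" "e' \<in> set xs" "(l + e) mod g = (l + e') mod g"
    then have "g dvd e - e'" by (simp add: mod_eq_dvd_iff)
    moreover have "\<bar>e - e'\<bar> < g" using xs(2)[OF e(1)] xs(2)[OF e(2)] k3 by linarith
    ultimately show "e = e'" using dvd_imp_le_int[of "e - e'" g] by fastforce
  qed
  have "{j \<in> {0..<g}. N j} = (\<lambda>e. (l + e) mod g) ` set xs"
  proof (rule equalityI; rule subsetI)
    fix j assume "j \<in> {j \<in> {0..<g}. N j}"
    then have j: "0 \<le> j" "j < g" "N j" by auto
    then obtain e where e: "e \<in> set xs" "g dvd j - (l + e)"
      using at by (auto simp: at_offsets_def diff_diff_eq)
    have "j = j mod g" using j by (intro mod_pos_pos_trivial[symmetric])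
    also have "\<dots> = (l + e) mod g" using e(2) by (simp add: mod_eq_dvd_iff)
    finally show "j \<in> (\<lambda>e. (l + e) mod g) ` set xs" using e(1) by blast
  next
    fix j assume "j \<in> (\<lambda>e. (l + e) mod g) ` set xs"
    then obtain e where e: "e \<in> set xs" "j = (l + e) mod g" by blast
    then have "g dvd j - l - e" by (simp add: diff_diff_eq mod_eq_dvd_iff[symmetric])
    then have "N j" using at e(1) by (auto simp: at_offsets_def)
    moreover have "j \<in> {0..<g}" unfolding e(2) using pos_mod_bound[of g "l + e"] by simp
    ultimately show "j \<in> {j \<in> {0..<g}. N j}" by blast
  qed
  moreover have "(\<Sum>j\<in>{0..<g}. of_bool (N j) * h j) = (\<Sum>j\<in>{j \<in> {0..<g}. N j}. h j)"
    by (intro sum.mono_neutral_cong_right) auto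
  ultimately have "(\<Sum>j\<in>{0..<g}. of_bool (N j) * h j) = (\<Sum>j\<in>(\<lambda>e. (l + e) mod g) ` set xs. h j)"
    by simp
  also have "\<dots> = (\<Sum>e\<in>set xs. h (l + e))"
    by (simp add: sum.reindex[OF inj] h)
  finally show ?thesis using xs(1) by (simp add: sum_list_distinct_conv_sum_set)
qed

definition p :: "'a \<Rightarrow> int \<Rightarrow> int" where "p w j = of_bool (N1 w j)"
text \<open>Its squared differences are those of \<open>level\<close>, but it is integral and
  vanishes away from the few circuit points near the vertex, so inner products become finite
  overlaps.\<close>

definition height :: "'a \<Rightarrow> int \<Rightarrow> int" where "height w j = of_bool (N1 w j) * 3 + of_bool (N2 w j) * 2"

lemma mod_dvd_diff: "g dvd j mod g - j"
  by (simp add: mod_eq_dvd_iff[symmetric])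

lemma p_mod: "p w (j mod g) = p w j"
  unfolding p_def N1_cong[OF mod_dvd_diff] ..

lemma height_mod: "height w (j mod g) = height w j"
  unfolding height_def N1_cong[OF mod_dvd_diff] N2_cong[OF mod_dvd_diff] ..

lemma height_level: "real_of_int (height w j) = 2 - level j w"
  by (simp add: height_def level_def)

lemma sum_p: "(\<Sum>w\<in>V. real_of_int (p w j)) = deg (c j)"
  unfolding deg_sum p_def N1_def by (intro sum.cong refl) (auto dest: R_sym)

fun fits :: "'a \<Rightarrow> int \<Rightarrow> profile \<Rightarrow> bool" where
  "fits w l (xs, ys, b, bs, U) \<longleftrightarrow> at_offsets (N1 w) l (set xs) \<and> at_offsets (N2 w) l (set ys)
    \<and> 16 * (q * deg w) \<le> n * of_int b + q * (\<Sum>i\<in>{0..<g}. of_int (at_residue bs i) * deg (c (l + i)))"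

text \<open>The inequality between the lengths of \<open>xs\<close> and \<open>ys\<close> makes the
  load nonnegative, so that a degree bound may be multiplied by it.\<close>

fun sound :: "profile \<Rightarrow> bool" where
  "sound (xs, ys, b, bs, U) \<longleftrightarrow> distinct xs \<and> distinct ys \<and> (\<forall>e\<in>set xs \<union> set ys. \<bar>e\<bar> \<le> 3)
    \<and> 3 * length xs \<le> 4 * length ys \<and> length bs = 2 * k + 1 \<and> 0 \<le> U"

lemma sum_height:
  assumes "fits w l (xs, ys, b, bs, U)" "sound (xs, ys, b, bs, U)" "\<And>j. h (j mod g) = h j"
  shows "(\<Sum>j\<in>{0..<g}. height w j * h j) = (\<Sum>(e, x)\<leftarrow>weights (xs, ys, b, bs, U). x * h (l + e))"
proof -
  have "(\<Sum>j\<in>{0..<g}. height w j * h j) = 3 * (\<Sum>j\<in>{0..<g}. of_bool (N1 w j) * h j)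
      + 2 * (\<Sum>j\<in>{0..<g}. of_bool (N2 w j) * h j)"
    unfolding height_def sum_distrib_left sum.distrib[symmetric] by (intro sum.cong refl) (simp add: algebra_simps)
  also have "(\<Sum>j\<in>{0..<g}. of_bool (N1 w j) * h j) = (\<Sum>e\<leftarrow>xs. h (l + e))"
    by (rule sum_at_offsets) (use assms in auto)
  also have "(\<Sum>j\<in>{0..<g}. of_bool (N2 w j) * h j) = (\<Sum>e\<leftarrow>ys. h (l + e))"
    by (rule sum_at_offsets) (use assms in auto)
  finally show ?thesis by (simp add: sum_list_const_mult o_def)
qed

lemma height_eq:
  assumes "fits w l a" "sound a"
  shows "height w j = (\<Sum>(e, x)\<leftarrow>weights a. x * of_bool (g dvd j - l - e))"
proof -
  obtain xs ys b bs U where a: "a = (xs, ys, b, bs, U)" by (cases a)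
  have "(\<Sum>i\<in>{0..<g}. height w i * of_bool (g dvd j - i)) = (\<Sum>(e, x)\<leftarrow>weights a. x * of_bool (g dvd j - (l + e)))"
    unfolding a
  proof (rule sum_height)
    show "of_bool (g dvd j - i mod g) = (of_bool (g dvd j - i) :: int)" for i
      by (simp add: mod_eq_dvd_iff[symmetric])
  qed (use assms a in auto)
  also have "(\<Sum>i\<in>{0..<g}. height w i * of_bool (g dvd j - i)) = (\<Sum>i\<in>{j mod g}. height w i * of_bool (g dvd j - i))"
  proof (rule sum.mono_neutral_right)
    show "{j mod g} \<subseteq> {0..<g}" using pos_mod_bound[of g j] by simp
    have "i = j mod g" if "i \<in> {0..<g}" "g dvd j - i" for i
    proof -
      have "i = i mod g" using that(1) by (intro mod_pos_pos_trivial[symmetric]) auto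
      also have "\<dots> = j mod g" using that(2) by (simp add: mod_eq_dvd_iff dvd_diff_commute)
      finally show ?thesis .
    qed
    then show "\<forall>i\<in>{0..<g} - {j mod g}. height w i * of_bool (g dvd j - i) = 0" by auto
  qed simp
  also have "\<dots> = height w j"
    using mod_dvd_diff[of j] by (simp add: height_mod dvd_diff_commute)
  finally show ?thesis by (simp add: diff_diff_eq)
qed

lemma sum_p_mult:
  assumes "fits w l (xs, ys, b, bs, U)" "sound (xs, ys, b, bs, U)" "\<And>j. h (j mod g) = h j"
  shows "(\<Sum>j\<in>{0..<g}. p w j * h j) = (\<Sum>e\<leftarrow>xs. h (l + e))"
  unfolding p_def by (rule sum_at_offsets) (use assms in auto)

lemma sum_height_height:
  assumes w: "fits w l a" "sound a" and w': "fits w' l' a'" "sound a'"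
  shows "(\<Sum>j\<in>{0..<g}. height w j * height w' j) = overlap g a a' (l' - l)"
proof -
  obtain xs ys b bs U where a: "a = (xs, ys, b, bs, U)" by (cases a)
  have "(\<Sum>j\<in>{0..<g}. height w j * height w' j) = (\<Sum>(e, x)\<leftarrow>weights a. x * height w' (l + e))"
    unfolding a by (rule sum_height) (use w a height_mod in auto)
  moreover have "x * height w' (l + e) = (\<Sum>(e', x')\<leftarrow>weights a'. if g dvd e' + (l' - l) - e then x * x' else 0)" for e x
  proof -
    have "g dvd l + e - l' - e' \<longleftrightarrow> g dvd e' + (l' - l) - e" for e'
      by (subst dvd_minus_iff[symmetric]) (simp add: algebra_simps)
    then show ?thesis
      unfolding height_eq[OF w'] sum_list_const_mult[symmetric]
      by (intro arg_cong[of _ _ sum_list] map_cong refl) auto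
  qed
  ultimately show ?thesis by (simp add: overlap_def)
qed

lemma sum_height_square:
  assumes w: "fits w l (xs, ys, b, bs, U)" "sound (xs, ys, b, bs, U)"
  shows "(\<Sum>j\<in>{0..<g}. (height w j)\<^sup>2) = 9 * int (length xs) + 4 * int (length ys)"
proof -
  have sq: "(height w j)\<^sup>2 = of_bool (N1 w j) * 9 + of_bool (N2 w j) * 4" for j
    using N1_N2_exclusive[of w j] by (auto simp: height_def)
  have "(\<Sum>j\<in>{0..<g}. of_bool (N1 w j) * 9 :: int) = (\<Sum>e\<leftarrow>xs. 9)"
    by (rule sum_at_offsets) (use w in auto)
  moreover have "(\<Sum>j\<in>{0..<g}. of_bool (N2 w j) * 4 :: int) = (\<Sum>e\<leftarrow>ys. 4)"
    by (rule sum_at_offsets) (use w in auto)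
  ultimately show ?thesis by (simp only: sq sum.distrib) (simp add: sum_list_triv)
qed

lemma load_eq:
  assumes w: "fits w l (xs, ys, b, bs, U)" "sound (xs, ys, b, bs, U)"
  shows "load w = real_of_int (4 * int (length ys) - 3 * int (length xs))"
proof -
  have "(\<Sum>j\<in>{0..<g}. of_bool (N1 w j) * 3 :: real) = (\<Sum>e\<leftarrow>xs. 3)"
    by (rule sum_at_offsets) (use w in auto)
  moreover have "(\<Sum>j\<in>{0..<g}. of_bool (N2 w j) * 4 :: real) = (\<Sum>e\<leftarrow>ys. 4)"
    by (rule sum_at_offsets) (use w in auto)
  ultimately show ?thesis unfolding load_def sum_subtractf
    by (simp only: mult.commute[of 4] mult.commute[of 3]) (simp add: sum_list_triv)
qed

lemma at_residue_cong_g: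
  "length zs = 2 * k + 1 \<Longrightarrow> g dvd i - j \<Longrightarrow> at_residue zs i = at_residue zs j"
  by (rule at_residue_cong) (simp add: add.commute)

lemma sum_residue_p:
  assumes w: "fits w l (xs, ys, b, bs, U)" "sound (xs, ys, b, bs, U)" and zs: "length zs = 2 * k + 1"
  shows "(\<Sum>m\<in>{0..<g}. at_residue zs m * p w (i + m)) = (\<Sum>e\<leftarrow>xs. at_residue zs (e + (l - i)))"
proof -
  define h where "h j = at_residue zs (j - i) * p w j" for j
  have mod: "at_residue zs (j mod g - i) = at_residue zs (j - i)" for j
    using mod_dvd_diff[of j] by (intro at_residue_cong_g[OF zs]) simp
  have "(\<Sum>m\<in>{0..<g}. h (m + i)) = (\<Sum>j\<in>{0..<g}. h j)"
    by (rule sum_periodic_shift) (simp_all add: h_def p_mod mod)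
  also have "\<dots> = (\<Sum>j\<in>{0..<g}. p w j * at_residue zs (j - i))"
    by (simp add: h_def mult.commute)
  also have "\<dots> = (\<Sum>e\<leftarrow>xs. at_residue zs (l + e - i))"
    by (rule sum_p_mult[OF w]) (rule mod)
  finally show ?thesis by (simp add: h_def algebra_simps)
qed

lemma sum_p_1:
  assumes w: "fits w l (xs, ys, b, bs, U)" "sound (xs, ys, b, bs, U)"
  shows "(\<Sum>j\<in>{0..<g}. p w j) = int (length xs)"
  using sum_p_mult[OF w, of "\<lambda>_. 1"] by (simp add: sum_list_triv)

text \<open>Identifies the computable closed form with what it stands for: energy, minus load times
  the degree bound and the \<open>U\<close> term, minus the products weighted by \<open>lam\<close>.
  Every cyclic sum collapses to the offsets, leaving a dependence on \<open>l' - l\<close>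
  alone.\<close>

lemma kernel_eq:
  assumes w: "fits w l (xs, ys, b, bs, U)" "sound (xs, ys, b, bs, U)"
    and w': "fits w' l' (xs', ys', b', bs', U')" "sound (xs', ys', b', bs', U')"
    and lam: "length lam = 2 * k + 1"
  shows "kernel k lam (xs, ys, b, bs, U) (xs', ys', b', bs', U') (l' - l) =
    32 * (6 * int k - 1) * (\<Sum>j\<in>{0..<g}. (height w j - height w' j)\<^sup>2)
    - (6 * int k - 1) * ((4 * int (length ys) - 3 * int (length xs))
        * (b + (6 * int k - 1) * (\<Sum>i\<in>{0..<g}. at_residue bs i * p w' (l + i)))
      + U * ((6 * int k - 1) * (\<Sum>j\<in>{0..<g}. p w' j) - 4 * g))
    - (\<Sum>m\<in>{0..<g}. at_residue lam m
      * (\<Sum>j\<in>{0..<g}. ((6 * int k - 1) * p w j - 4) * ((6 * int k - 1) * p w' (j + m) - 4)))"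
proof -
  define r where "r = 6 * int k - 1"
  let ?b = "\<lambda>d. \<Sum>e\<leftarrow>xs'. at_residue bs (e + d)"
  have energy: "(\<Sum>j\<in>{0..<g}. (height w j - height w' j)\<^sup>2)
      = 9 * (int (length xs) + int (length xs')) + 4 * (int (length ys) + int (length ys'))
        - 2 * overlap g (xs, ys, b, bs, U) (xs', ys', b', bs', U') (l' - l)"
    unfolding power2_diff sum.distrib sum_subtractf sum_height_square[OF w] sum_height_square[OF w']
      mult.assoc sum_distrib_left[symmetric] sum_height_height[OF w w'] by simp
  have lam_sum: "(\<Sum>m\<in>{0..<g}. at_residue lam m) = sum_list lam"
    using sum_at_residue_int[of lam] lam by (simp add: add.commute)
  have bs: "(\<Sum>i\<in>{0..<g}. at_residue bs i * p w' (l + i)) = ?b (l' - l)"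
    by (rule sum_residue_p[OF w']) (use w(2) in simp)
  have "(\<Sum>m\<in>{0..<g}. at_residue lam m * (\<Sum>j\<in>{0..<g}. p w j * p w' (j + m)))
      = (\<Sum>j\<in>{0..<g}. p w j * (\<Sum>m\<in>{0..<g}. at_residue lam m * p w' (j + m)))"
    unfolding sum_distrib_left by (subst sum.swap) (simp add: mult.left_commute)
  also have "\<dots> = (\<Sum>j\<in>{0..<g}. p w j * (\<Sum>e'\<leftarrow>xs'. at_residue lam (e' + (l' - j))))"
    by (simp only: sum_residue_p[OF w' lam])
  also have "\<dots> = (\<Sum>e\<leftarrow>xs. \<Sum>e'\<leftarrow>xs'. at_residue lam (e' + (l' - (l + e))))"
  proof (rule sum_p_mult[OF w])
    show "(\<Sum>e'\<leftarrow>xs'. at_residue lam (e' + (l' - j mod g))) = (\<Sum>e'\<leftarrow>xs'. at_residue lam (e' + (l' - j)))" for j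
      using mod_dvd_diff[of j]
      by (intro arg_cong[of _ _ sum_list] map_cong refl at_residue_cong_g[OF lam]) (simp add: dvd_diff_commute)
  qed
  finally have pp: "(\<Sum>m\<in>{0..<g}. at_residue lam m * (\<Sum>j\<in>{0..<g}. p w j * p w' (j + m)))
      = (\<Sum>e\<leftarrow>xs. \<Sum>e'\<leftarrow>xs'. at_residue lam (e' + (l' - l) - e))"
    by (simp add: algebra_simps)
  have shift: "(\<Sum>j\<in>{0..<g}. p w' (j + m)) = int (length xs')" for m
    using sum_periodic_shift[of g "p w'" m] p_mod sum_p_1[OF w'] by simp
  have row: "(\<Sum>j\<in>{0..<g}. (r * p w j - 4) * (r * p w' (j + m) - 4))
      = r * r * (\<Sum>j\<in>{0..<g}. p w j * p w' (j + m)) - 4 * r * (int (length xs) + int (length xs')) + 16 * g" for m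
  proof -
    have "(\<Sum>j\<in>{0..<g}. (r * p w j - 4) * (r * p w' (j + m) - 4))
        = (\<Sum>j\<in>{0..<g}. r * r * (p w j * p w' (j + m)) - 4 * r * p w j - 4 * r * p w' (j + m) + 16)"
      by (intro sum.cong refl) (simp add: algebra_simps)
    also have "\<dots> = r * r * (\<Sum>j\<in>{0..<g}. p w j * p w' (j + m)) - 4 * r * (\<Sum>j\<in>{0..<g}. p w j)
        - 4 * r * (\<Sum>j\<in>{0..<g}. p w' (j + m)) + 16 * g"
      unfolding sum.distrib sum_subtractf sum_distrib_left[symmetric] by simp
    finally show ?thesis unfolding sum_p_1[OF w] shift by (simp add: algebra_simps)
  qed
  have "(\<Sum>m\<in>{0..<g}. at_residue lam m * (\<Sum>j\<in>{0..<g}. (r * p w j - 4) * (r * p w' (j + m) - 4)))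
      = (\<Sum>m\<in>{0..<g}. r * r * (at_residue lam m * (\<Sum>j\<in>{0..<g}. p w j * p w' (j + m)))
        + at_residue lam m * (16 * g - 4 * r * (int (length xs) + int (length xs'))))"
    unfolding row by (intro sum.cong refl) (simp only: algebra_simps)
  also have "\<dots> = r * r * (\<Sum>e\<leftarrow>xs. \<Sum>e'\<leftarrow>xs'. at_residue lam (e' + (l' - l) - e))
      + sum_list lam * (16 * g - 4 * r * (int (length xs) + int (length xs')))"
    unfolding sum.distrib sum_distrib_left[symmetric] sum_distrib_right[symmetric] pp lam_sum ..
  finally have prod: "(\<Sum>m\<in>{0..<g}. at_residue lam m * (\<Sum>j\<in>{0..<g}. (r * p w j - 4) * (r * p w' (j + m) - 4)))
      = r * r * (\<Sum>e\<leftarrow>xs. \<Sum>e'\<leftarrow>xs'. at_residue lam (e' + (l' - l) - e))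
        - 4 * r * sum_list lam * (int (length xs) + int (length xs')) + 16 * g * sum_list lam"
    by (simp add: algebra_simps)
  show ?thesis
    unfolding r_def[symmetric] energy bs sum_p_1[OF w'] prod kernel.simps Let_def by simp
qed

lemma kernel_cong:
  assumes "sound a" "sound a'" "length lam = 2 * k + 1" "g dvd d - d'"
  shows "kernel k lam a a' d = kernel k lam a a' d'"
proof -
  obtain xs ys b bs U where a: "a = (xs, ys, b, bs, U)" by (cases a)
  obtain xs' ys' b' bs' U' where a': "a' = (xs', ys', b', bs', U')" by (cases a')
  have bs: "length bs = 2 * k + 1" using assms(1) a by simp
  have "(\<Sum>e\<leftarrow>xs'. at_residue bs (e + d)) = (\<Sum>e\<leftarrow>xs'. at_residue bs (e + d'))"
    using assms(4) by (intro arg_cong[of _ _ sum_list] map_cong refl at_residue_cong_g[OF bs]) simp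
  moreover have "(\<Sum>e\<leftarrow>xs. \<Sum>e'\<leftarrow>xs'. at_residue lam (e' + d - e)) = (\<Sum>e\<leftarrow>xs. \<Sum>e'\<leftarrow>xs'. at_residue lam (e' + d' - e))"
    using assms(4) by (intro arg_cong[of _ _ sum_list] map_cong refl at_residue_cong_g[OF assms(3)]) simp
  moreover have "g dvd e' + d - e \<longleftrightarrow> g dvd e' + d' - e" for e e'
  proof -
    have "e' + d - e = (d - d') + (e' + d' - e)" by simp
    then show ?thesis using dvd_add_right_iff[OF assms(4), of "e' + d' - e"] by presburger
  qed
  then have "overlap g a a' d = overlap g a a' d'" by (simp add: overlap_def)
  ultimately show ?thesis by (simp add: a a' Let_def)
qed

lemma profiles_sound:
  assumes "certificate k nu lam us" "a \<in> set (profiles k nu us)"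
  shows "sound a"
proof -
  have "length nu = 2 * k + 1" "us ! 0 \<ge> 0" "us ! 1 \<ge> 0" "us ! 2 \<ge> 0" "us ! 3 \<ge> 0"
    using assms(1) by (auto simp: certificate_def list_all_iff)
  moreover have "length (map2 (+) nu (0 # 16 # 16 # replicate (2 * k - 2) (0 :: int))) = 2 * k + 1"
    using calculation(1) k3 by simp
  ultimately show ?thesis
    using assms(2) unfolding profiles_def Let_def set_simps by (elim insertE) simp_all
qed

lemma certificate_kernel_pos:
  assumes cert: "certificate k nu lam us" and a: "a \<in> set (profiles k nu us)" "a' \<in> set (profiles k nu us)"
  shows "0 < kernel k lam a a' (l' - l) + kernel k lam a' a (l - l')"
proof -
  define d where "d = (l' - l) mod g"
  have d: "d \<in> set [0..2 * int k]" using pos_mod_bound[of g "l' - l"] by (simp add: d_def)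
  have lam: "length lam = 2 * k + 1" using cert by (simp add: certificate_def)
  note sound = profiles_sound[OF cert a(1)] profiles_sound[OF cert a(2)]
  have dvd: "g dvd l' - l - d" "g dvd l - l' - (- d)"
    using mod_dvd_diff[of "l' - l"] mod_dvd_diff[of "l' - l"]
    unfolding d_def by (simp_all add: dvd_diff_commute algebra_simps)
  have "0 < kernel k lam a a' d + kernel k lam a' a (- d)"
    using cert a d by (simp add: certificate_def list_all_iff)
  then show ?thesis
    using kernel_cong[OF sound lam dvd(1)] kernel_cong[OF sound(2,1) lam dvd(2)] by simp
qed

lemma certificate_contradiction:
  assumes cert: "certificate k nu lam us"
    and fit: "\<And>w. w \<in> V \<Longrightarrow> \<exists>l. \<exists>a\<in>set (profiles k nu us). fits w l a"
  shows False
proof -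
  obtain l a where la: "\<And>w. w \<in> V \<Longrightarrow> a w \<in> set (profiles k nu us)" "\<And>w. w \<in> V \<Longrightarrow> fits w (l w) (a w)"
    using fit by metis
  define xs ys b bs U where "xs w = fst (a w)" and "ys w = fst (snd (a w))"
    and "b w = fst (snd (snd (a w)))" and "bs w = fst (snd (snd (snd (a w))))"
    and "U w = snd (snd (snd (snd (a w))))" for w
  have a: "a w = (xs w, ys w, b w, bs w, U w)" for w
    by (simp add: xs_def ys_def b_def bs_def U_def)
  have w: "fits w (l w) (xs w, ys w, b w, bs w, U w)" "sound (xs w, ys w, b w, bs w, U w)" if "w \<in> V" for w
    using la(2)[OF that] profiles_sound[OF cert la(1)[OF that]] unfolding a .
  have lam: "length lam = 2 * k + 1" "\<And>i. i \<in> set lam \<Longrightarrow> 0 \<le> i"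
    using cert by (auto simp: certificate_def list_all_iff)
  define K where "K w w' = real_of_int (kernel k lam (a w) (a w') (l w' - l w))" for w w'
  define E where "E w w' = (\<Sum>j\<in>{0..<g}. (level j w - level j w')\<^sup>2)" for w w'
  \<comment> \<open>The share of \<open>w'\<close> in the upper bound for
    \<open>16 q load deg\<close> at \<open>w\<close>: summed over \<open>w'\<close>, the constants
    give multiples of \<open>n\<close>, and the indicators \<open>p\<close> give circuit
    degrees.\<close>
  define L where "L w w' = load w * (of_int (b w) + q * (\<Sum>i\<in>{0..<g}. of_int (at_residue (bs w) i) * of_int (p w' (l w + i))))
      + of_int (U w) * (q * (\<Sum>j\<in>{0..<g}. of_int (p w' j)) - 4 * of_int g)" for w w'
  define P where "P w w' = (\<Sum>m\<in>{0..<g}. of_int (at_residue lam m)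
      * (\<Sum>j\<in>{0..<g}. (q * of_int (p w j) - 4) * (q * of_int (p w' (j + m)) - 4)))" for w w'
  have K: "K w w' = 32 * q * E w w' - q * L w w' - P w w'" if "w \<in> V" "w' \<in> V" for w w'
  proof -
    have "real_of_int ((height w j - height w' j)\<^sup>2) = (level j w - level j w')\<^sup>2" for j
      by (simp add: height_level power2_commute)
    then have "real_of_int (\<Sum>j\<in>{0..<g}. (height w j - height w' j)\<^sup>2) = E w w'"
      unfolding E_def of_int_sum by simp
    then show ?thesis
      unfolding K_def a kernel_eq[OF w[OF that(1)] w[OF that(2)] lam(1)]
      by (simp add: L_def P_def load_eq[OF w[OF that(1)]])
  qed
  have lower: "16 * (load v * (q * deg v)) \<le> (\<Sum>w'\<in>V. L v w')" if v: "v \<in> V" for v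
  proof -
    have "(\<Sum>w'\<in>V. L v w') = load v * (n * of_int (b v) + q * (\<Sum>i\<in>{0..<g}. of_int (at_residue (bs v) i) * deg (c (l v + i))))
      + of_int (U v) * (\<Sum>j\<in>{0..<g}. q * deg (c j) - 4 * n)"
    proof -
      have 1: "(\<Sum>w'\<in>V. \<Sum>i\<in>{0..<g}. of_int (at_residue (bs v) i) * of_int (p w' (l v + i)))
          = (\<Sum>i\<in>{0..<g}. of_int (at_residue (bs v) i) * deg (c (l v + i)))"
        by (subst sum.swap) (simp add: sum_p flip: sum_distrib_left)
      have 2: "(\<Sum>w'\<in>V. \<Sum>j\<in>{0..<g}. real_of_int (p w' j)) = (\<Sum>j\<in>{0..<g}. deg (c j))"
        by (subst sum.swap) (simp add: sum_p)
      show ?thesis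
        unfolding L_def sum.distrib sum_subtractf sum_distrib_left[symmetric] 1 2
        by (simp add: algebra_simps)
    qed
    moreover have "0 \<le> load v"
      using w[OF v] by (simp add: load_eq[OF w[OF v]])
    moreover have "0 \<le> of_int (U v) * (\<Sum>j\<in>{0..<g}. q * deg (c j) - 4 * n)"
      using w[OF v] min_degree[OF c_V] by (intro mult_nonneg_nonneg sum_nonneg) auto
    moreover have "16 * (q * deg v) \<le> n * of_int (b v) + q * (\<Sum>i\<in>{0..<g}. of_int (at_residue (bs v) i) * deg (c (l v + i)))"
      using w[OF v] by simp
    then have "load v * (16 * (q * deg v)) \<le> load v * (n * of_int (b v) + q * (\<Sum>i\<in>{0..<g}. of_int (at_residue (bs v) i) * deg (c (l v + i))))"
      using calculation(2) by (rule mult_left_mono)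
    ultimately show ?thesis by simp
  qed
  have P: "0 \<le> (\<Sum>v\<in>V. \<Sum>w'\<in>V. P v w')"
  proof -
    have one: "(\<Sum>v\<in>V. q * of_int (p v j) - 4) = q * deg (c j) - 4 * n" for j
      by (simp add: sum_subtractf sum_p flip: sum_distrib_left)
    have "(\<Sum>v\<in>V. \<Sum>w'\<in>V. P v w') = (\<Sum>m\<in>{0..<g}. of_int (at_residue lam m)
      * (\<Sum>j\<in>{0..<g}. \<Sum>v\<in>V. \<Sum>w'\<in>V. (q * of_int (p v j) - 4) * (q * of_int (p w' (j + m)) - 4)))"
      unfolding P_def
      by (simp only: sum_distrib_left sum.swap[where A = V and B = "{0..<g}"])
    also have "\<dots> = (\<Sum>m\<in>{0..<g}. of_int (at_residue lam m)
      * (\<Sum>j\<in>{0..<g}. (q * deg (c j) - 4 * n) * (q * deg (c (j + m)) - 4 * n)))"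
      unfolding sum_product[symmetric] one ..
    also have "\<dots> \<ge> 0"
    proof (intro sum_nonneg mult_nonneg_nonneg)
      fix m assume "m \<in> {0..<g}"
      have "nat (m mod int (length lam)) < length lam" using lam(1) by (simp add: nat_less_iff)
      then show "0 \<le> real_of_int (at_residue lam m)" using lam(2) by (simp add: at_residue_def)
    qed (use min_degree[OF c_V] in simp_all)
    finally show ?thesis .
  qed
  \<comment> \<open>The factor 16 is the common denominator of the degree bounds; the remaining 2
    comes from \<open>level_energy\<close>.\<close>
  have "32 * q * (\<Sum>v\<in>V. \<Sum>w'\<in>V. E v w') = 16 * q * (2 * (\<Sum>v\<in>V. \<Sum>w'\<in>V. E v w'))" by simp
  also have "\<dots> \<le> 16 * q * (q * (\<Sum>v\<in>V. load v * deg v))"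
    using level_energy q_pos unfolding E_def by (intro mult_left_mono) auto
  also have "\<dots> = q * (\<Sum>v\<in>V. 16 * (load v * (q * deg v)))"
    by (simp add: sum_distrib_left mult_ac)
  also have "\<dots> \<le> q * (\<Sum>v\<in>V. \<Sum>w'\<in>V. L v w')"
    using q_pos lower by (intro mult_left_mono sum_mono) auto
  finally have "32 * q * (\<Sum>v\<in>V. \<Sum>w'\<in>V. E v w') - q * (\<Sum>v\<in>V. \<Sum>w'\<in>V. L v w') - (\<Sum>v\<in>V. \<Sum>w'\<in>V. P v w') \<le> 0"
    using P by linarith
  moreover have "(\<Sum>v\<in>V. \<Sum>w'\<in>V. K v w') = 32 * q * (\<Sum>v\<in>V. \<Sum>w'\<in>V. E v w') - q * (\<Sum>v\<in>V. \<Sum>w'\<in>V. L v w') - (\<Sum>v\<in>V. \<Sum>w'\<in>V. P v w')"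
    by (simp add: K sum_subtractf flip: sum_distrib_left)
  moreover have "0 < (\<Sum>v\<in>V. \<Sum>w'\<in>V. K v w' + K w' v)"
  proof -
    have "0 < K v w' + K w' v" if "v \<in> V" "w' \<in> V" for v w'
      using certificate_kernel_pos[OF cert la(1)[OF that(1)] la(1)[OF that(2)], of "l w'" "l v"]
      unfolding K_def of_int_add[symmetric] by simp
    then show ?thesis using fin c_V[of 0] by (intro sum_pos) auto
  qed
  moreover have "(\<Sum>v\<in>V. \<Sum>w'\<in>V. K w' v) = (\<Sum>v\<in>V. \<Sum>w'\<in>V. K v w')" by (rule sum.swap)
  ultimately show False unfolding sum.distrib by linarith
qed

section \<open>Degree bounds from a circuit of maximal degree sum\<close>

lemma sum_residue_single:
  fixes h :: "int \<Rightarrow> real"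
  shows "(\<Sum>i\<in>{0..<g}. of_int (at_residue (16 # replicate (2 * k) 0) i) * h i) = 16 * h 0"
proof -
  have "length (16 # replicate (2 * k) (0 :: int)) = Suc (2 * k)" by simp
  then show ?thesis
    using sum_at_residue[of "16 # replicate (2 * k) 0" h]
    by (simp add: sum.lessThan_Suc_shift add.commute del: sum.lessThan_Suc)
qed

lemma at_residue_replicate: "at_residue (replicate (2 * k + 1) x) i = x"
proof -
  have "nat (i mod g) < 2 * k + 1" using pos_mod_bound[of g i] by (simp add: nat_less_iff)
  then have "replicate (2 * k + 1) x ! nat (i mod g) = x" by (rule nth_replicate)
  then show ?thesis by (simp add: at_residue_def add.commute del: replicate.simps)
qed

lemma sum_residue_shifted:
  fixes h :: "int \<Rightarrow> real"
  assumes nu: "length nu = 2 * k + 1"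
  shows "(\<Sum>i\<in>{0..<g}. of_int (at_residue (map2 (+) nu (0 # 16 # 16 # replicate (2 * k - 2) 0)) i) * h i)
    = (\<Sum>i\<in>{0..<g}. of_int (at_residue nu i) * h i) + 16 * (h 1 + h 2)"
proof -
  define z :: "int list" where "z = 0 # 16 # 16 # replicate (2 * k - 2) 0"
  have z: "length z = 2 * k + 1" using k3 by (simp add: z_def)
  obtain m where m: "2 * k + 1 = Suc (Suc (Suc m))" using k3 by (intro that[of "2 * k - 2"]) simp
  have "(\<Sum>i<2 * k + 1. of_int (z ! i) * h (int i)) = 16 * (h 1 + h 2)"
    unfolding m by (subst sum.lessThan_Suc_shift)+ (use m in \<open>simp add: z_def del: sum.lessThan_Suc\<close>)
  moreover have "(\<Sum>i<2 * k + 1. of_int (map2 (+) nu z ! i) * h (int i))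
      = (\<Sum>i<2 * k + 1. of_int (nu ! i) * h (int i)) + (\<Sum>i<2 * k + 1. of_int (z ! i) * h (int i))"
    unfolding sum.distrib[symmetric] using nu z by (intro sum.cong refl) (simp add: distrib_right)
  ultimately show ?thesis
    using sum_at_residue[of "map2 (+) nu z" h] sum_at_residue[of nu h] nu z
    by (simp add: z_def[symmetric] add.commute)
qed

lemma sum_residue_reverse:
  fixes h :: "int \<Rightarrow> real"
  assumes "length zs = 2 * k + 1" and h: "\<And>j. h (j mod g) = h j"
  shows "(\<Sum>i\<in>{0..<g}. of_int (at_residue (hd zs # rev (tl zs)) i) * h i)
    = (\<Sum>i\<in>{0..<g}. of_int (at_residue zs i) * h (- i))"
proof -
  have "zs \<noteq> []" using assms(1) by auto
  have neg: "- ((- i) mod g) mod g = i" if "i \<in> {0..<g}" for i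
    using that by (simp add: mod_minus_eq)
  have range: "(- i) mod g \<in> {0..<g}" for i :: int using pos_mod_bound[of g "- i"] by simp
  have cong: "at_residue zs ((- i) mod g) = at_residue zs (- i)" for i
    by (rule at_residue_cong_g[OF assms(1) mod_dvd_diff])
  have hneg: "h (- ((- i) mod g)) = h i" for i
    by (metis h minus_minus mod_minus_eq)
  show ?thesis unfolding at_residue_reverse[OF \<open>zs \<noteq> []\<close>]
    by (rule sum.reindex_bij_witness[where i = "\<lambda>i. (- i) mod g" and j = "\<lambda>i. (- i) mod g"])
      (simp_all only: neg range cong hneg)
qed

end

locale max_odd_circuit = odd_circuit +
  assumes maximal: "(\<And>i. (c' i, c' (i + 1)) \<in> R) \<Longrightarrow> (\<And>i. c' (i mod g) = c' i)
    \<Longrightarrow> (\<Sum>j\<in>{0..<g}. deg (c' j)) \<le> (\<Sum>j\<in>{0..<g}. deg (c j))"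
begin

lemma exchange:
  assumes w: "(c (l - 2), u) \<in> R" "(u, w) \<in> R" "(w, u') \<in> R" "(u', c (l + 2)) \<in> R"
  shows "deg u + deg w + deg u' \<le> deg (c (l - 1)) + deg (c l) + deg (c (l + 1))"
proof -
  \<comment> \<open>The points \<open>l - 1\<close>, \<open>l\<close>, \<open>l + 1\<close> receive
    \<open>u\<close>, \<open>w\<close>, \<open>u'\<close>; residue \<open>g - 1\<close> stands for
    \<open>l - 1\<close>. The new closed walk competes with \<open>c\<close> for the largest degree
    sum.\<close>
  define c' where "c' i = (let r = (i - l) mod g in
    if r = 0 then w else if r = 1 then u' else if r = g - 1 then u else c i)" for i
  have c'_periodic: "c' (i mod g) = c' i" for i
    unfolding c'_def Let_def using periodic[of i] by (simp add: mod_simps)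
  have c'_step: "(c' i, c' (i + 1)) \<in> R" for i
  proof -
    define r where "r = (i - l) mod g"
    have r: "0 \<le> r" "r < g" using pos_mod_bound[of g "i - l"] by (simp_all add: r_def)
    have dvd: "g dvd i - (l + r)"
      using minus_mod_eq_mult_div[of "i - l" g] by (simp add: r_def diff_diff_eq)
    have ci: "c i = c (l + r)" "c (i + 1) = c (l + r + 1)"
      by (rule c_cong, use dvd in simp)+
    have r1: "(i + 1 - l) mod g = (if r = g - 1 then 0 else r + 1)"
    proof -
      have "(i + 1 - l) mod g = (r + 1) mod g"
        unfolding r_def by (metis add.commute diff_add_eq mod_add_right_eq)
      then show ?thesis using r by auto
    qed
    have cw: "c (l + (g - 2)) = c (l - 2)" "c (l + (g - 1) + 1) = c l"
      by (rule c_cong, simp)+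
    consider "r = 0" | "r = 1" | "r = g - 1" | "r = g - 2" | "1 < r" "r < g - 2" using r by linarith
    then show ?thesis
    proof cases
      case 2
      then have "c (i + 1) = c (l + 2)" using ci by (simp add: add.commute)
      then show ?thesis using 2 w r1 k3 by (simp add: c'_def Let_def r_def[symmetric])
    next
      case 5
      then show ?thesis using step[of i] r1 by (simp add: c'_def Let_def r_def[symmetric])
    qed (use w ci cw r1 k3 in \<open>simp_all add: c'_def Let_def r_def[symmetric]\<close>)
  qed
  have "(\<Sum>j\<in>{0..<g}. deg (c' j)) \<le> (\<Sum>j\<in>{0..<g}. deg (c j))"
    by (rule maximal) (rule c'_step c'_periodic)+
  moreover have "(\<Sum>j\<in>{0..<g}. deg (c' (j + l))) = (\<Sum>j\<in>{0..<g}. deg (c' j))"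
    "(\<Sum>j\<in>{0..<g}. deg (c (j + l))) = (\<Sum>j\<in>{0..<g}. deg (c j))"
    by (rule sum_periodic_shift; simp add: periodic c'_periodic)+
  ultimately have "(\<Sum>j\<in>{0..<g}. deg (c' (j + l)) - deg (c (j + l))) \<le> 0"
    by (simp add: sum_subtractf)
  moreover have "(\<Sum>j\<in>{0..<g}. deg (c' (j + l)) - deg (c (j + l)))
      = (\<Sum>j\<in>{0, 1, g - 1}. deg (c' (j + l)) - deg (c (j + l)))"
    by (rule sum.mono_neutral_right) (use k3 in \<open>auto simp: c'_def Let_def\<close>)
  moreover have "c (g - 1 + l) = c (l - 1)" by (rule c_cong) simp
  ultimately show ?thesis using k3 by (simp add: c'_def Let_def algebra_simps)
qed

text \<open>Taking the circuit vertices \<open>c (l - 1)\<close> and \<open>c (l + 1)\<close> as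
  outer vertices of the exchange replaces \<open>c l\<close> alone.\<close>

lemma deg_two_neighbours:
  assumes "N1 w (l - 1)" "N1 w (l + 1)"
  shows "deg w \<le> deg (c l)"
proof -
  have "(c (l - 2), c (l - 1)) \<in> R" "(c (l + 1), c (l + 2)) \<in> R"
    using step[of "l - 2"] step[of "l + 1"] by (simp_all add: add.assoc)
  then have "deg (c (l - 1)) + deg w + deg (c (l + 1)) \<le> deg (c (l - 1)) + deg (c l) + deg (c (l + 1))"
    by (intro exchange) (use assms R_sym in \<open>auto simp: N1_def\<close>)
  then show ?thesis by simp
qed

text \<open>The middle vertices of the two walks of length 2 enter the circuit along with
  \<open>w\<close>; their degrees are at least \<open>4 n / q\<close> each, which gives
  \<open>8 n\<close>.\<close>

lemma deg_far:
  assumes "N2 w (l - 2)" "N2 w (l + 2)"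
  shows "q * deg w \<le> q * (deg (c (l - 1)) + deg (c l) + deg (c (l + 1))) - 8 * n"
proof -
  obtain u u' where u: "(w, u) \<in> R" "N1 u (l - 2)" "(w, u') \<in> R" "N1 u' (l + 2)"
    using N2E[OF assms(1)] N2E[OF assms(2)] by metis
  then have "deg u + deg w + deg u' \<le> deg (c (l - 1)) + deg (c l) + deg (c (l + 1))"
    by (intro exchange) (auto simp: N1_def dest: R_sym)
  then have "q * (deg u + deg w + deg u') \<le> q * (deg (c (l - 1)) + deg (c l) + deg (c (l + 1)))"
    using q_pos by (intro mult_left_mono) auto
  then show ?thesis using min_degree[of u] min_degree[of u'] u R_V by (simp add: distrib_left)
qed

text \<open>Here \<open>c l\<close> stays and only two circuit vertices give way, to
  \<open>w\<close> and to the middle vertex \<open>u\<close> of its walk to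
  \<open>c (l + 3 s)\<close>. The sign \<open>s\<close> is the direction along the circuit.\<close>

lemma deg_one_neighbour:
  assumes s: "s \<in> {1, -1}" and w: "N1 w l" "N2 w (l + 3 * s)"
  shows "q * deg w \<le> q * (deg (c (l + s)) + deg (c (l + 2 * s))) - 4 * n"
proof -
  obtain u where u: "(w, u) \<in> R" "N1 u (l + 3 * s)" using N2E[OF w(2)] .
  have "deg w + deg u \<le> deg (c (l + s)) + deg (c (l + 2 * s))"
  proof (cases "s = 1")
    case True
    have "(c (l + 1 - 2), c l) \<in> R" "(u, c (l + 1 + 2)) \<in> R"
      using step[of "l - 1"] u True by (simp_all add: N1_def add.assoc)
    from exchange[OF this(1) _ u(1) this(2)] show ?thesis
      using w R_sym True by (simp add: N1_def add.assoc)
  next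
    case False
    then have s: "s = -1" using s by auto
    have "(c (l - 1 - 2), u) \<in> R" "(c l, c (l - 1 + 2)) \<in> R"
      using step[of l] u s by (auto simp: N1_def add.commute intro: R_sym)
    from exchange[OF this(1) R_sym[OF u(1)] _ this(2)] show ?thesis
      using w s by (simp add: N1_def algebra_simps)
  qed
  then have "q * (deg w + deg u) \<le> q * (deg (c (l + s)) + deg (c (l + 2 * s)))"
    using q_pos by (intro mult_left_mono) auto
  then show ?thesis using min_degree[of u] u R_V by (simp add: distrib_left)
qed

lemma fits_few:
  assumes "at_offsets (N1 w) l (set xs)" "at_offsets (N2 w) l (set ys)" "length ys \<le> 2"
  shows "fits w l (xs, ys, 16 * (6 * int k - 1) - 32 * (g - int (length ys)), replicate (2 * k + 1) 0, U)"
proof -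
  have "card {j \<in> {0..<g}. N2 w j} \<le> length ys"
    using card_at_offsets_le[OF assms(2)] card_length[of ys] by (meson List.finite_set order_trans)
  from degree_le[OF this] have "q * deg w \<le> n * (q - 2 * (2 * real k + 1 - real (length ys)))"
    using assms(3) by simp
  then show ?thesis using assms(1,2) unfolding fits.simps at_residue_replicate by (simp add: algebra_simps)
qed

lemma fits_one_neighbour:
  assumes nu: "length nu = 2 * k + 1" "\<forall>i\<in>set nu. 0 \<le> i" and s: "s \<in> {1, -1}"
    and w: "at_offsets (N1 w) l {0}" "at_offsets (N2 w) l {-1, 1, 3 * s}"
    and bs: "bs = map2 (+) nu (0 # 16 # 16 # replicate (2 * k - 2) 0)"
  shows "fits w l ([0], [-1, 1, 3 * s], - 64 - 4 * sum_list nu, if s = 1 then bs else hd bs # rev (tl bs), U)"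
proof -
  define h where "h i = deg (c (l + s * i))" for i
  have len: "length bs = 2 * k + 1" using nu(1) k3 by (simp add: bs)
  have h_mod: "deg (c (l + j mod g)) = deg (c (l + j))" for j
    by (rule arg_cong[of _ _ deg], rule c_cong) (use mod_dvd_diff[of j] in simp)
  have "(\<Sum>i\<in>{0..<g}. of_int (at_residue (if s = 1 then bs else hd bs # rev (tl bs)) i) * deg (c (l + i)))
      = (\<Sum>i\<in>{0..<g}. of_int (at_residue bs i) * h i)"
    using s sum_residue_reverse[OF len, of "\<lambda>i. deg (c (l + i))", OF h_mod] by (auto simp: h_def)
  also have "\<dots> = (\<Sum>i\<in>{0..<g}. of_int (at_residue nu i) * h i) + 16 * (h 1 + h 2)"
    unfolding bs by (rule sum_residue_shifted[OF nu(1)])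
  finally have eq: "(\<Sum>i\<in>{0..<g}. of_int (at_residue (if s = 1 then bs else hd bs # rev (tl bs)) i) * deg (c (l + i)))
      = (\<Sum>i\<in>{0..<g}. of_int (at_residue nu i) * h i) + 16 * (h 1 + h 2)" .
  have sum: "q * (\<Sum>i\<in>{0..<g}. of_int (at_residue (if s = 1 then bs else hd bs # rev (tl bs)) i) * deg (c (l + i)))
      = (\<Sum>i\<in>{0..<g}. of_int (at_residue nu i) * (q * h i)) + 16 * (q * (h 1 + h 2))"
    unfolding eq by (simp only: distrib_left sum_distrib_left mult.left_commute[of q])
  have "N1 w l" "N2 w (l + 3 * s)" using w by (auto simp: at_offsets_def)
  from deg_one_neighbour[OF s this] have main: "q * deg w \<le> q * (h 1 + h 2) - 4 * n"
    by (simp add: h_def mult.commute)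
  have "(\<Sum>i\<in>{0..<g}. of_int (at_residue nu i) * (4 * n)) \<le> (\<Sum>i\<in>{0..<g}. of_int (at_residue nu i) * (q * h i))"
  proof (intro sum_mono mult_left_mono)
    fix i :: int
    have "nat (i mod int (length nu)) < length nu" using nu(1) by (simp add: nat_less_iff)
    then show "0 \<le> real_of_int (at_residue nu i)" using nu(2) by (simp add: at_residue_def)
  qed (simp add: h_def min_degree[OF c_V])
  moreover have "(\<Sum>i\<in>{0..<g}. real_of_int (at_residue nu i) * (4 * n)) = of_int (sum_list nu) * (4 * n)"
    using sum_at_residue_int[of nu] nu(1) by (simp add: add.commute flip: sum_distrib_right of_int_sum)
  ultimately have "16 * (q * deg w) \<le> n * real_of_int (- 64 - 4 * sum_list nu)
      + ((\<Sum>i\<in>{0..<g}. of_int (at_residue nu i) * (q * h i)) + 16 * (q * (h 1 + h 2)))"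
    using main by (simp add: algebra_simps)
  then show ?thesis unfolding fits.simps sum using w by simp
qed

lemma profile_exists:
  assumes cert: "certificate k nu lam us"
  shows "\<exists>l. \<exists>a\<in>set (profiles k nu us). fits w l a"
proof -
  have nu: "length nu = 2 * k + 1" "\<forall>i\<in>set nu. 0 \<le> i"
    using cert by (auto simp: certificate_def list_all_iff)
  define bs where "bs = map2 (+) nu (0 # 16 # 16 # replicate (2 * k - 2) 0)"
  note one = fits_one_neighbour[OF nu _ _ _ bs_def]
  have found: ?thesis if "fits w l a" "a \<in> set (profiles k nu us)" for l a using that by blast
  consider l where "at_offsets (N1 w) l {-1, 1}" "at_offsets (N2 w) l {-2, 0, 2}"
    | l where "at_offsets (N1 w) l {0}" "at_offsets (N2 w) l {-1, 1, 3}"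
    | l where "at_offsets (N1 w) l {0}" "at_offsets (N2 w) l {-1, 1, -3}"
    | l where "at_offsets (N1 w) l {0}" "at_offsets (N2 w) l {-1, 1}"
    | l where "at_offsets (N1 w) l {}" "at_offsets (N2 w) l {-2, 0, 2}"
    | l where "at_offsets (N1 w) l {}" "at_offsets (N2 w) l {0, 2}"
    | l where "at_offsets (N1 w) l {}" "at_offsets (N2 w) l {-2, 2}"
    | l where "at_offsets (N1 w) l {}" "at_offsets (N2 w) l {0}"
    | l where "at_offsets (N1 w) l {}" "at_offsets (N2 w) l {}"
    using offsets_cases[of w] by blast
  then show ?thesis
  proof cases
    case (1 l)
    have "N1 w (l - 1)" "N1 w (l + 1)" using 1 by (auto simp: at_offsets_def)
    then have "q * deg w \<le> q * deg (c l)"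
      using q_pos by (intro mult_left_mono deg_two_neighbours) auto
    then have "fits w l ([-1, 1], [-2, 0, 2], 0, 16 # replicate (2 * k) 0, 0)"
      using 1 unfolding fits.simps sum_residue_single by simp
    then show ?thesis by (rule found) (simp add: profiles_def Let_def)
  next
    case (2 l)
    then have "fits w l ([0], [-1, 1, 3], - 64 - 4 * sum_list nu, bs, 0)"
      using one[of 1 w l 0] by simp
    then show ?thesis by (rule found) (simp add: profiles_def Let_def bs_def)
  next
    case (3 l)
    then have "fits w l ([0], [-1, 1, -3], - 64 - 4 * sum_list nu, hd bs # rev (tl bs), 0)"
      using one[of "-1" w l 0] by simp
    then show ?thesis by (rule found) (simp add: profiles_def Let_def bs_def)
  next
    case (4 l)
    have "fits w l ([0], [-1, 1], 16 * (6 * int k - 1) - 32 * (g - int (length [-1, 1 :: int])), replicate (2 * k + 1) 0, us ! 0)"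
      by (rule fits_few) (use 4 in simp_all)
    then show ?thesis by (rule found) (simp add: profiles_def Let_def)
  next
    case (5 l)
    have far: "N2 w (l - 2)" "N2 w (l + 2)" using 5 by (auto simp: at_offsets_def)
    have sum: "(\<Sum>i\<in>{0..<g}. of_int (at_residue (replicate (2 * k + 1) 16) i) * deg (c (l + i)))
        = 16 * (\<Sum>i\<in>{0..<g}. deg (c (l + i)))"
      unfolding at_residue_replicate by (simp add: sum_distrib_left)
    \<comment> \<open>The bound of \<open>deg_far\<close> involves three circuit vertices. Adding
      the surplus \<open>h\<close>, which is nonnegative, of all the others makes the coefficients
      constant, and \<open>8 n + 4 n (g - 3) = 4 n (g - 1)\<close>.\<close>
    define h where "h i = q * deg (c (l + i)) - 4 * n" for i
    have h_mod: "h (j mod g) = h j" for j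
      unfolding h_def by (subst c_cong[of "l + j mod g" "l + j"]) (use mod_dvd_diff[of j] in simp_all)
    have "(\<Sum>i\<in>{0, 1, 2}. h (i + - 1)) \<le> (\<Sum>i\<in>{0..<g}. h (i + - 1))"
      using min_degree[OF c_V] k3 by (intro sum_mono2) (auto simp: h_def)
    also have "\<dots> = (\<Sum>i\<in>{0..<g}. h i)"
      by (rule sum_periodic_shift) (use h_mod in auto)
    also have "\<dots> = q * (\<Sum>i\<in>{0..<g}. deg (c (l + i))) - 4 * n * of_int g"
      by (simp add: h_def sum_subtractf flip: sum_distrib_left)
    finally have "q * deg (c (l - 1)) + q * deg (c l) + q * deg (c (l + 1)) - 12 * n
        \<le> q * (\<Sum>i\<in>{0..<g}. deg (c (l + i))) - 4 * n * of_int g"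
      by (simp add: h_def)
    then have "16 * (q * deg w) \<le> n * of_int (- 64 * (g - 1)) + q * (16 * (\<Sum>i\<in>{0..<g}. deg (c (l + i))))"
      using deg_far[OF far] by (simp add: algebra_simps)
    then have "fits w l ([], [-2, 0, 2], - 64 * (g - 1), replicate (2 * k + 1) 16, 0)"
      using 5 unfolding fits.simps sum by simp
    then show ?thesis by (rule found) (simp add: profiles_def Let_def)
  next
    case (6 l)
    have "fits w l ([], [0, 2], 16 * (6 * int k - 1) - 32 * (g - int (length [0, 2 :: int])), replicate (2 * k + 1) 0, us ! 1)"
      by (rule fits_few) (use 6 in simp_all)
    then show ?thesis by (rule found) (simp add: profiles_def Let_def)
  next
    case (7 l)
    have "fits w l ([], [-2, 2], 16 * (6 * int k - 1) - 32 * (g - int (length [-2, 2 :: int])), replicate (2 * k + 1) 0, us ! 1)"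
      by (rule fits_few) (use 7 in simp_all)
    then show ?thesis by (rule found) (simp add: profiles_def Let_def)
  next
    case (8 l)
    have "fits w l ([], [0], 16 * (6 * int k - 1) - 32 * (g - int (length [0 :: int])), replicate (2 * k + 1) 0, us ! 2)"
      by (rule fits_few) (use 8 in simp_all)
    then show ?thesis by (rule found) (simp add: profiles_def Let_def)
  next
    case (9 l)
    have "fits w l ([], [], 16 * (6 * int k - 1) - 32 * (g - int (length ([] :: int list))), replicate (2 * k + 1) 0, us ! 3)"
      by (rule fits_few) (use 9 in simp_all)
    then show ?thesis by (rule found) (simp add: profiles_def Let_def)
  qed
qed

end

section \<open>Conclusion\<close>

lemma (in max_odd_circuit) contradiction: False
proof -
  have "k \<in> {3, 4, 5, 6}" using k3 k_less_7 by auto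
  then obtain nu lam us where cert: "certificate k nu lam us"
    using certificate_3 certificate_4 certificate_5 certificate_6 by blast
  show False by (rule certificate_contradiction[OF cert profile_exists[OF cert]])
qed

section \<open>Choice of the circuit and transfer of the spectral gap\<close>

lemma odd_closed_walk_circuit:
  assumes "(u, u) \<in> R ^^ (2 * k + 1)"
  shows "\<exists>c. (\<forall>i. (c i, c (i + 1)) \<in> R) \<and> (\<forall>i. c (i mod (2 * int k + 1)) = c i)"
proof -
  let ?g = "2 * int k + 1"
  obtain f where f: "f 0 = u" "f (2 * k + 1) = u" "\<And>i. i < 2 * k + 1 \<Longrightarrow> (f i, f (Suc i)) \<in> R"
    using assms unfolding relpow_fun_conv by blast
  define c where "c i = f (nat (i mod ?g))" for i
  have "(c i, c (i + 1)) \<in> R" for i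
  proof -
    define r where "r = nat (i mod ?g)"
    have r: "i mod ?g = int r" "r < 2 * k + 1"
      using pos_mod_bound[of ?g i] by (simp_all add: r_def nat_less_iff)
    have "(i + 1) mod ?g = (int r + 1) mod ?g" unfolding r(1)[symmetric] by (simp add: mod_simps)
    also have "\<dots> = (if r = 2 * k then 0 else int (Suc r))" using r(2) by auto
    finally have "c (i + 1) = f (Suc r)" using f(1,2) by (auto simp: c_def nat_add_distrib)
    then show ?thesis using f(3)[OF r(2)] by (simp add: c_def r_def)
  qed
  moreover have "c (i mod ?g) = c i" for i by (simp add: c_def)
  ultimately show ?thesis by blast
qed

lemma no_odd_closed_walk_if_spectral_gap:
  fixes V :: "'a set"
  assumes fin: "finite V" and R_sub: "R \<subseteq> V \<times> V" and sym_R: "sym R" and k3: "3 \<le> k"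
    and no_short: "\<And>u t. (u, u) \<in> R ^^ t \<Longrightarrow> odd t \<Longrightarrow> 2 * k + 1 \<le> t"
    and gap: "\<And>f. 4 * (real (card V) * (\<Sum>v\<in>V. (f v)\<^sup>2) - (\<Sum>v\<in>V. f v)\<^sup>2)
      \<le> (6 * real k - 1) * ((\<Sum>(u, v)\<in>R. (f u - f v)\<^sup>2) / 2)"
  shows "(u, u) \<notin> R ^^ (2 * k + 1)"
proof
  assume u: "(u, u) \<in> R ^^ (2 * k + 1)"
  define circuit where "circuit c \<longleftrightarrow> (\<forall>i. (c i, c (i + 1)) \<in> R) \<and> (\<forall>i. c (i mod (2 * int k + 1)) = c i)" for c
  \<comment> \<open>Degree sums are kept as natural numbers so that boundedness alone yields a
    maximal circuit, although the circuits are functions on all integers.\<close>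
  define m where "m c = (\<Sum>j\<in>{0..<2 * int k + 1}. card {v. (c j, v) \<in> R})" for c
  have "card {v. (x, v) \<in> R} \<le> card V" for x
    using R_sub by (intro card_mono[OF fin]) auto
  then have "m c < Suc ((2 * k + 1) * card V)" for c
    using sum_bounded_above[of "{0..<2 * int k + 1}" "\<lambda>j. card {v. (c j, v) \<in> R}" "card V"]
    by (simp add: m_def nat_add_distrib nat_mult_distrib)
  moreover obtain c0 where "circuit c0"
    using odd_closed_walk_circuit[OF u] unfolding circuit_def by blast
  ultimately obtain c where c: "circuit c" "\<And>c'. circuit c' \<Longrightarrow> m c' \<le> m c"
    using ex_has_greatest_nat[of circuit c0 m] by metis
  interpret odd_circuit V R k c
    by unfold_locales (use fin R_sub sym_R k3 no_short gap c(1) in \<open>auto simp: circuit_def\<close>)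
  interpret max_odd_circuit V R k c
  proof
    fix c' assume "\<And>i. (c' i, c' (i + 1)) \<in> R" "\<And>i. c' (i mod g) = c' i"
    then have "m c' \<le> m c" by (intro c(2)) (simp add: circuit_def)
    then show "(\<Sum>j\<in>{0..<g}. deg (c' j)) \<le> (\<Sum>j\<in>{0..<g}. deg (c j))"
      unfolding m_def deg_def of_nat_sum[symmetric] by (simp only: of_nat_le_iff)
  qed
  show False by (rule contradiction)
qed

text \<open>The Rayleigh inequality is applied to \<open>f\<close> minus its mean, which leaves the
  energy unchanged; multiplying by the number of vertices clears the denominator.\<close>

lemma (in pair_graph) variance_le_energy:
  assumes V: "card (pverts G) \<ge> 2" and r: "0 < r" "4 * real (card (pverts G)) \<le> r * algebraic_connectivity G"
  shows "4 * (real (card (pverts G)) * (\<Sum>v\<in>pverts G. (f v)\<^sup>2) - (\<Sum>v\<in>pverts G. f v)\<^sup>2)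
    \<le> r * ((\<Sum>(u, v)\<in>parcs G. (f u - f v)\<^sup>2) / 2)"
proof -
  define N where "N = real (card (pverts G))"
  define s where "s = (\<Sum>v\<in>pverts G. f v)"
  define h where "h v = f v - s / N" for v
  have N: "N > 0" using V by (simp add: N_def)
  have "(\<Sum>v\<in>pverts G. h v) = 0"
    using N by (simp add: h_def sum_subtractf s_def[symmetric] N_def[symmetric])
  then have "algebraic_connectivity G * (\<Sum>v\<in>pverts G. (h v)\<^sup>2) \<le> (\<Sum>(u, v)\<in>parcs G. (h u - h v)\<^sup>2) / 2"
    by (rule algebraic_connectivity_rayleigh[OF V])
  then have "r * (algebraic_connectivity G * (\<Sum>v\<in>pverts G. (h v)\<^sup>2)) \<le> r * ((\<Sum>(u, v)\<in>parcs G. (f u - f v)\<^sup>2) / 2)"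
    using r(1) by (intro mult_left_mono) (simp_all add: h_def)
  moreover have "4 * N * (\<Sum>v\<in>pverts G. (h v)\<^sup>2) \<le> r * algebraic_connectivity G * (\<Sum>v\<in>pverts G. (h v)\<^sup>2)"
    using r(2) by (intro mult_right_mono sum_nonneg) (simp_all add: N_def)
  moreover have "N * (\<Sum>v\<in>pverts G. (h v)\<^sup>2) = N * (\<Sum>v\<in>pverts G. (f v)\<^sup>2) - s\<^sup>2"
  proof -
    have "(\<Sum>v\<in>pverts G. (h v)\<^sup>2) = (\<Sum>v\<in>pverts G. (f v)\<^sup>2 - 2 * (s / N) * f v + (s / N)\<^sup>2)"
      by (intro sum.cong refl) (simp add: h_def power2_diff)
    also have "\<dots> = (\<Sum>v\<in>pverts G. (f v)\<^sup>2) - 2 * (s / N) * s + N * (s / N)\<^sup>2"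
      unfolding sum.distrib sum_subtractf sum_distrib_left[symmetric] by (simp add: s_def N_def)
    finally show ?thesis using N by (simp add: field_simps power2_eq_square)
  qed
  ultimately show ?thesis unfolding N_def[symmetric] s_def[symmetric] by (simp add: mult.assoc)
qed

theorem theorem1p4:
  fixes G :: "'a pair_pre_digraph" and k n :: nat
  assumes "k \<ge> 3"
    and "pair_graph G"
    and "card (pverts G) = n"
    and "n \<ge> 2"
    and "odd_girth G \<ge> enat (2 * k + 1)"
    and "algebraic_connectivity G > 4 * real n / (6 * real k - 1)"
  shows "bipartite G"
proof (rule ccontr)
  assume not_bip: "\<not> bipartite G"
  interpret pair_graph G by fact
  define odd_closed where "odd_closed t \<longleftrightarrow> odd t \<and> (\<exists>u. (u, u) \<in> parcs G ^^ t)" for t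
  obtain t0 where "odd_closed t0"
    using not_bip bipartite_if_no_odd_closed_walk unfolding odd_closed_def by blast
  define t where "t = (LEAST t. odd_closed t)"
  have t: "odd_closed t" and least: "\<And>t'. odd_closed t' \<Longrightarrow> t \<le> t'"
    using \<open>odd_closed t0\<close> unfolding t_def by (auto intro: LeastI Least_le)
  then obtain k' where k': "t = 2 * k' + 1" unfolding odd_closed_def by (auto elim: oddE)
  obtain u where u: "(u, u) \<in> parcs G ^^ (2 * k' + 1)" using t k' by (auto simp: odd_closed_def)
  have "enat (2 * k + 1) \<le> enat t"
    using assms(5) odd_girth_le_odd_closed_walk t unfolding odd_closed_def by (meson order_trans)
  then have k: "k \<le> k'" using k' by simp
  have "4 * real n / (6 * real k' - 1) \<le> 4 * real n / (6 * real k - 1)"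
    using k assms(1) by (intro divide_left_mono) auto
  then have "4 * real n / (6 * real k' - 1) \<le> algebraic_connectivity G" using assms(6) by simp
  then have "4 * real (card (pverts G)) \<le> (6 * real k' - 1) * algebraic_connectivity G"
    using k assms(1,3) by (simp add: divide_le_eq mult.commute)
  then have gap: "4 * (real (card (pverts G)) * (\<Sum>v\<in>pverts G. (f v)\<^sup>2) - (\<Sum>v\<in>pverts G. f v)\<^sup>2)
      \<le> (6 * real k' - 1) * ((\<Sum>(u, v)\<in>parcs G. (f u - f v)\<^sup>2) / 2)" for f
    by (rule variance_le_energy[rotated 2]) (use k assms(1,3,4) in simp_all)
  have "(u, u) \<notin> parcs G ^^ (2 * k' + 1)"
  proof (rule no_odd_closed_walk_if_spectral_gap[where V = "pverts G", OF _ _ parcs_sym])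
    show "2 * k' + 1 \<le> t'" if "(v, v) \<in> parcs G ^^ t'" "odd t'" for v t'
      using least[of t'] that k' by (auto simp: odd_closed_def)
  qed (use k assms(1) gap in \<open>auto dest: in_arcsD1 in_arcsD2\<close>)
  then show False using u by blast
qed

end
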